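(* There is an algorithm that computes all minimal models of a given 3-CNF theory, and there is an algorithm that computes all answer sets of a given disjunctive 3-program, each running in time $O(m n^2\, d^n)$, where $d = 2.2782\ldots$, $n$ is the number of atoms and $m$ the size of the input.
   Context: A 3-CNF theory is a finite set of propositional clauses each with at most 3 literals (no repeated literal, no complementary pair in a clause); a minimal model is a model (set of true atoms) no proper subset of which is a model. A disjunctive 3-program is a finite set of clauses $a_1\vee\cdots\vee a_p \leftarrow b_1,\ldots,b_r,\mathbf{not}(c_1),\ldots,\mathbf{not}(c_s)$ with $p+r+s\le 3$; an answer set of $P$ is a set $M$ of atoms that is a minimal model of the Gelfond–Lifschitz reduct $P^M$. $n$ is the number of atoms, $m$ the total number of atom occurrences in the input. The constant is $d = c\cdot 1.481^{\beta}\approx 2.2782$, where $c=1.6701\ldots$ is the real $\tau>1$ for which some $\alpha\in(0,1)$ makes $\tau$ simultaneously the root greater than 1 of $\tau^{-1+\alpha}+\tau^{-4+3\alpha}+2\tau^{-6+4\alpha}+\tau^{-8+5\alpha}=1$ and of $\tau^{-1}+\tau^{-1-4\alpha}=1$, and $\beta=0.7907\ldots$ is the smallest $\beta'\ge 0.6$ with $\binom{n}{\lceil \beta' n\rceil}=O(c^n)$.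
   Formalization: The constant d = c·1.481^β as defined equals 2.27840…, so the printed expansion 2.2782… is a rounding slip; the time bounds are stated for the defined d, and "d = 2.2782…" is replaced by |d − 2.2782| < 0.0005. *)

theory Defs
  imports Complex_Main "HOL-Library.Landau_Symbols"
begin

section \<open>Theories, programs, minimal models, answer sets\<close>

type_synonym atom = nat

datatype literal = Pos atom | Neg atom

type_synonym clause = "literal set"

fun atom_of :: "literal \<Rightarrow> atom" where
  "atom_of (Pos a) = a"
| "atom_of (Neg a) = a"

fun lit_true :: "atom set \<Rightarrow> literal \<Rightarrow> bool" where
  "lit_true M (Pos a) \<longleftrightarrow> a \<in> M"
| "lit_true M (Neg a) \<longleftrightarrow> a \<notin> M"

definition cnf3 :: "clause set \<Rightarrow> bool" where
  "cnf3 T \<longleftrightarrow> finite T \<and>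
     (\<forall>C\<in>T. finite C \<and> card C \<le> 3 \<and> \<not> (\<exists>a. Pos a \<in> C \<and> Neg a \<in> C))"

definition cnf_model :: "clause set \<Rightarrow> atom set \<Rightarrow> bool" where
  "cnf_model T M \<longleftrightarrow> (\<forall>C\<in>T. \<exists>l\<in>C. lit_true M l)"

definition minimal_set :: "(atom set \<Rightarrow> bool) \<Rightarrow> atom set \<Rightarrow> bool" where
  "minimal_set Q M \<longleftrightarrow> Q M \<and> \<not> (\<exists>N. N \<subset> M \<and> Q N)"

definition minimal_models :: "clause set \<Rightarrow> atom set set" where
  "minimal_models T = {M. minimal_set (cnf_model T) M}"

definition cnf_atoms :: "clause set \<Rightarrow> atom set" where
  "cnf_atoms T = (\<Union>C\<in>T. atom_of ` C)"

definition cnf_size :: "clause set \<Rightarrow> nat" where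
  "cnf_size T = (\<Sum>C\<in>T. card C)"

text \<open>
  The triple \<open>(A, B, C)\<close> stands for the rule with head disjunction \<open>A\<close>, positive body \<open>B\<close>
  and negated body \<open>C\<close>. An empty head (an integrity constraint) is allowed.
\<close>

type_synonym rule = "atom set \<times> atom set \<times> atom set"

definition program3 :: "rule set \<Rightarrow> bool" where
  "program3 P \<longleftrightarrow> finite P \<and>
     (\<forall>(A, B, C)\<in>P. finite A \<and> finite B \<and> finite C \<and> card A + card B + card C \<le> 3)"

definition program_model :: "rule set \<Rightarrow> atom set \<Rightarrow> bool" where
  "program_model P M \<longleftrightarrow>
     (\<forall>(A, B, C)\<in>P. B \<subseteq> M \<and> C \<inter> M = {} \<longrightarrow> A \<inter> M \<noteq> {})"

definition reduct :: "rule set \<Rightarrow> atom set \<Rightarrow> rule set" where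
  "reduct P M = {(A, B, {}) | A B. \<exists>C. (A, B, C) \<in> P \<and> C \<inter> M = {}}"

definition answer_sets :: "rule set \<Rightarrow> atom set set" where
  "answer_sets P = {M. minimal_set (program_model (reduct P M)) M}"

definition program_atoms :: "rule set \<Rightarrow> atom set" where
  "program_atoms P = (\<Union>(A, B, C)\<in>P. A \<union> B \<union> C)"

definition program_size :: "rule set \<Rightarrow> nat" where
  "program_size P = (\<Sum>(A, B, C)\<in>P. card A + card B + card C)"


section \<open>Random access machines\<close>

text \<open>
  Unit-cost random access machine with addition and truncated subtraction. A program uses
  finitely many registers, which address an unbounded memory, and an append-only output tape.
  The machine halts by leaving the program text.
\<close>

datatype instr =
    Const nat nat      \<comment> \<open>\<open>Const r k\<close>: \<open>r := k\<close>\<close>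
  | Add nat nat nat    \<comment> \<open>\<open>Add r s u\<close>: \<open>r := s + u\<close>\<close>
  | Sub nat nat nat    \<comment> \<open>\<open>Sub r s u\<close>: \<open>r := s - u\<close>\<close>
  | Load nat nat       \<comment> \<open>\<open>Load r s\<close>: \<open>r := mem[s]\<close>\<close>
  | Store nat nat      \<comment> \<open>\<open>Store r s\<close>: \<open>mem[r] := s\<close>\<close>
  | Jle nat nat nat    \<comment> \<open>\<open>Jle r s l\<close>: if \<open>r \<le> s\<close> goto \<open>l\<close>\<close>
  | Write nat

record config =
  pc :: nat
  reg :: "nat \<Rightarrow> nat"
  mem :: "nat \<Rightarrow> nat"
  out :: "nat list"

fun exec :: "instr \<Rightarrow> config \<Rightarrow> config" where
  "exec (Const r k) c = c\<lparr>pc := Suc (pc c), reg := (reg c)(r := k)\<rparr>"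
| "exec (Add r s u) c = c\<lparr>pc := Suc (pc c), reg := (reg c)(r := reg c s + reg c u)\<rparr>"
| "exec (Sub r s u) c = c\<lparr>pc := Suc (pc c), reg := (reg c)(r := reg c s - reg c u)\<rparr>"
| "exec (Load r s) c = c\<lparr>pc := Suc (pc c), reg := (reg c)(r := mem c (reg c s))\<rparr>"
| "exec (Store r s) c = c\<lparr>pc := Suc (pc c), mem := (mem c)(reg c r := reg c s)\<rparr>"
| "exec (Jle r s l) c = c\<lparr>pc := (if reg c r \<le> reg c s then l else Suc (pc c))\<rparr>"
| "exec (Write r) c = c\<lparr>pc := Suc (pc c), out := out c @ [reg c r]\<rparr>"

definition halted :: "instr list \<Rightarrow> config \<Rightarrow> bool" where
  "halted prog c \<longleftrightarrow> length prog \<le> pc c"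

definition step :: "instr list \<Rightarrow> config \<Rightarrow> config" where
  "step prog c = (if halted prog c then c else exec (prog ! pc c) c)"

definition init :: "nat list \<Rightarrow> config" where
  "init x = \<lparr>pc = 0, reg = (\<lambda>_. 0)(0 := length x),
             mem = (\<lambda>i. if i < length x then x ! i else 0), out = []\<rparr>"

definition run :: "instr list \<Rightarrow> nat list \<Rightarrow> nat \<Rightarrow> config" where
  "run prog x t = (step prog ^^ t) (init x)"

text \<open>
  On input \<open>x\<close> the machine halts after at most \<open>t\<close> steps with output \<open>y\<close>, and all words
  occurring in the computation are at most \<open>w\<close>.
\<close>

definition computes :: "instr list \<Rightarrow> nat list \<Rightarrow> nat list \<Rightarrow> nat \<Rightarrow> nat \<Rightarrow> bool" where
  "computes prog x y t w \<longleftrightarrow> halted prog (run prog x t) \<and> out (run prog x t) = y \<and>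
     (\<forall>s\<le>t. \<forall>i. reg (run prog x s) i \<le> w \<and> mem (run prog x s) i \<le> w)"

text \<open>
  \<open>prog\<close> computes the function \<open>F\<close> in time \<open>O(f)\<close>, for a given representation \<open>repI\<close> of the
  inputs and \<open>repO\<close> of the outputs by words. The machine word is restricted to a number of bits
  that is logarithmic in the input (its length and its largest entry) and the running time, so
  that unit cost cannot be abused by computing with very long numbers. The maximum
  with 1 only matters for inputs without atoms, where the time bounds used below vanish.
\<close>

definition computes_in_time ::
  "instr list \<Rightarrow> (nat list \<Rightarrow> 'i \<Rightarrow> bool) \<Rightarrow> (nat list \<Rightarrow> 'o \<Rightarrow> bool) \<Rightarrow>
     ('i \<Rightarrow> 'o) \<Rightarrow> ('i \<Rightarrow> real) \<Rightarrow> bool" where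
  "computes_in_time prog repI repO F f \<longleftrightarrow>
     (\<exists>(K::real) (k::nat). \<forall>i x. repI x i \<longrightarrow>
        (\<exists>t y. computes prog x y t ((2 + length x + Max (insert 0 (set x)) + t) ^ k) \<and>
               repO y (F i) \<and> real t \<le> K * max 1 (f i)))"


section \<open>Representation of inputs and outputs\<close>

text \<open>
  Finite sets are given by repetition-free lists in an arbitrary order, and lists are
  preceded by their length. The output is a bare sequence of such lists of atoms.
\<close>

fun encode_literal :: "literal \<Rightarrow> nat list" where
  "encode_literal (Pos a) = [1, a]"
| "encode_literal (Neg a) = [0, a]"

definition encode_cnf :: "literal list list \<Rightarrow> nat list" where
  "encode_cnf Cs = length Cs # concat (map (\<lambda>C. length C # concat (map encode_literal C)) Cs)"

definition represents_cnf3 :: "nat list \<Rightarrow> clause set \<Rightarrow> bool" where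
  "represents_cnf3 x T \<longleftrightarrow> cnf3 T \<and>
     (\<exists>Cs. x = encode_cnf Cs \<and> (\<forall>C\<in>set Cs. distinct C) \<and>
           distinct (map set Cs) \<and> set (map set Cs) = T)"

definition encode_program :: "(atom list \<times> atom list \<times> atom list) list \<Rightarrow> nat list" where
  "encode_program Rs = length Rs #
     concat (map (\<lambda>(A, B, C). length A # A @ length B # B @ length C # C) Rs)"

definition represents_program3 :: "nat list \<Rightarrow> rule set \<Rightarrow> bool" where
  "represents_program3 x P \<longleftrightarrow> program3 P \<and>
     (\<exists>Rs. x = encode_program Rs \<and>
           (\<forall>(A, B, C)\<in>set Rs. distinct A \<and> distinct B \<and> distinct C) \<and>
           distinct (map (\<lambda>(A, B, C). (set A, set B, set C)) Rs) \<and>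
           set (map (\<lambda>(A, B, C). (set A, set B, set C)) Rs) = P)"

definition represents_family :: "nat list \<Rightarrow> atom set set \<Rightarrow> bool" where
  "represents_family y \<M> \<longleftrightarrow>
     (\<exists>Ms. y = concat (map (\<lambda>M. length M # M) Ms) \<and> (\<forall>M\<in>set Ms. distinct M) \<and>
           distinct (map set Ms) \<and> set (map set Ms) = \<M>)"


section \<open>The constant in the time bound\<close>

definition c_const :: real where
  "c_const = (THE \<tau>. 1 < \<tau> \<and> (\<exists>\<alpha>. 0 < \<alpha> \<and> \<alpha> < 1 \<and>
     \<tau> powr (-1 + \<alpha>) + \<tau> powr (-4 + 3 * \<alpha>) + 2 * \<tau> powr (-6 + 4 * \<alpha>) + \<tau> powr (-8 + 5 * \<alpha>) = 1 \<and>
     \<tau> powr (-1) + \<tau> powr (-1 - 4 * \<alpha>) = 1))"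

definition \<beta>_const :: real where
  "\<beta>_const = (LEAST \<beta>. 0.6 \<le> \<beta> \<and>
     (\<lambda>n::nat. real (n choose nat \<lceil>\<beta> * real n\<rceil>)) \<in> O(\<lambda>n. c_const ^ n))"

text \<open>
  Numerically \<open>c = 1.67016\<dots>\<close>, \<open>\<beta> = 0.79078\<dots>\<close> and \<open>d = 2.27840\<dots>\<close>; the value 2.2782 usually
  quoted for \<open>d\<close> results from truncating \<open>c\<close> and \<open>\<beta>\<close> to four decimals first.
\<close>

definition d_const :: real where
  "d_const = c_const * 1.481 powr \<beta>_const"

end

theory Submission
  imports Defs "HOL-Library.Countable" "HOL-Combinatorics.Multiset_Permutations"
begin

text \<open>
  Minimal models of a clause set are the answer sets of a program without negation, so one
  algorithm serves both problems. It runs through all sets \<open>M\<close> of atoms. If \<open>M\<close> is a model and no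
  \<open>M - {a}\<close> is a model of the reduct \<open>P^M\<close>, it searches for a model \<open>N \<subset> M\<close> of \<open>P^M\<close> in two ways.
  Shrinking starts from \<open>M - {a}\<close> and repairs the first violated rule by deleting one of its body
  atoms; as \<open>M\<close> satisfies the rule, at least one of the three positions is a head, so there are at
  most two choices. Growing starts from the empty set and repairs by adding one of at most three head
  atoms. With \<open>k = card M\<close>, either \<open>card (M - N)\<close> is at most about \<open>5k/8\<close> or \<open>card N\<close> is at most
  \<open>3k/8\<close>, so \<open>2^(5k/8) + 3^(3k/8) = O(1.543^k)\<close> choice sequences suffice.

  The number of sets \<open>M\<close> that reach the search is bounded by the coding argument of Paturi, Pudlak
  and Zane: every \<open>a \<in> M\<close> has a critical rule on at most three atoms, and in a random order of the
  atoms it is the last of them with probability at least \<open>1/3\<close>, in which case its value is forced.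
  Coding true atoms with probability \<open>p\<close> gives \<open>(\<Sum>M. p^(2k/3) * (1 - p)^(n - k)) \<le> 1\<close>, and
  \<open>p = 51/91\<close> turns this into \<open>(\<Sum>M. 1.543^k) \<le> 2.275^n\<close>, where \<open>2.275 < d\<close>.
\<close>


text \<open>The deletion test takes polynomial time, yet it is what supplies the critical rules.
  Bounding the number of surviving sets and the cost of one search separately would lose too much,
  so each survivor is counted with weight 1.543^k, its search cost. The constants follow from this
  product. Balancing 2^(xk) against 3^((1-x)k) gives x = ln 3 / ln 6 = 0.613 and base 1.53; 5/8 is a
  nearby fraction that a counter modulo 8 can realise, and 2^(5/8) < 1.543. Turning coding weights
  into search costs needs p^(2/3) \<ge> 1.543 (1 - p), while the total has base 1 / (1 - p), so p is
  chosen near the least admissible value; 1 / (1 - 51/91) = 91/40 = 2.275. The gap between 2.275 and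
  d is not spent on polynomial factors: one n comes from the deleted atom a, and m n from a single
  choice sequence. Two obstacles shape the rest. The number d is defined through an implicit root
  and an asymptotic minimum, so even 2.275 < d needs analysis. And the time bound concerns machine
  code with short words, so the algorithm is written in a small language whose costs are exactly
  those of its compiled code.\<close>

section \<open>The constant d\<close>

text \<open>
  With \<open>s = \<tau> powr \<alpha>\<close> the second equation reads \<open>s ^ 4 * (\<tau> - 1) = 1\<close>. Eliminating \<open>\<alpha>\<close> leaves a
  function of \<open>\<tau>\<close> that is strictly decreasing, so the solution is unique.
\<close>

definition alpha_pow :: "real \<Rightarrow> real" where "alpha_pow t = root 4 (1 / (t - 1))"

definition first_eq :: "real \<Rightarrow> real" where
  "first_eq t = alpha_pow t / t + alpha_pow t ^ 3 / t ^ 4 + 2 * alpha_pow t ^ 4 / t ^ 6 + alpha_pow t ^ 5 / t ^ 8"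

lemma alpha_pow_pos: "1 < t \<Longrightarrow> 0 < alpha_pow t" by (simp add: alpha_pow_def)

lemma alpha_pow_pow4: "1 < t \<Longrightarrow> alpha_pow t ^ 4 = 1 / (t - 1)" by (simp add: alpha_pow_def)

lemma alpha_pow_less: "1 < t \<Longrightarrow> t < u \<Longrightarrow> alpha_pow u < alpha_pow t"
  by (auto simp: alpha_pow_def intro!: real_root_less_mono divide_strict_left_mono)

text \<open>Every summand has a power of the positive decreasing function \<open>alpha_pow\<close>
  above a power of the increasing variable.\<close>

lemma first_eq_less:
  assumes "1 < t" "t < u"
  shows "first_eq u < first_eq t"
proof -
  have s: "0 < alpha_pow u" "alpha_pow u < alpha_pow t" using assms alpha_pow_pos alpha_pow_less by auto
  have frac: "alpha_pow u ^ Suc j / u ^ i < alpha_pow t ^ Suc j / t ^ i" for i j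
    using assms s by (intro frac_less power_mono power_strict_mono) auto
  show ?thesis
    using frac[of 0 1] frac[of 2 4] frac[of 3 6] frac[of 4 8] by (simp add: first_eq_def eval_nat_numeral)
qed

lemma powr_eqs:
  assumes "1 < (t::real)"
  shows "t powr (-1 + a) = t powr a / t" "t powr (-4 + 3 * a) = (t powr a) ^ 3 / t ^ 4"
    "t powr (-6 + 4 * a) = (t powr a) ^ 4 / t ^ 6" "t powr (-8 + 5 * a) = (t powr a) ^ 5 / t ^ 8"
    "t powr (-1 - 4 * a) = 1 / (t * (t powr a) ^ 4)" "t powr (-1) = 1 / t"
proof -
  have mul: "(t powr a) ^ k = t powr (real k * a)" for k
    using assms by (simp add: powr_realpow[symmetric] powr_powr mult.commute)
  have gen: "t powr (- real i + real j * a) = (t powr a) ^ j / t ^ i" for i j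
  proof -
    have "- real i + real j * a = real j * a - real i" by simp
    then show ?thesis using assms by (simp only: powr_diff mul powr_realpow)
  qed
  show "t powr (-1 + a) = t powr a / t" using gen[of 1 1] by simp
  show "t powr (-4 + 3 * a) = (t powr a) ^ 3 / t ^ 4" using gen[of 4 3] by simp
  show "t powr (-6 + 4 * a) = (t powr a) ^ 4 / t ^ 6" using gen[of 6 4] by simp
  show "t powr (-8 + 5 * a) = (t powr a) ^ 5 / t ^ 8" using gen[of 8 5] by simp
  show "t powr (-1 - 4 * a) = 1 / (t * (t powr a) ^ 4)"
    using assms mul[of 4] by (simp add: powr_diff powr_minus field_simps)
  show "t powr (-1) = 1 / t" using assms by (simp add: powr_minus field_simps)
qed

lemma second_eq_iff:
  assumes "1 < (t::real)"
  shows "t powr (-1) + t powr (-1 - 4 * a) = 1 \<longleftrightarrow> t powr a = alpha_pow t"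
proof -
  have y: "0 < t powr a" using assms by simp
  have "t powr (-1) + t powr (-1 - 4 * a) = 1 \<longleftrightarrow> (t powr a) ^ 4 = 1 / (t - 1)"
    unfolding powr_eqs[OF assms] using assms y by (simp add: field_simps)
  also have "\<dots> \<longleftrightarrow> (t powr a) ^ 4 = alpha_pow t ^ 4" using assms by (simp add: alpha_pow_pow4)
  also have "\<dots> \<longleftrightarrow> t powr a = alpha_pow t"
    using y alpha_pow_pos[OF assms] by (intro power_eq_iff_eq_base) auto
  finally show ?thesis .
qed

lemma first_eq_gt: "1 < first_eq 1.6701"
proof -
  have s4: "alpha_pow 1.6701 ^ 4 = 1 / 0.6701" using alpha_pow_pow4[of "1.6701"] by simp
  \<comment> \<open>The fourth root of 1 / 0.6701 is 1.105261..., and rounding it down to five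
    decimals still leaves the sum above 1.\<close>
  have L: "1.10526 \<le> alpha_pow 1.6701"
  proof (rule ccontr)
    assume "\<not> 1.10526 \<le> alpha_pow 1.6701"
    then have "alpha_pow 1.6701 ^ 4 < 1.10526 ^ 4" using alpha_pow_pos[of "1.6701"] by (intro power_strict_mono) auto
    then show False unfolding s4 by (simp add: field_simps)
  qed
  have "1 < (1.10526::real) / 1.6701 + 1.10526 ^ 3 / 1.6701 ^ 4 + 2 * 1.10526 ^ 4 / 1.6701 ^ 6 + 1.10526 ^ 5 / 1.6701 ^ 8"
    by (simp add: field_simps)
  also have "\<dots> \<le> first_eq 1.6701" unfolding first_eq_def
    using L by (intro add_mono divide_right_mono mult_left_mono power_mono) auto
  finally show ?thesis .
qed

lemma first_eq_lt: "first_eq 1.6702 < 1"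
proof -
  have s4: "alpha_pow 1.6702 ^ 4 = 1 / 0.6702" using alpha_pow_pow4[of "1.6702"] by simp
  have L: "alpha_pow 1.6702 \<le> 1.10523"
  proof (rule ccontr)
    assume "\<not> alpha_pow 1.6702 \<le> 1.10523"
    then have "1.10523 ^ 4 < alpha_pow 1.6702 ^ 4" by (intro power_strict_mono) auto
    then show False unfolding s4 by (simp add: field_simps)
  qed
  have "first_eq 1.6702 \<le> 1.10523 / 1.6702 + 1.10523 ^ 3 / 1.6702 ^ 4 + 2 * 1.10523 ^ 4 / 1.6702 ^ 6 + 1.10523 ^ 5 / 1.6702 ^ 8"
    unfolding first_eq_def using L alpha_pow_pos[of "1.6702"]
    by (intro add_mono divide_right_mono mult_left_mono power_mono) auto
  also have "\<dots> < 1" by (simp add: field_simps)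
  finally show ?thesis .
qed

lemma c_const_bounds: "1.6701 < c_const" "c_const < 1.6702"
proof -
  have cont: "continuous_on {1.6701..1.6702} first_eq"
    unfolding first_eq_def[abs_def] alpha_pow_def[abs_def] by (intro continuous_intros) auto
  obtain t where t: "1.6701 \<le> t" "t \<le> 1.6702" "first_eq t = 1"
    using IVT2'[of first_eq "1.6702" 1 "1.6701"] first_eq_gt first_eq_lt cont by auto
  have t1: "1 < t" using t by simp
  \<comment> \<open>Since \<alpha> will be the logarithm of \<open>alpha_pow t\<close> to base t,
    the bounds 1 < \<open>alpha_pow t\<close> < t are what place it strictly between 0 and
    1.\<close>
  have s1: "1 < alpha_pow t"
  proof (rule ccontr)
    assume "\<not> 1 < alpha_pow t"
    then have "alpha_pow t ^ 4 \<le> 1" using alpha_pow_pos[OF t1] by (intro power_le_one) auto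
    then show False using alpha_pow_pow4[OF t1] t by (simp add: field_simps)
  qed
  have st: "alpha_pow t < t"
  proof (rule ccontr)
    assume "\<not> alpha_pow t < t"
    then have "1.6701 ^ 4 \<le> alpha_pow t ^ 4" using t by (intro power_mono) auto
    also have "\<dots> \<le> 1 / 0.6701" unfolding alpha_pow_pow4[OF t1] using t by (intro divide_left_mono) auto
    finally show False by (simp add: field_simps)
  qed
  define a where "a = log t (alpha_pow t)"
  have a: "t powr a = alpha_pow t" using t1 alpha_pow_pos[OF t1] by (simp add: a_def)
  have a01: "0 < a" "a < 1" using s1 st t1 by (auto simp: a_def)
  have eq1: "t powr (-1 + b) + t powr (-4 + 3 * b) + 2 * t powr (-6 + 4 * b) + t powr (-8 + 5 * b) = first_eq t"
    if "t powr b = alpha_pow t" "1 < t" for t b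
    unfolding powr_eqs[OF that(2)] that(1) first_eq_def by simp
  have "c_const = t" unfolding c_const_def
  proof (rule the_equality)
    show "1 < t \<and> (\<exists>\<alpha>. 0 < \<alpha> \<and> \<alpha> < 1 \<and>
      t powr (-1 + \<alpha>) + t powr (-4 + 3 * \<alpha>) + 2 * t powr (-6 + 4 * \<alpha>) + t powr (-8 + 5 * \<alpha>) = 1 \<and>
      t powr (-1) + t powr (-1 - 4 * \<alpha>) = 1)"
    proof (intro conjI exI[of _ a])
      show "t powr (-1) + t powr (-1 - 4 * a) = 1" using second_eq_iff[OF t1, of a] a by (rule iffD2)
      show "t powr (-1 + a) + t powr (-4 + 3 * a) + 2 * t powr (-6 + 4 * a) + t powr (-8 + 5 * a) = 1"
        using eq1[OF a t1] t(3) by (rule trans)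
    qed (use t1 a01 in auto)
  next
    fix u :: real
    assume u: "1 < u \<and> (\<exists>\<alpha>. 0 < \<alpha> \<and> \<alpha> < 1 \<and>
      u powr (-1 + \<alpha>) + u powr (-4 + 3 * \<alpha>) + 2 * u powr (-6 + 4 * \<alpha>) + u powr (-8 + 5 * \<alpha>) = 1 \<and>
      u powr (-1) + u powr (-1 - 4 * \<alpha>) = 1)"
    then obtain b where b: "u powr (-1 + b) + u powr (-4 + 3 * b) + 2 * u powr (-6 + 4 * b) + u powr (-8 + 5 * b) = 1"
      "u powr (-1) + u powr (-1 - 4 * b) = 1" and u1: "1 < u" by (elim exE conjE)
    have "u powr b = alpha_pow u" using second_eq_iff[OF u1, of b] b(2) by (rule iffD1)
    then have "first_eq u = 1" using eq1[of u b] u1 b(1) by (simp only:)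
    then show "u = t" using first_eq_less[of u t] first_eq_less[of t u] t1 u1 t(3) by (cases u t rule: linorder_cases) simp_all
  qed
  moreover have "t \<noteq> 1.6701" "t \<noteq> 1.6702" using t(3) first_eq_gt first_eq_lt by fastforce+
  ultimately show "1.6701 < c_const" "c_const < 1.6702" using t(1,2) by linarith+
qed

section \<open>Binary entropy, growth of binomial coefficients and the exponent \<beta>\<close>

definition entropy :: "real \<Rightarrow> real" where
  "entropy x = - (x * ln x + (1 - x) * ln (1 - x))"

lemma entropy_deriv:
  assumes "0 < x" "x < 1"
  shows "(entropy has_real_derivative ln (1 - x) - ln x) (at x)"
  unfolding entropy_def[abs_def] using assms
  by (auto intro!: derivative_eq_intros)

lemma entropy_less:
  assumes "1 / 2 \<le> x" "x < y" "y < 1"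
  shows "entropy y < entropy x"
\<comment> \<open>The derivative vanishes at 1/2, a possible left end point, so its sign is used on
  the open interval only.\<close>
proof (rule DERIV_neg_imp_decreasing_open[OF assms(2)])
  fix z assume z: "x < z" "z < y"
  then have "ln (1 - z) < ln z" using assms by (subst ln_less_cancel_iff) auto
  then show "\<exists>d. (entropy has_real_derivative d) (at z) \<and> d < 0"
    using entropy_deriv[of z] z assms by (intro exI[of _ "ln (1 - z) - ln z"]) auto
next
  show "continuous_on {x..y} entropy"
    using assms by (intro continuous_at_imp_continuous_on ballI DERIV_isCont[OF entropy_deriv]) auto
qed

lemma binomial_term_le_one:
  assumes "0 \<le> x" "x \<le> (1::real)" "k \<le> n"
  shows "real (n choose k) * x ^ k * (1 - x) ^ (n - k) \<le> 1"
proof -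
  have "real (n choose k) * x ^ k * (1 - x) ^ (n - k) \<le> (\<Sum>j\<le>n. real (n choose j) * x ^ j * (1 - x) ^ (n - j))"
    by (rule member_le_sum) (use assms in auto)
  also have "\<dots> = (x + (1 - x)) ^ n" by (rule binomial_ring[symmetric])
  finally show ?thesis by simp
qed

text \<open>These are the probabilities of the binomial distribution with success rate k/n, scaled
  by n^n to stay in the natural numbers. Its mode is k because the ratio of consecutive terms passes
  1 there.\<close>

lemma binomial_mode:
  assumes "k \<le> n" "j \<le> n"
  shows "(n choose j) * k ^ j * (n - k) ^ (n - j) \<le> (n choose k) * k ^ k * (n - k) ^ (n - k)"
proof -
  let ?t = "\<lambda>j. (n choose j) * k ^ j * (n - k) ^ (n - j)"
  have absorb: "(n choose Suc i) * Suc i = (n choose i) * (n - i)" for i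
    using binomial_absorb_comp[of n i] binomial_absorption[of i n] by (simp only: mult.commute)
  have ratio: "?t (Suc i) * (Suc i * (n - k)) = ?t i * ((n - i) * k)" if "i < n" for i
  proof -
    have "(n - k) ^ (n - i) = (n - k) ^ (n - Suc i) * (n - k)" using that by (simp add: Suc_diff_Suc flip: power_Suc2)
    then have "?t i * ((n - i) * k) = ((n choose i) * (n - i)) * (k ^ Suc i * ((n - k) ^ (n - Suc i) * (n - k)))"
      by (simp only: power_Suc mult.assoc mult.commute mult.left_commute)
    also have "\<dots> = ((n choose Suc i) * Suc i) * (k ^ Suc i * ((n - k) ^ (n - Suc i) * (n - k)))"
      by (simp only: absorb)
    also have "\<dots> = ?t (Suc i) * (Suc i * (n - k))"
      by (simp only: power_Suc mult.assoc mult.commute mult.left_commute)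
    finally show ?thesis ..
  qed
  show ?thesis
  proof (cases "k = n \<or> k = 0")
    case True
    then show ?thesis using assms by (auto simp: power_0_left)
  next
    case False
    then have k: "0 < k" "k < n" using assms by auto
    have up: "?t i \<le> ?t (Suc i)" if "i < k" for i
    proof -
      have "Suc i * (n - k) \<le> (n - i) * k"
        using mult_le_mono[of "Suc i" k "n - k" "n - i"] that k by (simp add: mult.commute)
      then have "?t i * (Suc i * (n - k)) \<le> ?t i * ((n - i) * k)" by (rule mult_le_mono2)
      also have "\<dots> = ?t (Suc i) * (Suc i * (n - k))" by (rule ratio[symmetric]) (use that k in simp)
      finally show ?thesis using k by (simp only: mult_le_cancel2) auto
    qed
    have down: "?t (Suc i) \<le> ?t i" if "k \<le> i" "i < n" for i
    proof -
      have "(n - i) * k \<le> Suc i * (n - k)"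
        using mult_le_mono[of k "Suc i" "n - i" "n - k"] that k by (simp add: mult.commute)
      then have "?t i * ((n - i) * k) \<le> ?t i * (Suc i * (n - k))" by (rule mult_le_mono2)
      then have "?t (Suc i) * (Suc i * (n - k)) \<le> ?t i * (Suc i * (n - k))" by (simp only: ratio[OF that(2)])
      then show ?thesis using k by (simp only: mult_le_cancel2) auto
    qed
    show ?thesis
    proof (cases "j \<le> k")
      case True
      then show ?thesis
      proof (induction rule: inc_induct)
        case (step i)
        then show ?case using le_trans[OF up[OF step(2)] step(3)] by blast
      qed simp
    next
      case False
      then have "k \<le> j" by simp
      then show ?thesis using assms(2)
      proof (induction rule: dec_induct)
        case (step i)
        then have "i < n" by simp
        from le_trans[OF down[OF step(1) this] step.IH] this show ?case by simp
      qed simp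
    qed
  qed
qed

text \<open>At rational points the entropy turns into a product of rational powers. This serves the
  estimate of binomial coefficients and also reduces the comparison of an entropy with ln c to
  integer powers of rationals.\<close>

lemma exp_entropy:
  assumes "0 < p" "0 < r" "q = p + r"
  shows "exp (real q * entropy (real p / real q)) = (real q / real p) ^ p * (real q / real r) ^ r"
proof -
  have n: "real q > 0" "real p > 0" "real r > 0" using assms by auto
  have eq: "1 - real p / real q = real r / real q" using n assms(3) by (simp add: field_simps)
  have "real q * entropy (real p / real q) =
      - (real p * ln (real p / real q) + real r * ln (real r / real q))"
    unfolding entropy_def eq using n by (simp add: right_diff_distrib)
  also have "\<dots> = real p * ln (real q / real p) + real r * ln (real q / real r)"
    using n by (simp only: ln_div) (simp add: algebra_simps)
  finally have "exp (real q * entropy (real p / real q)) =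
    exp (real p * ln (real q / real p)) * exp (real r * ln (real q / real r))"
    by (simp only: exp_add)
  then show ?thesis using n by (simp only: exp_of_nat_mult exp_ln divide_pos_pos)
qed

text \<open>Of the n + 1 terms of (k + (n - k))^n the one with index k is the largest, so it is at
  least the (n + 1)-th part of n^n.\<close>

lemma binomial_ge_entropy:
  assumes "0 < k" "k < n"
  shows "exp (real n * entropy (real k / real n)) \<le> real (n + 1) * real (n choose k)"
proof -
  have "n ^ n = (\<Sum>j\<le>n. (n choose j) * k ^ j * (n - k) ^ (n - j))"
    using binomial[of k "n - k" n] assms by simp
  also have "\<dots> \<le> (\<Sum>j\<le>n. (n choose k) * k ^ k * (n - k) ^ (n - k))"
    using assms by (intro sum_mono binomial_mode) auto
  also have "\<dots> = (n + 1) * (n choose k) * (k ^ k * (n - k) ^ (n - k))" by (simp add: algebra_simps)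
  finally have "real (n ^ n) \<le> real ((n + 1) * (n choose k) * (k ^ k * (n - k) ^ (n - k)))"
    by (simp only: of_nat_le_iff)
  then have main: "real n ^ n \<le> real (n + 1) * real (n choose k) * (real k ^ k * real (n - k) ^ (n - k))"
    by (simp only: of_nat_mult of_nat_power)
  have n: "real n > 0" "real k > 0" "real (n - k) > 0" using assms by auto
  have "real n ^ n = real n ^ k * real n ^ (n - k)" using assms by (simp flip: power_add)
  then have "exp (real n * entropy (real k / real n)) = real n ^ n / (real k ^ k * real (n - k) ^ (n - k))"
    using exp_entropy[of k "n - k" n] assms by (simp add: power_divide)
  also have "\<dots> \<le> real (n + 1) * real (n choose k)" using main n by (simp add: divide_le_eq)
  finally show ?thesis .
qed

text \<open>Unlike in the lower bound no polynomial factor is lost. Hence O(c^n) still holds at the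
  very point where the entropy equals ln c, and the least \<beta> is attained there.\<close>

lemma binomial_le_entropy:
  assumes "1 / 2 \<le> b" "b < 1"
  shows "real (n choose nat \<lceil>b * real n\<rceil>) \<le> exp (entropy b) ^ n"
proof -
  define k where "k = nat \<lceil>b * real n\<rceil>"
  have kn: "k \<le> n" using assms mult_right_mono[of b 1 "real n"] by (auto simp: k_def nat_le_iff ceiling_le_iff)
  have bk: "b * real n \<le> real k" unfolding k_def by (rule real_nat_ceiling_ge)
  have pos: "0 < b ^ k * (1 - b) ^ (n - k)" using assms by simp
  have lnb: "ln (1 - b) \<le> ln b" using assms by simp
  have "real (n choose k) * (b ^ k * (1 - b) ^ (n - k)) \<le> 1"
    using binomial_term_le_one[of b k n] assms kn by (simp add: mult.assoc)
  then have "real (n choose k) \<le> 1 / (b ^ k * (1 - b) ^ (n - k))" using pos by (simp add: le_divide_eq)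
  also have "\<dots> = exp (- (real k * ln b + real (n - k) * ln (1 - b)))"
  proof -
    have "exp (real k * ln b + real (n - k) * ln (1 - b)) = b ^ k * (1 - b) ^ (n - k)"
      using assms by (simp add: exp_add exp_of_nat_mult)
    then show ?thesis by (simp only: exp_minus inverse_eq_divide)
  qed
  \<comment> \<open>Rounding b n up only helps: for b \<ge> 1/2 the exponent decreases in k, because
    ln (1 - b) \<le> ln b.\<close>
  also have "\<dots> \<le> exp (real n * entropy b)"
  proof -
    have "(real k - b * real n) * (ln (1 - b) - ln b) \<le> 0" using bk lnb by (intro mult_nonneg_nonpos) auto
    then show ?thesis using kn by (simp add: entropy_def of_nat_diff algebra_simps)
  qed
  finally show ?thesis by (simp add: k_def exp_of_nat_mult)
qed


text \<open>The exponential gain has to beat both the factor n + 1 lost in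
  \<open>binomial_ge_entropy\<close> and the constant hidden in the O-notation; the quadratic Taylor
  term of exp is enough.\<close>

lemma exp_div_linear_unbounded:
  assumes "0 < (e::real)"
  shows "eventually (\<lambda>n::nat. K < exp (real n * e) / real (n + 1)) at_top"
proof -
  define N where "N = nat \<lceil>4 * (\<bar>K\<bar> + 1) / e\<^sup>2\<rceil>"
  have "K < exp (real n * e) / real (n + 1)" if n: "n \<ge> N + 1" for n
  proof -
    have nN: "4 * (\<bar>K\<bar> + 1) / e\<^sup>2 \<le> real n" using n unfolding N_def by linarith
    then have "4 * (\<bar>K\<bar> + 1) \<le> real n * e\<^sup>2" using assms by (simp add: divide_le_eq)
    then have "4 * (\<bar>K\<bar> + 1) * real n \<le> real n * e\<^sup>2 * real n" by (rule mult_right_mono) simp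
    also have "\<dots> = (real n * e)\<^sup>2" by (simp add: power2_eq_square mult_ac)
    finally have "2 * (\<bar>K\<bar> + 1) * real n \<le> (real n * e)\<^sup>2 / 2" by (simp add: field_simps)
    also have "\<dots> < exp (real n * e)"
    proof -
      have "0 \<le> real n * e" using assms by simp
      with exp_lower_Taylor_quadratic[OF this] show ?thesis by linarith
    qed
    finally have "2 * (\<bar>K\<bar> + 1) * real n < exp (real n * e)" .
    moreover have "K * real (n + 1) \<le> 2 * (\<bar>K\<bar> + 1) * real n"
    proof -
      have "K * real (n + 1) \<le> (\<bar>K\<bar> + 1) * (2 * real n)" using n by (intro mult_mono) auto
      then show ?thesis by (simp add: algebra_simps)
    qed
    ultimately have "K * real (n + 1) < exp (real n * e)" by linarith
    then show ?thesis by (simp add: less_divide_eq)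
  qed
  then show ?thesis unfolding eventually_at_top_linorder by blast
qed

lemma not_bigo_of_entropy_gt:
  assumes b: "0 < b" "b < 1" and c: "0 < c" "ln c < entropy b"
  shows "(\<lambda>n::nat. real (n choose nat \<lceil>b * real n\<rceil>)) \<notin> O(\<lambda>n. c ^ n)"
proof
  let ?k = "\<lambda>n::nat. nat \<lceil>b * real n\<rceil>"
  assume "(\<lambda>n::nat. real (n choose ?k n)) \<in> O(\<lambda>n. c ^ n)"
  then obtain K where K: "eventually (\<lambda>n. norm (real (n choose ?k n)) \<le> K * norm (c ^ n)) at_top"
    by (auto elim!: landau_o.bigE)
  \<comment> \<open>Half of the gap pays for replacing b by the rounded quotient; the other half
    survives as the factor exp (n e) that refutes the bound.\<close>
  define e where "e = (entropy b - ln c) / 2"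
  have e: "0 < e" using c by (simp add: e_def)
  have lim: "(\<lambda>n. real (?k n) / real n) \<longlonglongrightarrow> b"
  proof (rule tendsto_sandwich[where f = "\<lambda>_. b" and h = "\<lambda>n. b + 1 / real n"])
    show "eventually (\<lambda>n. b \<le> real (?k n) / real n) at_top"
      using eventually_gt_at_top[of 0] by eventually_elim (simp add: le_divide_eq real_nat_ceiling_ge)
    show "eventually (\<lambda>n. real (?k n) / real n \<le> b + 1 / real n) at_top"
      using eventually_gt_at_top[of 0]
    proof eventually_elim
      case (elim n)
      have "0 \<le> b * real n" using b by simp
      then have "real (?k n) \<le> b * real n + 1" by linarith
      then show ?case using elim by (simp add: field_simps)
    qed
    show "(\<lambda>n. b + 1 / real n) \<longlonglongrightarrow> b"
      using tendsto_add[OF tendsto_const lim_1_over_n] by force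
  qed simp
  have "isCont entropy b" using DERIV_isCont[OF entropy_deriv[OF b]] .
  then have "(\<lambda>n. entropy (real (?k n) / real n)) \<longlonglongrightarrow> entropy b"
    using isCont_tendsto_compose lim by blast
  moreover have "ln c + e < entropy b" using c by (simp add: e_def field_simps)
  ultimately have ev1: "eventually (\<lambda>n. ln c + e < entropy (real (?k n) / real n)) at_top"
    by (rule order_tendstoD)
  have ev2: "eventually (\<lambda>n. real (?k n) / real n < 1) at_top" using lim b(2) by (rule order_tendstoD)
  have ev3: "eventually (\<lambda>n. 0 < real (?k n) / real n) at_top" using lim b(1) by (rule order_tendstoD)
  have "eventually (\<lambda>n::nat. False) at_top"
    using K ev1 ev2 ev3 eventually_gt_at_top[of 0] exp_div_linear_unbounded[OF e, of K]
  proof eventually_elim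
    case (elim n)
    have k: "0 < ?k n" "?k n < n" using elim(3,4,5) by (auto simp: zero_less_divide_iff)
    have "exp (real n * (ln c + e)) \<le> exp (real n * entropy (real (?k n) / real n))"
      using elim(2) by (simp add: mult_left_mono)
    also have "\<dots> \<le> real (n + 1) * real (n choose ?k n)" by (rule binomial_ge_entropy[OF k])
    also have "\<dots> \<le> real (n + 1) * (K * c ^ n)" using elim(1) c by (intro mult_left_mono) auto
    finally have "exp (real n * e) * c ^ n \<le> (real (n + 1) * K) * c ^ n"
      using c by (simp add: distrib_left exp_add exp_of_nat_mult mult_ac)
    then have "exp (real n * e) \<le> real (n + 1) * K" using c by (simp only: mult_le_cancel_right_pos zero_less_power)
    then show False using elim(6) by (simp add: less_divide_eq mult.commute)
  qed
  then show False by simp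
qed

text \<open>
  The powers below are multiplied up with rounding to seven digits, which keeps the numerals short
  enough for the simplifier.
\<close>

lemma pow_le_add:
  fixes x :: real
  assumes "x ^ k \<le> v" "x ^ j \<le> w" "v * w \<le> u" "0 \<le> x" "m = k + j"
  shows "x ^ m \<le> u"
proof -
  have "0 \<le> v" using assms by (meson order_trans zero_le_power)
  then have "x ^ k * x ^ j \<le> v * w" using assms by (intro mult_mono) auto
  then show ?thesis using assms by (simp add: power_add)
qed

lemma le_pow_add:
  fixes x :: real
  assumes "v \<le> x ^ k" "w \<le> x ^ j" "u \<le> v * w" "0 \<le> v" "0 \<le> w" "m = k + j"
  shows "u \<le> x ^ m"
proof -
  have "v * w \<le> x ^ k * x ^ j" using assms by (intro mult_mono) auto
  then show ?thesis using assms by (simp add: power_add)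
qed

text \<open>By \<open>exp_entropy\<close> this means ln 1.6702 < entropy (34 / 43). The fractions
  34/43 = 0.79070 and 87/110 = 0.79091 enclose \<beta> closely while keeping the exponents
  small.\<close>

lemma num_entropy_lower: "1.6702 ^ 43 < ((43 / 34) ^ 34 * (43 / 9) ^ 9 :: real)"
proof -
  \<comment> \<open>The names carry the exponents, each of which is split into two nearly equal
    parts so that few products occur. This side is rounded up, the other side down.\<close>
  have a_1: "1.6702 ^ 1 \<le> (1.6702 :: real)" by simp
  have a_2: "1.6702 ^ 2 \<le> (2.789569 :: real)" by (rule pow_le_add[OF a_1 a_1]) simp_all
  have a_3: "1.6702 ^ 3 \<le> (4.659139 :: real)" by (rule pow_le_add[OF a_1 a_2]) simp_all
  have a_5: "1.6702 ^ 5 \<le> (12.99699 :: real)" by (rule pow_le_add[OF a_2 a_3]) simp_all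
  have a_10: "1.6702 ^ 10 \<le> (168.9218 :: real)" by (rule pow_le_add[OF a_5 a_5]) simp_all
  have a_6: "1.6702 ^ 6 \<le> (21.70758 :: real)" by (rule pow_le_add[OF a_3 a_3]) simp_all
  have a_11: "1.6702 ^ 11 \<le> (282.1333 :: real)" by (rule pow_le_add[OF a_5 a_6]) simp_all
  have a_21: "1.6702 ^ 21 \<le> (47658.47 :: real)" by (rule pow_le_add[OF a_10 a_11]) simp_all
  have a_22: "1.6702 ^ 22 \<le> (79599.2 :: real)" by (rule pow_le_add[OF a_11 a_11]) simp_all
  have a_43: "1.6702 ^ 43 \<le> (3793577000 :: real)" by (rule pow_le_add[OF a_21 a_22]) simp_all
  have b_1: "1.264705 \<le> ((43 / 34) ^ 1 :: real)" by simp
  have b_2: "1.599478 \<le> ((43 / 34) ^ 2 :: real)" by (rule le_pow_add[OF b_1 b_1]) simp_all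
  have b_4: "2.558329 \<le> ((43 / 34) ^ 4 :: real)" by (rule le_pow_add[OF b_2 b_2]) simp_all
  have b_8: "6.545047 \<le> ((43 / 34) ^ 8 :: real)" by (rule le_pow_add[OF b_4 b_4]) simp_all
  have b_3: "2.022867 \<le> ((43 / 34) ^ 3 :: real)" by (rule le_pow_add[OF b_1 b_2]) simp_all
  have b_5: "3.235531 \<le> ((43 / 34) ^ 5 :: real)" by (rule le_pow_add[OF b_2 b_3]) simp_all
  have b_9: "8.277552 \<le> ((43 / 34) ^ 9 :: real)" by (rule le_pow_add[OF b_4 b_5]) simp_all
  have b_17: "54.17696 \<le> ((43 / 34) ^ 17 :: real)" by (rule le_pow_add[OF b_8 b_9]) simp_all
  have b_34: "2935.142 \<le> ((43 / 34) ^ 34 :: real)" by (rule le_pow_add[OF b_17 b_17]) simp_all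
  have bb_1: "4.777777 \<le> ((43 / 9) ^ 1 :: real)" by simp
  have bb_2: "22.82715 \<le> ((43 / 9) ^ 2 :: real)" by (rule le_pow_add[OF bb_1 bb_1]) simp_all
  have bb_4: "521.0787 \<le> ((43 / 9) ^ 4 :: real)" by (rule le_pow_add[OF bb_2 bb_2]) simp_all
  have bb_3: "109.063 \<le> ((43 / 9) ^ 3 :: real)" by (rule le_pow_add[OF bb_1 bb_2]) simp_all
  have bb_5: "2489.597 \<le> ((43 / 9) ^ 5 :: real)" by (rule le_pow_add[OF bb_2 bb_3]) simp_all
  have bb_9: "1297275 \<le> ((43 / 9) ^ 9 :: real)" by (rule le_pow_add[OF bb_4 bb_5]) simp_all
  have "1.6702 ^ 43 \<le> (3793577000 :: real)" by (rule a_43)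
  also have "3793577000 < (2935.142 * 1297275 :: real)" by simp
  also have "2935.142 * 1297275 \<le> ((43 / 34) ^ 34 * (43 / 9) ^ 9 :: real)" by (rule mult_mono[OF b_34 bb_9]) simp_all
  finally show ?thesis .
qed

lemma num_entropy_upper: "(110 / 87) ^ 87 * (110 / 23) ^ 23 < (1.6701 ^ 110 :: real)"
proof -
  have a_1: "(110 / 87) ^ 1 \<le> (1.264368 :: real)" by simp
  have a_2: "(110 / 87) ^ 2 \<le> (1.598627 :: real)" by (rule pow_le_add[OF a_1 a_1]) simp_all
  have a_3: "(110 / 87) ^ 3 \<le> (2.021253 :: real)" by (rule pow_le_add[OF a_1 a_2]) simp_all
  have a_5: "(110 / 87) ^ 5 \<le> (3.23123 :: real)" by (rule pow_le_add[OF a_2 a_3]) simp_all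
  have a_10: "(110 / 87) ^ 10 \<le> (10.44085 :: real)" by (rule pow_le_add[OF a_5 a_5]) simp_all
  have a_6: "(110 / 87) ^ 6 \<le> (4.085464 :: real)" by (rule pow_le_add[OF a_3 a_3]) simp_all
  have a_11: "(110 / 87) ^ 11 \<le> (13.20108 :: real)" by (rule pow_le_add[OF a_5 a_6]) simp_all
  have a_21: "(110 / 87) ^ 21 \<le> (137.8305 :: real)" by (rule pow_le_add[OF a_10 a_11]) simp_all
  have a_22: "(110 / 87) ^ 22 \<le> (174.2686 :: real)" by (rule pow_le_add[OF a_11 a_11]) simp_all
  have a_43: "(110 / 87) ^ 43 \<le> (24019.53 :: real)" by (rule pow_le_add[OF a_21 a_22]) simp_all
  have a_44: "(110 / 87) ^ 44 \<le> (30369.55 :: real)" by (rule pow_le_add[OF a_22 a_22]) simp_all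
  have a_87: "(110 / 87) ^ 87 \<le> (729462400 :: real)" by (rule pow_le_add[OF a_43 a_44]) simp_all
  have aa_1: "(110 / 23) ^ 1 \<le> (4.782609 :: real)" by simp
  have aa_2: "(110 / 23) ^ 2 \<le> (22.87335 :: real)" by (rule pow_le_add[OF aa_1 aa_1]) simp_all
  have aa_3: "(110 / 23) ^ 3 \<le> (109.3943 :: real)" by (rule pow_le_add[OF aa_1 aa_2]) simp_all
  have aa_5: "(110 / 23) ^ 5 \<le> (2502.215 :: real)" by (rule pow_le_add[OF aa_2 aa_3]) simp_all
  have aa_6: "(110 / 23) ^ 6 \<le> (11967.12 :: real)" by (rule pow_le_add[OF aa_3 aa_3]) simp_all
  have aa_11: "(110 / 23) ^ 11 \<le> (29944310 :: real)" by (rule pow_le_add[OF aa_5 aa_6]) simp_all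
  have aa_12: "(110 / 23) ^ 12 \<le> (143212000 :: real)" by (rule pow_le_add[OF aa_6 aa_6]) simp_all
  have aa_23: "(110 / 23) ^ 23 \<le> (4288385000000000 :: real)" by (rule pow_le_add[OF aa_11 aa_12]) simp_all
  have b_1: "1.6701 \<le> (1.6701 ^ 1 :: real)" by simp
  have b_2: "2.789234 \<le> (1.6701 ^ 2 :: real)" by (rule le_pow_add[OF b_1 b_1]) simp_all
  have b_3: "4.658299 \<le> (1.6701 ^ 3 :: real)" by (rule le_pow_add[OF b_1 b_2]) simp_all
  have b_6: "21.69974 \<le> (1.6701 ^ 6 :: real)" by (rule le_pow_add[OF b_3 b_3]) simp_all
  have b_4: "7.779826 \<le> (1.6701 ^ 4 :: real)" by (rule le_pow_add[OF b_2 b_2]) simp_all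
  have b_7: "36.24075 \<le> (1.6701 ^ 7 :: real)" by (rule le_pow_add[OF b_3 b_4]) simp_all
  have b_13: "786.4148 \<le> (1.6701 ^ 13 :: real)" by (rule le_pow_add[OF b_6 b_7]) simp_all
  have b_14: "1313.391 \<le> (1.6701 ^ 14 :: real)" by (rule le_pow_add[OF b_7 b_7]) simp_all
  have b_27: "1032870 \<le> (1.6701 ^ 27 :: real)" by (rule le_pow_add[OF b_13 b_14]) simp_all
  have b_28: "1724995 \<le> (1.6701 ^ 28 :: real)" by (rule le_pow_add[OF b_14 b_14]) simp_all
  have b_55: "1781695000000 \<le> (1.6701 ^ 55 :: real)" by (rule le_pow_add[OF b_27 b_28]) simp_all
  have b_110: "3174437000000000000000000 \<le> (1.6701 ^ 110 :: real)" by (rule le_pow_add[OF b_55 b_55]) simp_all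
  have "(110 / 87) ^ 87 * (110 / 23) ^ 23 \<le> (729462400 * 4288385000000000 :: real)" by (rule mult_mono[OF a_87 aa_23]) simp_all
  also have "729462400 * 4288385000000000 < (3174437000000000000000000 :: real)" by simp
  also have "3174437000000000000000000 \<le> (1.6701 ^ 110 :: real)" by (rule b_110)
  finally show ?thesis .
qed

text \<open>The 43rd power of 2.2778 / 1.6701 < 1.481 powr (34 / 43), which clears the fractional
  exponent. The resulting 2.2778 < d already leaves room above the base 2.275 of the
  algorithm.\<close>

lemma num_d_lower: "(2.2778 / 1.6701) ^ 43 < (1.481 ^ 34 :: real)"
proof -
  have a_1: "(2.2778 / 1.6701) ^ 1 \<le> (1.363871 :: real)" by simp
  have a_2: "(2.2778 / 1.6701) ^ 2 \<le> (1.860145 :: real)" by (rule pow_le_add[OF a_1 a_1]) simp_all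
  have a_3: "(2.2778 / 1.6701) ^ 3 \<le> (2.536998 :: real)" by (rule pow_le_add[OF a_1 a_2]) simp_all
  have a_5: "(2.2778 / 1.6701) ^ 5 \<le> (4.719185 :: real)" by (rule pow_le_add[OF a_2 a_3]) simp_all
  have a_10: "(2.2778 / 1.6701) ^ 10 \<le> (22.27071 :: real)" by (rule pow_le_add[OF a_5 a_5]) simp_all
  have a_6: "(2.2778 / 1.6701) ^ 6 \<le> (6.436359 :: real)" by (rule pow_le_add[OF a_3 a_3]) simp_all
  have a_11: "(2.2778 / 1.6701) ^ 11 \<le> (30.37437 :: real)" by (rule pow_le_add[OF a_5 a_6]) simp_all
  have a_21: "(2.2778 / 1.6701) ^ 21 \<le> (676.4588 :: real)" by (rule pow_le_add[OF a_10 a_11]) simp_all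
  have a_22: "(2.2778 / 1.6701) ^ 22 \<le> (922.6024 :: real)" by (rule pow_le_add[OF a_11 a_11]) simp_all
  have a_43: "(2.2778 / 1.6701) ^ 43 \<le> (624102.6 :: real)" by (rule pow_le_add[OF a_21 a_22]) simp_all
  have b_1: "1.481 \<le> (1.481 ^ 1 :: real)" by simp
  have b_2: "2.193361 \<le> (1.481 ^ 2 :: real)" by (rule le_pow_add[OF b_1 b_1]) simp_all
  have b_4: "4.810832 \<le> (1.481 ^ 4 :: real)" by (rule le_pow_add[OF b_2 b_2]) simp_all
  have b_8: "23.1441 \<le> (1.481 ^ 8 :: real)" by (rule le_pow_add[OF b_4 b_4]) simp_all
  have b_3: "3.248367 \<le> (1.481 ^ 3 :: real)" by (rule le_pow_add[OF b_1 b_2]) simp_all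
  have b_5: "7.124841 \<le> (1.481 ^ 5 :: real)" by (rule le_pow_add[OF b_2 b_3]) simp_all
  have b_9: "34.27641 \<le> (1.481 ^ 9 :: real)" by (rule le_pow_add[OF b_4 b_5]) simp_all
  have b_17: "793.2966 \<le> (1.481 ^ 17 :: real)" by (rule le_pow_add[OF b_8 b_9]) simp_all
  have b_34: "629319.4 \<le> (1.481 ^ 34 :: real)" by (rule le_pow_add[OF b_17 b_17]) simp_all
  have "(2.2778 / 1.6701) ^ 43 \<le> (624102.6 :: real)" by (rule a_43)
  also have "624102.6 < (629319.4 :: real)" by simp
  also have "629319.4 \<le> (1.481 ^ 34 :: real)" by (rule b_34)
  finally show ?thesis .
qed

lemma num_d_upper: "1.481 ^ 87 < ((2.2787 / 1.6702) ^ 110 :: real)"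
proof -
  have a_1: "1.481 ^ 1 \<le> (1.481 :: real)" by simp
  have a_2: "1.481 ^ 2 \<le> (2.193361 :: real)" by (rule pow_le_add[OF a_1 a_1]) simp_all
  have a_3: "1.481 ^ 3 \<le> (3.248368 :: real)" by (rule pow_le_add[OF a_1 a_2]) simp_all
  have a_5: "1.481 ^ 5 \<le> (7.124844 :: real)" by (rule pow_le_add[OF a_2 a_3]) simp_all
  have a_10: "1.481 ^ 10 \<le> (50.76341 :: real)" by (rule pow_le_add[OF a_5 a_5]) simp_all
  have a_6: "1.481 ^ 6 \<le> (10.5519 :: real)" by (rule pow_le_add[OF a_3 a_3]) simp_all
  have a_11: "1.481 ^ 11 \<le> (75.18065 :: real)" by (rule pow_le_add[OF a_5 a_6]) simp_all
  have a_21: "1.481 ^ 21 \<le> (3816.427 :: real)" by (rule pow_le_add[OF a_10 a_11]) simp_all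
  have a_22: "1.481 ^ 22 \<le> (5652.131 :: real)" by (rule pow_le_add[OF a_11 a_11]) simp_all
  have a_43: "1.481 ^ 43 \<le> (21570950 :: real)" by (rule pow_le_add[OF a_21 a_22]) simp_all
  have a_44: "1.481 ^ 44 \<le> (31946590 :: real)" by (rule pow_le_add[OF a_22 a_22]) simp_all
  have a_87: "1.481 ^ 87 \<le> (689118300000000 :: real)" by (rule pow_le_add[OF a_43 a_44]) simp_all
  have b_1: "1.364327 \<le> ((2.2787 / 1.6702) ^ 1 :: real)" by simp
  have b_2: "1.861388 \<le> ((2.2787 / 1.6702) ^ 2 :: real)" by (rule le_pow_add[OF b_1 b_1]) simp_all
  have b_3: "2.539541 \<le> ((2.2787 / 1.6702) ^ 3 :: real)" by (rule le_pow_add[OF b_1 b_2]) simp_all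
  have b_6: "6.449268 \<le> ((2.2787 / 1.6702) ^ 6 :: real)" by (rule le_pow_add[OF b_3 b_3]) simp_all
  have b_4: "3.464765 \<le> ((2.2787 / 1.6702) ^ 4 :: real)" by (rule le_pow_add[OF b_2 b_2]) simp_all
  have b_7: "8.798912 \<le> ((2.2787 / 1.6702) ^ 7 :: real)" by (rule le_pow_add[OF b_3 b_4]) simp_all
  have b_13: "56.74654 \<le> ((2.2787 / 1.6702) ^ 13 :: real)" by (rule le_pow_add[OF b_6 b_7]) simp_all
  have b_14: "77.42085 \<le> ((2.2787 / 1.6702) ^ 14 :: real)" by (rule le_pow_add[OF b_7 b_7]) simp_all
  have b_27: "4393.365 \<le> ((2.2787 / 1.6702) ^ 27 :: real)" by (rule le_pow_add[OF b_13 b_14]) simp_all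
  have b_28: "5993.988 \<le> ((2.2787 / 1.6702) ^ 28 :: real)" by (rule le_pow_add[OF b_14 b_14]) simp_all
  have b_55: "26333770 \<le> ((2.2787 / 1.6702) ^ 55 :: real)" by (rule le_pow_add[OF b_27 b_28]) simp_all
  have b_110: "693467400000000 \<le> ((2.2787 / 1.6702) ^ 110 :: real)" by (rule le_pow_add[OF b_55 b_55]) simp_all
  have "1.481 ^ 87 \<le> (689118300000000 :: real)" by (rule a_87)
  also have "689118300000000 < (693467400000000 :: real)" by simp
  also have "693467400000000 \<le> ((2.2787 / 1.6702) ^ 110 :: real)" by (rule b_110)
  finally show ?thesis .
qed

lemma ln_c_less_entropy: "ln c_const < entropy (34 / 43)"
proof -
  have c: "1 < c_const" using c_const_bounds by simp
  have "c_const ^ 43 < 1.6702 ^ 43" using c_const_bounds c by (intro power_strict_mono) auto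
  also note num_entropy_lower
  also have "(43 / 34) ^ 34 * (43 / 9) ^ 9 = exp (43 * entropy (34 / 43))"
    by (rule exp_entropy[of 34 9 43, unfolded of_nat_numeral, symmetric]) simp_all
  also have "\<dots> = exp (entropy (34 / 43)) ^ 43" using exp_of_nat_mult[of 43 "entropy (34 / 43)"] by simp
  finally have "c_const < exp (entropy (34 / 43))" by (rule power_less_imp_less_base) simp
  then have "exp (ln c_const) < exp (entropy (34 / 43))" using c by simp
  then show ?thesis by (simp only: exp_less_cancel_iff)
qed

lemma entropy_less_ln_c: "entropy (87 / 110) < ln c_const"
proof -
  have c: "1 < c_const" using c_const_bounds by simp
  have "exp (entropy (87 / 110)) ^ 110 = exp (110 * entropy (87 / 110))"
    using exp_of_nat_mult[of 110 "entropy (87 / 110)"] by simp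
  also have "\<dots> = (110 / 87) ^ 87 * (110 / 23) ^ 23"
    by (rule exp_entropy[of 87 23 110, unfolded of_nat_numeral]) simp_all
  also note num_entropy_upper
  also have "1.6701 ^ 110 < c_const ^ 110" using c_const_bounds by (intro power_strict_mono) auto
  finally have "exp (entropy (87 / 110)) < c_const" by (rule power_less_imp_less_base) (use c in simp)
  then have "exp (entropy (87 / 110)) < exp (ln c_const)" using c by simp
  then show ?thesis by (simp only: exp_less_cancel_iff)
qed

lemma beta_const_bounds: "34 / 43 < \<beta>_const" "\<beta>_const < 87 / 110"
proof -
  have c: "1 < c_const" using c_const_bounds by simp
  note lo = ln_c_less_entropy and hi = entropy_less_ln_c
  have cont: "continuous_on {34 / 43..87 / 110} entropy"
    by (intro continuous_at_imp_continuous_on ballI DERIV_isCont[OF entropy_deriv]) auto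
  obtain b where b: "34 / 43 \<le> b" "b \<le> 87 / 110" "entropy b = ln c_const"
    using IVT2'[OF less_imp_le[OF hi] less_imp_le[OF lo] _ cont] by auto
  have "\<beta>_const = b" unfolding \<beta>_const_def
  proof (rule Least_equality)
    have "exp (entropy b) = c_const" using b c by simp
    then have "real (n choose nat \<lceil>b * real n\<rceil>) \<le> 1 * c_const ^ n" for n
      using binomial_le_entropy[of b n] b by simp
    then have "(\<lambda>n::nat. real (n choose nat \<lceil>b * real n\<rceil>)) \<in> O(\<lambda>n. c_const ^ n)"
      using c by (intro landau_o.bigI[where c = 1]) (auto simp: power_abs)
    then show "0.6 \<le> b \<and> (\<lambda>n::nat. real (n choose nat \<lceil>b * real n\<rceil>)) \<in> O(\<lambda>n. c_const ^ n)"
      using b by simp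
  next
    fix y assume y: "0.6 \<le> y \<and> (\<lambda>n::nat. real (n choose nat \<lceil>y * real n\<rceil>)) \<in> O(\<lambda>n. c_const ^ n)"
    show "b \<le> y"
    proof (rule ccontr)
      assume "\<not> b \<le> y"
      \<comment> \<open>The constraint 0.6 \<le> y keeps y on the decreasing branch of the entropy,
        where y < b means faster growth than c^n.\<close>
      then have "entropy b < entropy y" using entropy_less[of y b] y b by simp
      then show False using not_bigo_of_entropy_gt[of y c_const] y b c \<open>\<not> b \<le> y\<close> by simp
    qed
  qed
  moreover have "b \<noteq> 34 / 43" "b \<noteq> 87 / 110" using b(3) lo hi by (metis less_irrefl)+
  ultimately show "34 / 43 < \<beta>_const" "\<beta>_const < 87 / 110" using b(1,2) by linarith+
qed

lemma d_const_bounds: "2.2778 < d_const" "d_const < 2.2787"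
proof -
  note c = c_const_bounds and b = beta_const_bounds
  have frac: "(x powr (real p / real q)) ^ q = x ^ p" if "0 < x" "0 < q" for x :: real and p q
    using that by (simp add: powr_realpow[symmetric] powr_powr)
  have "2.2778 / 1.6701 < (1.481::real) powr (34 / 43)"
    by (rule power_less_imp_less_base[of _ 43]) (use frac[of "1.481" 43 34] num_d_lower in simp_all)
  also have "\<dots> < 1.481 powr \<beta>_const" using b by (intro powr_less_mono) auto
  finally have "2.2778 < 1.6701 * 1.481 powr \<beta>_const" by simp
  also have "\<dots> < d_const" unfolding d_const_def using c by simp
  finally show "2.2778 < d_const" .
  have u: "(1.481::real) powr (87 / 110) < 2.2787 / 1.6702"
    by (rule power_less_imp_less_base[of _ 110]) (use frac[of "1.481" 110 87] num_d_upper in simp_all)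
  have "1.481 powr \<beta>_const < (1.481::real) powr (87 / 110)" using b by (intro powr_less_mono) auto
  also note u
  finally have "1.6702 * 1.481 powr \<beta>_const < 2.2787" by simp
  moreover have "d_const < 1.6702 * 1.481 powr \<beta>_const" unfolding d_const_def using c by simp
  ultimately show "d_const < 2.2787" by linarith
qed

section \<open>Counting locally minimal sets\<close>

text \<open>
  An atom \<open>a \<in> M\<close> is forced once all other atoms of its critical set \<open>S M a\<close> have been read.
  \<open>wt p S {} xs M\<close> is the probability that the guessing process which reads the atoms in the order
  \<open>xs\<close> and makes unforced atoms true with probability \<open>p\<close> produces \<open>M\<close>.
\<close>

definition forced :: "('a set \<Rightarrow> 'a \<Rightarrow> 'a set) \<Rightarrow> 'a set \<Rightarrow> 'a set \<Rightarrow> 'a \<Rightarrow> bool" where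
  "forced S D M a \<longleftrightarrow> S M a - {a} \<subseteq> D"

fun wt :: "real \<Rightarrow> ('a set \<Rightarrow> 'a \<Rightarrow> 'a set) \<Rightarrow> 'a set \<Rightarrow> 'a list \<Rightarrow> 'a set \<Rightarrow> real" where
  "wt p S D [] M = 1"
| "wt p S D (x # xs) M = (if x \<notin> M then 1 - p else if forced S D M x then 1 else p)
     * wt p S (insert x D) xs M"

lemma wt_nonneg: "0 < p \<Longrightarrow> p < 1 \<Longrightarrow> 0 \<le> wt p S D xs M"
  by (induction xs arbitrary: D) auto

text \<open>Induction over the order, with F the sets still compatible with the values read on D. If
  x is forced for one member of F, then x lies in every member: only one branch is alive and may
  have factor 1. Otherwise the two branches carry the factors p and 1 - p.\<close>

lemma kraft:
  assumes p: "0 < p" "p < 1"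
    and "finite F" "\<And>M. M \<in> F \<Longrightarrow> M \<subseteq> D \<union> set xs" "\<And>M M'. M \<in> F \<Longrightarrow> M' \<in> F \<Longrightarrow> M \<inter> D = M' \<inter> D"
    and crit: "\<And>M M' a. M \<in> F \<Longrightarrow> M' \<in> F \<Longrightarrow> a \<in> M \<Longrightarrow> M' \<inter> (S M a - {a}) = M \<inter> (S M a - {a}) \<Longrightarrow> a \<in> M'"
  shows "(\<Sum>M\<in>F. wt p S D xs M) \<le> 1"
  using assms(3-6)
proof (induction xs arbitrary: D F)
  case Nil
  have "M = M'" if "M \<in> F" "M' \<in> F" for M M' using Nil(2)[OF that(1)] Nil(2)[OF that(2)] Nil(3)[OF that] by auto
  then have "card F \<le> 1" using card_le_Suc0_iff_eq[OF Nil(1)] by auto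
  then show ?case by simp
next
  case (Cons x xs)
  let ?F1 = "{M\<in>F. x \<in> M}" and ?F0 = "{M\<in>F. x \<notin> M}"
  let ?g = "wt p S (insert x D) xs"
  have fin: "finite ?F1" "finite ?F0" using Cons.prems(1) by auto
  have agree1: "M \<inter> insert x D = M' \<inter> insert x D" if "M \<in> ?F1" "M' \<in> ?F1" for M M'
    using that Cons.prems(3)[of M M'] by auto
  have agree0: "M \<inter> insert x D = M' \<inter> insert x D" if "M \<in> ?F0" "M' \<in> ?F0" for M M'
    using that Cons.prems(3)[of M M'] by auto
  have c1: "(\<Sum>M\<in>?F1. ?g M) \<le> 1"
  proof (rule Cons.IH[OF fin(1) _ agree1])
    show "M \<subseteq> insert x D \<union> set xs" if "M \<in> ?F1" for M using that Cons.prems(2)[of M] by auto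
    show "a \<in> M'" if "M \<in> ?F1" "M' \<in> ?F1" "a \<in> M" "M' \<inter> (S M a - {a}) = M \<inter> (S M a - {a})" for M M' a
      using Cons.prems(4)[of M M' a] that by simp
  qed
  have c0: "(\<Sum>M\<in>?F0. ?g M) \<le> 1"
  proof (rule Cons.IH[OF fin(2) _ agree0])
    show "M \<subseteq> insert x D \<union> set xs" if "M \<in> ?F0" for M using that Cons.prems(2)[of M] by auto
    show "a \<in> M'" if "M \<in> ?F0" "M' \<in> ?F0" "a \<in> M" "M' \<inter> (S M a - {a}) = M \<inter> (S M a - {a})" for M M' a
      using Cons.prems(4)[of M M' a] that by simp
  qed
  have split: "(\<Sum>M\<in>F. wt p S D (x # xs) M) =
      (\<Sum>M\<in>?F1. wt p S D (x # xs) M) + (\<Sum>M\<in>?F0. wt p S D (x # xs) M)"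
  proof -
    have "(\<Sum>M\<in>F. wt p S D (x # xs) M) = (\<Sum>M\<in>?F1 \<union> ?F0. wt p S D (x # xs) M)"
      by (rule arg_cong[where f = "sum _"]) auto
    also have "\<dots> = (\<Sum>M\<in>?F1. wt p S D (x # xs) M) + (\<Sum>M\<in>?F0. wt p S D (x # xs) M)"
      by (rule sum.union_disjoint[OF fin]) auto
    finally show ?thesis .
  qed
  have e0: "(\<Sum>M\<in>?F0. wt p S D (x # xs) M) = (1 - p) * (\<Sum>M\<in>?F0. ?g M)"
    by (simp add: sum_distrib_left)
  show ?case
  proof (cases "\<exists>M\<in>?F1. forced S D M x")
    case True
    then obtain M where M: "M \<in> F" "x \<in> M" "S M x - {x} \<subseteq> D" by (auto simp: forced_def)
    have "x \<in> M'" if "M' \<in> F" for M'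
      using Cons.prems(4)[OF M(1) that M(2)] Cons.prems(3)[OF M(1) that] M(3) by blast
    then have "?F0 = {}" by auto
    moreover have "(\<Sum>M\<in>?F1. wt p S D (x # xs) M) \<le> (\<Sum>M\<in>?F1. ?g M)"
    proof (rule sum_mono)
      fix M assume "M \<in> ?F1"
      then show "wt p S D (x # xs) M \<le> ?g M"
        using p wt_nonneg[OF p, of S "insert x D" xs M] by (simp add: mult_left_le_one_le)
    qed
    moreover from \<open>?F0 = {}\<close> have "(\<Sum>M\<in>?F0. wt p S D (x # xs) M) = 0" by (simp only: sum.empty)
    ultimately show ?thesis unfolding split using c1 by linarith
  next
    case False
    then have "(\<Sum>M\<in>?F1. wt p S D (x # xs) M) = p * (\<Sum>M\<in>?F1. ?g M)"
      by (simp add: sum_distrib_left)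
    also have "\<dots> \<le> p" using p c1 by (simp add: mult_left_le)
    finally show ?thesis unfolding split e0 using mult_left_le[OF c0, of "1 - p"] p by linarith
  qed
qed

section \<open>Forced atoms in a random order\<close>

definition before :: "'a list \<Rightarrow> 'a \<Rightarrow> 'a set" where
  "before xs a = set (takeWhile (\<lambda>x. x \<noteq> a) xs)"

definition unforced :: "('a set \<Rightarrow> 'a \<Rightarrow> 'a set) \<Rightarrow> 'a list \<Rightarrow> 'a set \<Rightarrow> 'a set" where
  "unforced S xs M = {a \<in> M. \<not> S M a - {a} \<subseteq> before xs a}"

text \<open>The set D of atoms already read is arbitrary for the sake of the induction; in the
  application it is empty and \<open>before\<close> alone decides which atoms are forced.\<close>

lemma wt_eq:
  assumes "distinct xs" "D \<inter> set xs = {}" "0 < p" "p < 1"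
  shows "wt p S D xs M =
    p ^ card {a \<in> M \<inter> set xs. \<not> S M a - {a} \<subseteq> D \<union> before xs a} * (1 - p) ^ card (set xs - M)"
  using assms
proof (induction xs arbitrary: D)
  case (Cons x xs)
  have IH: "wt p S (insert x D) xs M =
    p ^ card {a \<in> M \<inter> set xs. \<not> S M a - {a} \<subseteq> insert x D \<union> before xs a} * (1 - p) ^ card (set xs - M)"
    using Cons by auto
  have bx: "before (x # xs) x = {}" by (simp add: before_def)
  have eq: "{a \<in> M \<inter> set xs. \<not> S M a - {a} \<subseteq> insert x D \<union> before xs a} =
     {a \<in> M \<inter> set xs. \<not> S M a - {a} \<subseteq> D \<union> before (x # xs) a}" (is "?A = ?B")
    using Cons.prems(1) by (auto simp: before_def)
  show ?case
  proof (cases "x \<in> M")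
    case True
    then have m: "set (x # xs) - M = set xs - M" by auto
    show ?thesis
    proof (cases "forced S D M x")
      case f: True
      then have "{a \<in> M \<inter> set (x # xs). \<not> S M a - {a} \<subseteq> D \<union> before (x # xs) a} = ?B"
        using bx by (auto simp: forced_def)
      then show ?thesis using True f IH eq m by simp
    next
      case f: False
      then have "{a \<in> M \<inter> set (x # xs). \<not> S M a - {a} \<subseteq> D \<union> before (x # xs) a} = insert x ?B"
        using bx True by (auto simp: forced_def)
      moreover have "x \<notin> ?B" "finite ?B" using Cons.prems by auto
      ultimately show ?thesis using True f IH eq m by simp
    qed
  next
    case False
    then have "{a \<in> M \<inter> set (x # xs). \<not> S M a - {a} \<subseteq> D \<union> before (x # xs) a} = ?B" by auto
    moreover have "set (x # xs) - M = insert x (set xs - M)" using False by auto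
    moreover have "x \<notin> set xs - M" using Cons.prems by auto
    ultimately show ?thesis using False IH eq by simp
  qed
qed (simp add: before_def)

lemma before_map_inj:
  assumes "inj f"
  shows "before (map f xs) (f a) = f ` before xs a"
  using assms by (auto simp: before_def takeWhile_map o_def inj_eq)

lemma before_linear:
  assumes "distinct xs" "a \<in> set xs" "b \<in> set xs" "a \<noteq> b"
  shows "a \<in> before xs b \<or> b \<in> before xs a"
  using assms by (induction xs) (auto simp: before_def)

lemma before_trans:
  assumes "distinct xs" "a \<in> before xs b" "b \<in> before xs c"
  shows "a \<in> before xs c"
  using assms by (induction xs) (auto simp: before_def split: if_splits dest: set_takeWhileD)

lemma last_exists:
  assumes "distinct xs" "finite T" "T \<noteq> {}" "T \<subseteq> set xs"
  shows "\<exists>s\<in>T. T - {s} \<subseteq> before xs s"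
  using assms(2-4)
proof (induction T rule: finite_ne_induct)
  case (insert x T)
  then obtain s where s: "s \<in> T" "T - {s} \<subseteq> before xs s" by auto
  have "x \<in> before xs s \<or> s \<in> before xs x" using before_linear[OF assms(1), of x s] insert s by auto
  then show ?case
  proof
    assume "s \<in> before xs x"
    moreover from this have "T - {s} \<subseteq> before xs x" using s before_trans[OF assms(1)] by blast
    ultimately show ?thesis using s by blast
  qed (use s in blast)
qed auto

text \<open>
  By symmetry (transposing \<open>a\<close> with another element of \<open>T\<close>) each element of \<open>T\<close> is last equally often.
\<close>

lemma card_last_ge:
  assumes "finite U" "T \<subseteq> U" "a \<in> T" "card T \<le> 3"
  shows "card (permutations_of_set U) \<le> 3 * card {xs \<in> permutations_of_set U. T - {a} \<subseteq> before xs a}"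
proof -
  let ?P = "permutations_of_set U"
  let ?E = "\<lambda>s. {xs \<in> ?P. T - {s} \<subseteq> before xs s}"
  have finT: "finite T" using assms finite_subset by blast
  have finP: "finite ?P" by simp
  have "?P \<subseteq> (\<Union>s\<in>T. ?E s)"
  proof
    fix xs assume xs: "xs \<in> ?P"
    then have "distinct xs" "set xs = U" by (auto simp: permutations_of_set_def)
    with last_exists[of xs T] finT assms xs show "xs \<in> (\<Union>s\<in>T. ?E s)" by auto
  qed
  then have "card ?P \<le> card (\<Union>s\<in>T. ?E s)" using finP finT by (intro card_mono) auto
  also have "\<dots> \<le> (\<Sum>s\<in>T. card (?E s))" by (rule card_UN_le[OF finT])
  also have "\<dots> \<le> (\<Sum>s\<in>T. card (?E a))"
  proof (rule sum_mono)
    fix s assume s: "s \<in> T"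
    let ?f = "transpose a s"
    have sT: "?f ` T = T" using s assms by (simp add: transpose_image_eq)
    have sU: "?f ` U = U" using s assms by (meson subsetD transpose_image_eq)
    show "card (?E s) \<le> card (?E a)"
    proof (rule card_inj_on_le[where f = "map ?f"])
      show "inj_on (map ?f) (?E s)" by (rule inj_on_subset[OF inj_mapI]) simp_all
      show "map ?f ` ?E s \<subseteq> ?E a"
      proof (rule image_subsetI)
        fix xs assume xs: "xs \<in> ?E s"
        then have "distinct (map ?f xs)" "set (map ?f xs) = U"
          using sU by (auto simp: permutations_of_set_def distinct_map)
        moreover have "T - {a} \<subseteq> before (map ?f xs) a"
        proof -
          have "?f ` (T - {s}) \<subseteq> ?f ` before xs s" using xs by blast
          also have "?f ` before xs s = before (map ?f xs) (?f s)" by (rule before_map_inj[symmetric]) simp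
          also have "?f s = a" by simp
          also have "?f ` (T - {s}) = T - {a}" using sT by (simp add: image_set_diff)
          finally show ?thesis .
        qed
        ultimately show "map ?f xs \<in> ?E a" by (auto simp: permutations_of_set_def)
      qed
    qed simp
  qed
  also have "\<dots> = card T * card (?E a)" by simp
  also have "\<dots> \<le> 3 * card (?E a)" using assms by simp
  finally show ?thesis .
qed

text \<open>The inequality \<open>kraft\<close> holds for every order. On average over all orders at
  most two thirds of the atoms of M are unforced, and by convexity of u -> p^u the mean of p^u is at
  least p raised to the mean of u.\<close>

theorem ppz_count:
  fixes p :: real
  assumes p: "0 < p" "p < 1" and U: "finite U" and F: "F \<subseteq> Pow U"
    and S: "\<And>M a. M \<in> F \<Longrightarrow> a \<in> M \<Longrightarrow> S M a \<subseteq> U \<and> a \<in> S M a \<and> card (S M a) \<le> 3"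
    and crit: "\<And>M M' a. M \<in> F \<Longrightarrow> M' \<in> F \<Longrightarrow> a \<in> M \<Longrightarrow> M' \<inter> (S M a - {a}) = M \<inter> (S M a - {a}) \<Longrightarrow> a \<in> M'"
  shows "(\<Sum>M\<in>F. p powr (2 / 3 * card M) * (1 - p) ^ (card U - card M)) \<le> 1"
proof -
  let ?P = "permutations_of_set U"
  have finF: "finite F" using F U by (meson finite_Pow_iff finite_subset)
  have finP: "finite ?P" "card ?P > 0" using U by (auto simp: card_gt_0_iff)
  have key: "p powr (2 / 3 * card M) * card ?P \<le> (\<Sum>xs\<in>?P. p ^ card (unforced S xs M))" if M: "M \<in> F" for M
  proof -
    have fM: "finite M" using M F U finite_subset by blast
    let ?u = "\<lambda>xs. card (unforced S xs M)" and ?mean = "2 / 3 * real (card M)"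
    \<comment> \<open>Jensen's inequality in tangent form. The tangent is taken at
      \<open>?mean\<close>, which only bounds the true mean from above; as ln p < 0, the error has
      the right sign.\<close>
    have tangent: "p powr ?mean * (1 + (real k - ?mean) * ln p) \<le> p ^ k" for k :: nat
    proof -
      have "p powr ?mean * (1 + (real k - ?mean) * ln p) \<le> p powr ?mean * exp ((real k - ?mean) * ln p)"
        by (intro mult_left_mono exp_ge_add_one_self) simp
      also have "\<dots> = p ^ k" using p
        by (simp add: powr_def exp_add[symmetric] algebra_simps) (simp add: exp_of_nat_mult)
      finally show ?thesis .
    qed
    have "(\<Sum>xs\<in>?P. real (?u xs)) = (\<Sum>xs\<in>?P. \<Sum>a\<in>M. if a \<in> unforced S xs M then 1 else 0)"
    proof (rule sum.cong[OF refl])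
      fix xs
      have "M \<inter> unforced S xs M = unforced S xs M" by (auto simp: unforced_def)
      then show "real (?u xs) = (\<Sum>a\<in>M. if a \<in> unforced S xs M then 1 else 0)"
        using fM by (simp add: sum.If_cases)
    qed
    also have "\<dots> = (\<Sum>a\<in>M. \<Sum>xs\<in>?P. if a \<in> unforced S xs M then 1 else 0)" by (rule sum.swap)
    also have "\<dots> \<le> (\<Sum>a\<in>M. 2 / 3 * real (card ?P))"
    proof (rule sum_mono)
      fix a assume a: "a \<in> M"
      let ?E = "{xs \<in> ?P. S M a - {a} \<subseteq> before xs a}"
      have "(\<Sum>xs\<in>?P. if a \<in> unforced S xs M then 1 else 0::real) = real (card (?P - ?E))"
      proof -
        have "?P \<inter> {xs. a \<in> unforced S xs M} = ?P - ?E" using a by (auto simp: unforced_def)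
        then show ?thesis by (simp add: sum.If_cases)
      qed
      also have "\<dots> = real (card ?P) - real (card ?E)"
        by (subst card_Diff_subset) (auto simp: of_nat_diff card_mono)
      also have "\<dots> \<le> 2 / 3 * real (card ?P)"
        using card_last_ge[OF U, of "S M a" a] S[OF M a] by simp
      finally show "(\<Sum>xs\<in>?P. if a \<in> unforced S xs M then 1 else 0::real) \<le> 2 / 3 * real (card ?P)" .
    qed
    finally have su: "(\<Sum>xs\<in>?P. real (?u xs)) \<le> ?mean * real (card ?P)" by (simp add: algebra_simps)
    have "(\<Sum>xs\<in>?P. real (?u xs) - ?mean) = (\<Sum>xs\<in>?P. real (?u xs)) - real (card ?P) * ?mean"
      by (simp only: sum_subtractf sum_constant)
    then have "(\<Sum>xs\<in>?P. real (?u xs) - ?mean) \<le> 0" using su mult.commute[of ?mean "real (card ?P)"] by linarith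
    moreover have "ln p < 0" using p by simp
    ultimately have "0 \<le> (\<Sum>xs\<in>?P. real (?u xs) - ?mean) * ln p" by (simp add: mult_nonpos_nonpos)
    then have "p powr ?mean * card ?P \<le> p powr ?mean * (card ?P + (\<Sum>xs\<in>?P. real (?u xs) - ?mean) * ln p)"
      by (intro mult_left_mono) auto
    also have "\<dots> = (\<Sum>xs\<in>?P. p powr ?mean * (1 + (real (?u xs) - ?mean) * ln p))"
      by (simp add: sum_distrib_left[symmetric] sum.distrib sum_distrib_right[symmetric])
    also have "\<dots> \<le> (\<Sum>xs\<in>?P. p ^ ?u xs)" by (intro sum_mono tangent)
    finally show ?thesis .
  qed
  have kr: "(\<Sum>M\<in>F. p ^ card (unforced S xs M) * (1 - p) ^ (card U - card M)) \<le> 1" if xs: "xs \<in> ?P" for xs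
  proof -
    have d: "distinct xs" "set xs = U" using xs by (auto simp: permutations_of_set_def)
    have "(\<Sum>M\<in>F. wt p S {} xs M) \<le> 1"
    proof (rule kraft[OF p finF])
      show "M \<subseteq> {} \<union> set xs" if "M \<in> F" for M using that F d by auto
      show "a \<in> M'" if "M \<in> F" "M' \<in> F" "a \<in> M" "M' \<inter> (S M a - {a}) = M \<inter> (S M a - {a})" for M M' a
        using crit[OF that] .
    qed simp
    moreover have "wt p S {} xs M = p ^ card (unforced S xs M) * (1 - p) ^ (card U - card M)" if "M \<in> F" for M
    proof -
      have MU: "M \<subseteq> U" using that F by auto
      then have "{a \<in> M \<inter> set xs. \<not> S M a - {a} \<subseteq> {} \<union> before xs a} = unforced S xs M"
        using d by (auto simp: unforced_def)
      moreover have "card (U - M) = card U - card M" using MU U by (meson card_Diff_subset finite_subset)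
      ultimately show ?thesis using wt_eq[of xs "{}" p S M] d p by simp
    qed
    ultimately show ?thesis by simp
  qed
  have "card ?P * (\<Sum>M\<in>F. p powr (2 / 3 * card M) * (1 - p) ^ (card U - card M))
      = (\<Sum>M\<in>F. (p powr (2 / 3 * card M) * card ?P) * (1 - p) ^ (card U - card M))"
    by (simp add: sum_distrib_left mult_ac)
  also have "\<dots> \<le> (\<Sum>M\<in>F. (\<Sum>xs\<in>?P. p ^ card (unforced S xs M)) * (1 - p) ^ (card U - card M))"
    using p by (intro sum_mono mult_right_mono key) auto
  also have "\<dots> = (\<Sum>xs\<in>?P. \<Sum>M\<in>F. p ^ card (unforced S xs M) * (1 - p) ^ (card U - card M))"
    by (subst sum.swap) (simp add: sum_distrib_right)
  also have "\<dots> \<le> (\<Sum>xs\<in>?P. 1)" by (intro sum_mono kr)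
  also have "\<dots> = card ?P * (1::real)" by simp
  finally show ?thesis using finP by (simp only: mult_le_cancel_left_pos of_nat_0_less_iff)
qed

section \<open>A structured language and its compilation to random access machines\<close>

text \<open>
  \<open>KIND\<close> and \<open>IDX\<close> describe the rules, \<open>NAME\<close> the atoms, \<open>MM\<close> and \<open>NN\<close> are the characteristic functions of
  the candidate and of the current set of a search, \<open>DIG\<close> holds the digits that guide the search.
  The variable \<open>Vnv\<close> is the value a search writes into \<open>NN\<close>: 0 when shrinking, 1 when growing.
\<close>

datatype arr = INP | NAME | KIND | IDX | MM | NN | DIG

datatype var = Vn | Vend | Vp | Vf | Vi | Va | Vt | Vgo | Vq | Vd | Vr | Vnv | Vbad | Vk | Ve | Vr1
  | Vcont | Vmore | Vpos | Vrules | Vlen | Vkind | Vname | Vbase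

instance var :: countable by countable_datatype

text \<open>
  Values grow only by increments, so a computation of \<open>t\<close> steps never exceeds the initial values by
  more than \<open>t\<close>, and the words of the compiled program stay short without any further argument.
\<close>

datatype exp = Num nat | Var var | Ld arr exp | Inc exp | Dif exp exp

record st =
  vv :: "var \<Rightarrow> nat"
  aa :: "arr \<Rightarrow> nat \<Rightarrow> nat"
  oo :: "nat list"

fun eval :: "exp \<Rightarrow> st \<Rightarrow> nat" where
  "eval (Num k) s = k"
| "eval (Var x) s = vv s x"
| "eval (Ld a e) s = aa s a (eval e s)"
| "eval (Inc e) s = Suc (eval e s)"
| "eval (Dif e f) s = eval e s - eval f s"

fun cost :: "exp \<Rightarrow> nat" where
  "cost (Num k) = 1"
| "cost (Var x) = 2"
| "cost (Ld a e) = cost e + 6"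
| "cost (Inc e) = cost e + 2"
| "cost (Dif e f) = cost e + cost f + 1"

datatype com = Skip | Asg var exp | St arr exp exp | Wr exp | Seq com com | If exp com com | Whl exp com

text \<open>The time is the exact number of instructions executed by the compiled code. A test adds
  two to the cost of its expression, and a then-branch or a loop round ends with one more jump.
  Assignments pay two for copying a register by adding zero.\<close>

inductive big :: "com \<Rightarrow> st \<Rightarrow> nat \<Rightarrow> st \<Rightarrow> bool" where
  Skip: "big Skip s 0 s"
| Asg: "big (Asg x e) s (cost e + 2) (s\<lparr>vv := (vv s)(x := eval e s)\<rparr>)"
| St: "big (St a e f) s (cost e + cost f + 6)
    (s\<lparr>aa := (aa s)(a := (aa s a)(eval e s := eval f s))\<rparr>)"
| Wr: "big (Wr e) s (cost e + 1) (s\<lparr>oo := oo s @ [eval e s]\<rparr>)"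
| Seq: "big c s t s' \<Longrightarrow> big d s' u s'' \<Longrightarrow> big (Seq c d) s (t + u) s''"
| IfT: "eval e s \<noteq> 0 \<Longrightarrow> big c s t s' \<Longrightarrow> big (If e c d) s (cost e + t + 3) s'"
| IfF: "eval e s = 0 \<Longrightarrow> big d s t s' \<Longrightarrow> big (If e c d) s (cost e + t + 2) s'"
| WhlF: "eval e s = 0 \<Longrightarrow> big (Whl e c) s (cost e + 2) s"
| WhlT: "eval e s \<noteq> 0 \<Longrightarrow> big c s t s' \<Longrightarrow> big (Whl e c) s' u s'' \<Longrightarrow>
    big (Whl e c) s (cost e + t + u + 3) s''"

text \<open>
  Even registers hold variables, odd registers temporaries; register 0 is left to the input length.
  The arrays are interleaved: entry \<open>i\<close> of array \<open>a\<close> is stored at address \<open>8 * i + ai a\<close>.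
\<close>

fun rv :: "var \<Rightarrow> nat" where "rv x = 2 * to_nat x + 2"
definition tmp :: "nat \<Rightarrow> nat" where "tmp j = 2 * j + 1"

lemma rv_inj [simp]: "rv x = rv y \<longleftrightarrow> x = y" by simp
lemma rv_tmp [simp]: "rv x \<noteq> tmp j" "tmp j \<noteq> rv x" unfolding tmp_def rv.simps by presburger+
lemma tmp_inj [simp]: "tmp i = tmp j \<longleftrightarrow> i = j" by (simp add: tmp_def)
declare rv.simps [simp del]

fun ai :: "arr \<Rightarrow> nat" where
  "ai INP = 0" | "ai NAME = 1" | "ai KIND = 2" | "ai IDX = 3" | "ai MM = 4" | "ai NN = 5" | "ai DIG = 6"

lemma ai_inj: "ai a = ai b \<longleftrightarrow> a = b" by (cases a; cases b) simp_all
lemma ai_less: "ai a < 8" by (cases a) simp_all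
lemma cell_inj [simp]: "8 * i + ai a = 8 * j + ai b \<longleftrightarrow> i = j \<and> a = b"
proof
  assume eq: "8 * i + ai a = 8 * j + ai b"
  have "(8 * i + ai a) div 8 = i" "(8 * j + ai b) div 8 = j" using ai_less[of a] ai_less[of b] by simp_all
  with eq have "i = j" by simp
  with eq show "i = j \<and> a = b" by (simp add: ai_inj)
qed simp

text \<open>Temporaries act as a stack of height j: the value is left in temporary j and lower ones
  are preserved. The machine cannot multiply, so an index is scaled to the stride 8 of the arrays by
  three doublings.\<close>

fun cexp :: "exp \<Rightarrow> nat \<Rightarrow> instr list" where
  "cexp (Num k) j = [Const (tmp j) k]"
| "cexp (Var x) j = [Const (tmp j) 0, Add (tmp j) (rv x) (tmp j)]"
| "cexp (Ld a e) j = cexp e j @ [Add (tmp j) (tmp j) (tmp j), Add (tmp j) (tmp j) (tmp j),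
     Add (tmp j) (tmp j) (tmp j), Const (tmp (Suc j)) (ai a), Add (tmp j) (tmp j) (tmp (Suc j)),
     Load (tmp j) (tmp j)]"
| "cexp (Inc e) j = cexp e j @ [Const (tmp (Suc j)) 1, Add (tmp j) (tmp j) (tmp (Suc j))]"
| "cexp (Dif e f) j = cexp e j @ cexp f (Suc j) @ [Sub (tmp j) (tmp j) (tmp (Suc j))]"

lemma length_cexp [simp]: "length (cexp e j) = cost e"
  by (induction e arbitrary: j) auto

text \<open>The parameter p is the load address, since jump targets are absolute. Comparing a
  temporary with itself gives an unconditional jump, comparing it with a zeroed one a test for
  zero.\<close>

fun ccom :: "com \<Rightarrow> nat \<Rightarrow> instr list" where
  "ccom Skip p = []"
| "ccom (Asg x e) p = cexp e 0 @ [Const (tmp 1) 0, Add (rv x) (tmp 0) (tmp 1)]"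
| "ccom (St a e f) p = cexp e 0 @ [Add (tmp 0) (tmp 0) (tmp 0), Add (tmp 0) (tmp 0) (tmp 0),
     Add (tmp 0) (tmp 0) (tmp 0), Const (tmp 1) (ai a), Add (tmp 0) (tmp 0) (tmp 1)] @
     cexp f 1 @ [Store (tmp 0) (tmp 1)]"
| "ccom (Wr e) p = cexp e 0 @ [Write (tmp 0)]"
| "ccom (Seq c d) p = (let c' = ccom c p in c' @ ccom d (p + length c'))"
| "ccom (If e c d) p = (let c' = ccom c (p + cost e + 2); l = Suc (p + cost e + 2 + length c'); d' = ccom d l in
     cexp e 0 @ [Const (tmp 1) 0, Jle (tmp 0) (tmp 1) l] @ c' @
     [Jle (tmp 0) (tmp 0) (l + length d')] @ d')"
| "ccom (Whl e c) p = (let c' = ccom c (p + cost e + 2) in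
     cexp e 0 @ [Const (tmp 1) 0, Jle (tmp 0) (tmp 1) (Suc (p + cost e + 2 + length c'))] @ c' @
     [Jle (tmp 0) (tmp 0) p])"

definition code_at :: "instr list \<Rightarrow> nat \<Rightarrow> instr list \<Rightarrow> bool" where
  "code_at prog p cs \<longleftrightarrow> (\<forall>i<length cs. p + i < length prog \<and> prog ! (p + i) = cs ! i)"

lemma code_at_Nil [simp]: "code_at prog p []" by (simp add: code_at_def)

lemma code_at_Cons [simp]: "code_at prog p (c # cs) \<longleftrightarrow>
  p < length prog \<and> prog ! p = c \<and> code_at prog (Suc p) cs"
  unfolding code_at_def by (force simp: less_Suc_eq_0_disj all_conj_distrib)

lemma code_at_append [simp]: "code_at prog p (cs @ ds) \<longleftrightarrow>
  code_at prog p cs \<and> code_at prog (p + length cs) ds"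
  by (induction cs arbitrary: p) auto

section \<open>Simulation of commands by the machine with bounded words\<close>

definition bounded :: "nat \<Rightarrow> config \<Rightarrow> bool" where
  "bounded w c \<longleftrightarrow> (\<forall>i. reg c i \<le> w) \<and> (\<forall>i. mem c i \<le> w)"

text \<open>The word bound refers to every intermediate configuration because
  \<open>computes\<close> demands it at all times up to t.\<close>

definition reach :: "instr list \<Rightarrow> nat \<Rightarrow> config \<Rightarrow> nat \<Rightarrow> config \<Rightarrow> bool" where
  "reach prog w c t c' \<longleftrightarrow> (step prog ^^ t) c = c' \<and> (\<forall>s\<le>t. bounded w ((step prog ^^ s) c))"

lemma reach_refl: "bounded w c \<Longrightarrow> reach prog w c 0 c"
  by (simp add: reach_def)

lemma reach_trans:
  assumes "reach prog w c t c'" "reach prog w c' u c''"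
  shows "reach prog w c (t + u) c''"
proof -
  have "(step prog ^^ (t + u)) c = c''"
    using assms by (simp add: reach_def funpow_add add.commute[of t])
  moreover have "bounded w ((step prog ^^ s) c)" if "s \<le> t + u" for s
  proof (cases "s \<le> t")
    case False
    then obtain k where k: "s = k + t" "k \<le> u" using \<open>s \<le> t + u\<close>
      by (metis add.commute add_le_cancel_left le_add_diff_inverse nat_le_linear)
    then show ?thesis using assms by (simp add: reach_def funpow_add)
  qed (use assms in \<open>simp add: reach_def\<close>)
  ultimately show ?thesis by (simp add: reach_def)
qed

lemma reach_exec:
  assumes "reach prog w c t c'" "pc c' < length prog" "bounded w (exec (prog ! pc c') c')"
  shows "reach prog w c (Suc t) (exec (prog ! pc c') c')"
proof -
  have "reach prog w c' 1 (exec (prog ! pc c') c')"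
    using assms by (auto simp: reach_def step_def halted_def le_Suc_eq)
  with reach_trans[OF assms(1)] show ?thesis by fastforce
qed

lemma reach_bounded: "reach prog w c t c' \<Longrightarrow> bounded w c'"
  by (auto simp: reach_def)

text \<open>Temporaries, register 0 and the memory cells with address 7 modulo 8 stay
  unconstrained.\<close>

definition rel :: "config \<Rightarrow> st \<Rightarrow> bool" where
  "rel c s \<longleftrightarrow> (\<forall>x. reg c (rv x) = vv s x) \<and> (\<forall>a i. mem c (8 * i + ai a) = aa s a i) \<and> out c = oo s"

definition sbounded :: "nat \<Rightarrow> st \<Rightarrow> bool" where
  "sbounded W s \<longleftrightarrow> (\<forall>x. vv s x \<le> W) \<and> (\<forall>a i. aa s a i \<le> W)"

fun maxc :: "exp \<Rightarrow> nat" where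
  "maxc (Num k) = k"
| "maxc (Var x) = 0"
| "maxc (Ld a e) = maxc e"
| "maxc (Inc e) = maxc e"
| "maxc (Dif e f) = max (maxc e) (maxc f)"

fun maxcc :: "com \<Rightarrow> nat" where
  "maxcc Skip = 0"
| "maxcc (Asg x e) = maxc e"
| "maxcc (St a e f) = max (maxc e) (maxc f)"
| "maxcc (Wr e) = maxc e"
| "maxcc (Seq c d) = max (maxcc c) (maxcc d)"
| "maxcc (If e c d) = max (maxc e) (max (maxcc c) (maxcc d))"
| "maxcc (Whl e c) = max (maxc e) (maxcc c)"

lemma eval_le: "sbounded W s \<Longrightarrow> maxc e \<le> W \<Longrightarrow> eval e s \<le> W + cost e"
proof (induction e)
  case (Ld a e)
  then have "aa s a (eval e s) \<le> W" by (simp add: sbounded_def)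
  then show ?case by simp
next
  case (Var x)
  then have "vv s x \<le> W" by (simp add: sbounded_def)
  then show ?case by simp
qed (auto)

lemma sbounded_mono: "sbounded W s \<Longrightarrow> W \<le> W' \<Longrightarrow> sbounded W' s"
  unfolding sbounded_def by (meson le_trans)

lemma big_sbounded:
  assumes "big c s t s'" "sbounded W s" "maxcc c \<le> W"
  shows "sbounded (W + t) s'"
  using assms
proof (induction arbitrary: W)
  case (Asg x e s)
  then have "eval e s \<le> W + cost e" by (simp add: eval_le)
  with Asg show ?case by (auto simp: sbounded_def intro: order_trans[of _ W])
next
  case (St a e f s)
  then have "eval f s \<le> W + cost f" by (simp add: eval_le)
  with St show ?case by (auto simp: sbounded_def intro: order_trans[of _ W])
next
  case (Seq c s t s' d u s'')
  then have "sbounded (W + t) s'" by simp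
  with Seq.IH(2)[of "W + t"] Seq.prems show ?case by (simp add: add.assoc)
next
  case (WhlT e s c t s' u s'')
  then have "sbounded (W + t) s'" by simp
  with WhlT.IH(2)[of "W + t"] WhlT.prems have "sbounded (W + t + u) s''" by simp
  then show ?case by (rule sbounded_mono) simp
next
  case (IfT e s c t s' d)
  then have "sbounded (W + t) s'" by simp
  then show ?case by (rule sbounded_mono) simp
next
  case (IfF e s d t s' c)
  then have "sbounded (W + t) s'" by simp
  then show ?case by (rule sbounded_mono) simp
next
  case (Wr e s)
  then have "sbounded W (s\<lparr>oo := oo s @ [eval e s]\<rparr>)" by (simp add: sbounded_def)
  then show ?case by (rule sbounded_mono) simp
next
  case (WhlF e s c)
  from WhlF(2) show ?case by (rule sbounded_mono) simp
qed simp

text \<open>The bound w has to cover addresses, which are eight times a value plus a residue below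
  8. Preservation of the lower temporaries protects the first operand of \<open>Dif\<close> while
  the second one is evaluated.\<close>

lemma cexp_correct:
  assumes "code_at prog p (cexp e j)" "pc c = p" "rel c s" "sbounded W s" "maxc e \<le> W"
    "bounded w c" "8 * (W + cost e) + 8 \<le> w"
  shows "\<exists>c'. reach prog w c (cost e) c' \<and> pc c' = p + cost e \<and> rel c' s \<and>
    reg c' (tmp j) = eval e s \<and> (\<forall>u<j. reg c' (tmp u) = reg c (tmp u))"
  using assms
proof (induction e arbitrary: j p c)
  case (Num k)
  have "bounded w (exec (prog ! pc c) c)" using Num by (auto simp: bounded_def)
  from reach_exec[OF reach_refl[OF Num(6)] _ this] Num show ?case
    by (intro exI[of _ "exec (prog ! pc c) c"]) (auto simp: rel_def)
next
  case (Var x)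
  let ?c1 = "exec (prog ! pc c) c"
  have b1: "bounded w ?c1" using Var by (auto simp: bounded_def)
  have r1: "reach prog w c 1 ?c1" using reach_exec[OF reach_refl[OF Var(6)] _ b1] Var by simp
  let ?c2 = "exec (prog ! pc ?c1) ?c1"
  have b2: "bounded w ?c2" using Var b1 by (auto simp: bounded_def)
  have r2: "reach prog w c 2 ?c2" using reach_exec[OF r1 _ b2] Var by (simp add: numeral_2_eq_2)
  show ?case using r2 Var by (intro exI[of _ ?c2]) (auto simp: rel_def)
next
  case (Inc e)
  from Inc.prems have "code_at prog p (cexp e j)" "maxc e \<le> W" "8 * (W + cost e) + 8 \<le> w" by auto
  from Inc.IH[OF this(1) Inc.prems(2-4) this(2) Inc.prems(6) this(3)] obtain c' where
    c': "reach prog w c (cost e) c'" "pc c' = p + cost e" "rel c' s" "reg c' (tmp j) = eval e s"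
      "\<forall>u<j. reg c' (tmp u) = reg c (tmp u)" by blast
  have ev: "eval e s \<le> W + cost e" using Inc.prems by (simp add: eval_le)
  let ?c1 = "exec (prog ! pc c') c'"
  have b1: "bounded w ?c1" using Inc.prems reach_bounded[OF c'(1)] c'(2) by (auto simp: bounded_def)
  have r1: "reach prog w c (Suc (cost e)) ?c1" using reach_exec[OF c'(1) _ b1] Inc c'(2) by simp
  let ?c2 = "exec (prog ! pc ?c1) ?c1"
  have b2: "bounded w ?c2" using Inc.prems b1 c' ev by (auto simp: bounded_def)
  have r2: "reach prog w c (cost e + 2) ?c2" using reach_exec[OF r1 _ b2] Inc c' by (simp add: numeral_2_eq_2)
  show ?case using r2 Inc.prems c' by (intro exI[of _ ?c2]) (auto simp: rel_def)
next
  case (Dif e f)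
  from Dif.prems have "code_at prog p (cexp e j)" "maxc e \<le> W" "8 * (W + cost e) + 8 \<le> w" by auto
  from Dif.IH(1)[OF this(1) Dif.prems(2-4) this(2) Dif.prems(6) this(3)] obtain c' where
    c': "reach prog w c (cost e) c'" "pc c' = p + cost e" "rel c' s" "reg c' (tmp j) = eval e s"
      "\<forall>u<j. reg c' (tmp u) = reg c (tmp u)" by blast
  from Dif.prems have "code_at prog (p + cost e) (cexp f (Suc j))" "maxc f \<le> W" "8 * (W + cost f) + 8 \<le> w" by auto
  from Dif.IH(2)[OF this(1) c'(2,3) Dif.prems(4) this(2) reach_bounded[OF c'(1)] this(3)] obtain c2 where
    c2: "reach prog w c' (cost f) c2" "pc c2 = p + cost e + cost f" "rel c2 s" "reg c2 (tmp (Suc j)) = eval f s"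
      "\<forall>u<Suc j. reg c2 (tmp u) = reg c' (tmp u)" by blast
  have ev: "eval e s \<le> W + cost e" using Dif.prems by (simp add: eval_le)
  let ?c1 = "exec (prog ! pc c2) c2"
  have b1: "bounded w ?c1" using Dif.prems reach_bounded[OF c2(1)] c2 c' ev by (auto simp: bounded_def)
  have r1: "reach prog w c (cost e + cost f + 1) ?c1"
    using reach_exec[OF reach_trans[OF c'(1) c2(1)] _ b1] Dif c2(2) by (simp add: add.assoc)
  show ?case using r1 Dif.prems c' c2 by (intro exI[of _ ?c1]) (auto simp: rel_def)
next
  case (Ld a e)
  from Ld.prems have "code_at prog p (cexp e j)" "maxc e \<le> W" "8 * (W + cost e) + 8 \<le> w" by auto
  from Ld.IH[OF this(1) Ld.prems(2-4) this(2) Ld.prems(6) this(3)] obtain c' where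
    c': "reach prog w c (cost e) c'" "pc c' = p + cost e" "rel c' s" "reg c' (tmp j) = eval e s"
      "\<forall>u<j. reg c' (tmp u) = reg c (tmp u)" by blast
  have ev: "eval e s \<le> W + cost e" using Ld.prems by (simp add: eval_le)
  let ?E = "\<lambda>c. exec (prog ! pc c) c"
  note A = Ld.prems(1)[simplified] and a8 = ai_less[of a] and b0 = reach_bounded[OF c'(1)]
  have b1: "bounded w (?E c')" using Ld.prems reach_bounded[OF c'(1)] c' ev A by (auto simp: bounded_def)
  have r1: "reach prog w c (Suc (cost e)) (?E c')" using reach_exec[OF c'(1) _ b1] c'(2) A by simp
  have b2: "bounded w (?E (?E c'))" using Ld.prems b0 c' ev A by (auto simp: bounded_def)
  have r2: "reach prog w c (Suc (Suc (cost e))) (?E (?E c'))" using reach_exec[OF r1 _ b2] c'(2) A by simp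
  have b3: "bounded w (?E (?E (?E c')))" using Ld.prems b0 c' ev A by (auto simp: bounded_def)
  have r3: "reach prog w c (Suc (Suc (Suc (cost e)))) (?E (?E (?E c')))"
    using reach_exec[OF r2 _ b3] c'(2) A by simp
  have b4: "bounded w (?E (?E (?E (?E c'))))" using Ld.prems b0 c' ev A a8 by (auto simp: bounded_def)
  have r4: "reach prog w c (Suc (Suc (Suc (Suc (cost e))))) (?E (?E (?E (?E c'))))"
    using reach_exec[OF r3 _ b4] c'(2) A by simp
  have b5: "bounded w (?E (?E (?E (?E (?E c')))))" using Ld.prems b0 c' ev A a8 by (auto simp: bounded_def)
  have r5: "reach prog w c (Suc (Suc (Suc (Suc (Suc (cost e)))))) (?E (?E (?E (?E (?E c')))))"
    using reach_exec[OF r4 _ b5] c'(2) A by simp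
  have b6: "bounded w (?E (?E (?E (?E (?E (?E c'))))))" using b0 Ld.prems c' ev A a8 by (auto simp: bounded_def)
  have r6: "reach prog w c (cost e + 6) (?E (?E (?E (?E (?E (?E c'))))))"
    using reach_exec[OF r5 _ b6] c'(2) A by (simp add: eval_nat_numeral)
  have addr: "reg (?E (?E (?E (?E (?E c'))))) (tmp j) = 8 * eval e s + ai a"
    using c' A by simp
  have oct: "eval e s + eval e s + (eval e s + eval e s) + (eval e s + eval e s + (eval e s + eval e s)) = 8 * eval e s"
    by simp
  show ?case using r6 A c' addr by (intro exI[of _ "?E (?E (?E (?E (?E (?E c')))))"]) (auto simp: rel_def oct)
qed

lemma test_correct:
  assumes "code_at prog p (cexp e 0 @ [Const (tmp 1) 0, Jle (tmp 0) (tmp 1) l])" "pc d = p" "rel d s"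
    "sbounded W s" "maxc e \<le> W" "bounded w d" "8 * (W + cost e) + 8 \<le> w"
  shows "\<exists>d'. reach prog w d (cost e + 2) d' \<and> pc d' = (if eval e s = 0 then l else p + cost e + 2) \<and> rel d' s"
proof -
  note B = assms(1)[simplified]
  obtain c' where c': "reach prog w d (cost e) c'" "pc c' = p + cost e" "rel c' s" "reg c' (tmp 0) = eval e s"
    using cexp_correct[of prog p e 0, OF _ assms(2-)] B by auto
  note b0 = reach_bounded[OF c'(1)]
  let ?E = "\<lambda>c. exec (prog ! pc c) c"
  have b1: "bounded w (?E c')" using b0 B c' by (auto simp: bounded_def)
  have r1: "reach prog w d (Suc (cost e)) (?E c')" using reach_exec[OF c'(1) _ b1] c'(2) B by simp
  have b2: "bounded w (?E (?E c'))" using b0 B c' by (auto simp: bounded_def)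
  have r2: "reach prog w d (cost e + 2) (?E (?E c'))" using reach_exec[OF r1 _ b2] c'(2) B by simp
  show ?thesis using r2 c' B by (intro exI[of _ "?E (?E c')"]) (auto simp: rel_def)
qed

text \<open>The bound W on the state varies in the induction: after t steps it becomes W + t, and
  the remaining time shrinks by t, so the sum that w has to dominate does not change.\<close>

lemma ccom_correct:
  assumes "big c s t s'" "code_at prog p (ccom c p)" "pc d = p" "rel d s" "sbounded W s" "maxcc c \<le> W"
    "bounded w d" "8 * (W + t) + 8 \<le> w"
  shows "\<exists>d'. reach prog w d t d' \<and> pc d' = p + length (ccom c p) \<and> rel d' s'"
  using assms
proof (induction arbitrary: p d W)
  case (Skip s)
  then show ?case using reach_refl by (intro exI[of _ d]) auto
next
  case (Asg x e s)
  then have A: "code_at prog p (cexp e 0)" "maxc e \<le> W" "8 * (W + cost e) + 8 \<le> w" by auto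
  obtain c' where c': "reach prog w d (cost e) c'" "pc c' = p + cost e" "rel c' s"
      "reg c' (tmp 0) = eval e s"
    using cexp_correct[OF A(1) Asg.prems(2-4) A(2) Asg.prems(6) A(3)] by blast
  have ev: "eval e s \<le> W + cost e" using Asg.prems by (simp add: eval_le)
  note b0 = reach_bounded[OF c'(1)]
  let ?E = "\<lambda>c. exec (prog ! pc c) c"
  have b1: "bounded w (?E c')" using b0 Asg.prems c' ev by (auto simp: bounded_def)
  have r1: "reach prog w d (Suc (cost e)) (?E c')" using reach_exec[OF c'(1) _ b1] c'(2) Asg.prems by simp
  have b2: "bounded w (?E (?E c'))" using b0 Asg.prems c' ev by (auto simp: bounded_def)
  have r2: "reach prog w d (cost e + 2) (?E (?E c'))" using reach_exec[OF r1 _ b2] c'(2) Asg.prems by simp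
  show ?case using r2 c' Asg.prems by (intro exI[of _ "?E (?E c')"]) (auto simp: rel_def)
next
  case (St a e f s)
  then have A: "code_at prog p (cexp e 0)" "maxc e \<le> W" "8 * (W + cost e) + 8 \<le> w" by auto
  obtain c' where c': "reach prog w d (cost e) c'" "pc c' = p + cost e" "rel c' s"
      "reg c' (tmp 0) = eval e s"
    using cexp_correct[OF A(1) St.prems(2-4) A(2) St.prems(6) A(3)] by blast
  have ev: "eval e s \<le> W + cost e" using St.prems by (simp add: eval_le)
  note b0 = reach_bounded[OF c'(1)] and B = St.prems(1)[simplified] and a8 = ai_less[of a]
  let ?E = "\<lambda>c. exec (prog ! pc c) c"
  have b1: "bounded w (?E c')" using b0 St.prems c' ev B by (auto simp: bounded_def)
  have r1: "reach prog w d (Suc (cost e)) (?E c')" using reach_exec[OF c'(1) _ b1] c'(2) B by simp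
  have b2: "bounded w (?E (?E c'))" using b0 St.prems c' ev B by (auto simp: bounded_def)
  have r2: "reach prog w d (Suc (Suc (cost e))) (?E (?E c'))" using reach_exec[OF r1 _ b2] c'(2) B by simp
  have b3: "bounded w (?E (?E (?E c')))" using b0 St.prems c' ev B by (auto simp: bounded_def)
  have r3: "reach prog w d (Suc (Suc (Suc (cost e)))) (?E (?E (?E c')))"
    using reach_exec[OF r2 _ b3] c'(2) B by simp
  have b4: "bounded w (?E (?E (?E (?E c'))))" using b0 St.prems c' ev B a8 by (auto simp: bounded_def)
  have r4: "reach prog w d (Suc (Suc (Suc (Suc (cost e))))) (?E (?E (?E (?E c'))))"
    using reach_exec[OF r3 _ b4] c'(2) B by simp
  have b5: "bounded w (?E (?E (?E (?E (?E c')))))" using b0 St.prems c' ev B a8 by (auto simp: bounded_def)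
  have r5: "reach prog w d (Suc (Suc (Suc (Suc (Suc (cost e)))))) (?E (?E (?E (?E (?E c')))))"
    using reach_exec[OF r4 _ b5] c'(2) B by simp
  define c5 where "c5 = ?E (?E (?E (?E (?E c'))))"
  have c5: "reg c5 (tmp 0) = 8 * eval e s + ai a" "rel c5 s" "pc c5 = p + cost e + 5"
    using c' B by (auto simp: c5_def rel_def)
  have "code_at prog (p + cost e + 5) (cexp f 1)" "maxc f \<le> W" "8 * (W + cost f) + 8 \<le> w"
    using St.prems by (auto simp: eval_nat_numeral)
  from cexp_correct[OF this(1) c5(3,2) St.prems(4) this(2) b5[folded c5_def] this(3)] obtain c6 where
    c6: "reach prog w c5 (cost f) c6" "pc c6 = p + cost e + 5 + cost f" "rel c6 s"
      "reg c6 (tmp 1) = eval f s" "reg c6 (tmp 0) = 8 * eval e s + ai a"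
    using c5(1) by auto
  have evf: "eval f s \<le> W + cost f" using St.prems by (simp add: eval_le)
  have at6: "prog ! pc c6 = Store (tmp 0) (tmp 1)" "pc c6 < length prog"
    using B c6(2) by (auto simp: eval_nat_numeral add.assoc)
  have b6: "bounded w (?E c6)" using reach_bounded[OF c6(1)] at6 c6 evf St.prems by (auto simp: bounded_def)
  have r6: "reach prog w d (cost e + cost f + 6) (?E c6)"
    using reach_exec[OF reach_trans[OF r5[folded c5_def] c6(1)] at6(2) b6] by (simp add: eval_nat_numeral)
  show ?case using r6 c6 at6 by (intro exI[of _ "?E c6"]) (auto simp: rel_def)
next
  case (Wr e s)
  then have A: "code_at prog p (cexp e 0)" "maxc e \<le> W" "8 * (W + cost e) + 8 \<le> w" by auto
  obtain c' where c': "reach prog w d (cost e) c'" "pc c' = p + cost e" "rel c' s"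
      "reg c' (tmp 0) = eval e s"
    using cexp_correct[OF A(1) Wr.prems(2-4) A(2) Wr.prems(6) A(3)] by blast
  note b0 = reach_bounded[OF c'(1)]
  let ?E = "\<lambda>c. exec (prog ! pc c) c"
  have b1: "bounded w (?E c')" using b0 Wr.prems c' by (auto simp: bounded_def)
  have r1: "reach prog w d (Suc (cost e)) (?E c')" using reach_exec[OF c'(1) _ b1] c'(2) Wr.prems by simp
  show ?case using r1 c' Wr.prems by (intro exI[of _ "?E c'"]) (auto simp: rel_def)
next
  case (Seq c s t s' e u s'')
  have A: "code_at prog p (ccom c p)" "maxcc c \<le> W" "8 * (W + t) + 8 \<le> w"
    using Seq.prems by (auto simp: Let_def)
  obtain d1 where d1: "reach prog w d t d1" "pc d1 = p + length (ccom c p)" "rel d1 s'"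
    using Seq.IH(1)[OF A(1) Seq.prems(2-4) A(2) Seq.prems(6) A(3)] by blast
  have B: "code_at prog (p + length (ccom c p)) (ccom e (p + length (ccom c p)))"
    "maxcc e \<le> W + t" "8 * (W + t + u) + 8 \<le> w"
    using Seq.prems by (auto simp: Let_def)
  have "sbounded (W + t) s'" using big_sbounded[OF Seq.hyps(1) Seq.prems(4) A(2)] .
  from Seq.IH(2)[OF B(1) d1(2,3) this B(2) reach_bounded[OF d1(1)] B(3)] obtain d2 where
    d2: "reach prog w d1 u d2" "pc d2 = p + length (ccom c p) + length (ccom e (p + length (ccom c p)))" "rel d2 s''"
    by blast
  show ?case using reach_trans[OF d1(1) d2(1)] d2 by (intro exI[of _ d2]) (auto simp: Let_def)
next
  case (IfT e s c t s' c2)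
  let ?p = "p + cost e + 2"
  let ?l = "Suc (?p + length (ccom c ?p))"
  note B = IfT.prems(1)[unfolded ccom.simps Let_def]
  obtain d2 where d2: "reach prog w d (cost e + 2) d2" "pc d2 = ?p" "rel d2 s"
    using test_correct[of prog p e ?l d s W w] B IfT.prems IfT.hyps by auto
  have "code_at prog ?p (ccom c ?p)" "maxcc c \<le> W" "8 * (W + t) + 8 \<le> w" using B IfT.prems by auto
  from IfT.IH[OF this(1) d2(2,3) IfT.prems(4) this(2) reach_bounded[OF d2(1)] this(3)] obtain d3 where
    d3: "reach prog w d2 t d3" "pc d3 = ?p + length (ccom c ?p)" "rel d3 s'" by blast
  let ?E = "\<lambda>c. exec (prog ! pc c) c"
  have b4: "bounded w (?E d3)" using reach_bounded[OF d3(1)] B d3 by (auto simp: bounded_def)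
  have r4: "reach prog w d (cost e + t + 3) (?E d3)"
    using reach_exec[OF reach_trans[OF d2(1) d3(1)] _ b4] B d3(2) by (simp add: eval_nat_numeral)
  show ?case using r4 d3 B by (intro exI[of _ "?E d3"]) (auto simp: Let_def rel_def)
next
  case (IfF e s c2 t s' c)
  let ?p = "p + cost e + 2"
  let ?l = "Suc (?p + length (ccom c ?p))"
  note B = IfF.prems(1)[unfolded ccom.simps Let_def]
  obtain d2 where d2: "reach prog w d (cost e + 2) d2" "pc d2 = ?l" "rel d2 s"
    using test_correct[of prog p e ?l d s W w] B IfF.prems IfF.hyps by auto
  have "code_at prog ?l (ccom c2 ?l)" "maxcc c2 \<le> W" "8 * (W + t) + 8 \<le> w" using B IfF.prems by auto
  from IfF.IH[OF this(1) d2(2,3) IfF.prems(4) this(2) reach_bounded[OF d2(1)] this(3)] obtain d3 where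
    d3: "reach prog w d2 t d3" "pc d3 = ?l + length (ccom c2 ?l)" "rel d3 s'" by blast
  have eq: "cost e + 2 + t = cost e + t + 2" by simp
  have "pc d3 = p + length (ccom (If e c c2) p)" using d3(2) by (simp add: Let_def)
  then show ?case using reach_trans[OF d2(1) d3(1)] d3(3) unfolding eq by blast
next
  case (WhlF e s c)
  let ?l = "Suc (p + cost e + 2 + length (ccom c (p + cost e + 2)))"
  note B = WhlF.prems(1)[unfolded ccom.simps Let_def]
  obtain d2 where "reach prog w d (cost e + 2) d2" "pc d2 = ?l" "rel d2 s"
    using test_correct[of prog p e ?l d s W w] B WhlF.prems WhlF.hyps by auto
  then show ?case by (intro exI[of _ d2]) (auto simp: Let_def)
next
  case (WhlT e s c t s' u s'')
  let ?p = "p + cost e + 2"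
  let ?l = "Suc (?p + length (ccom c ?p))"
  note B = WhlT.prems(1)[unfolded ccom.simps Let_def]
  obtain d2 where d2: "reach prog w d (cost e + 2) d2" "pc d2 = ?p" "rel d2 s"
    using test_correct[of prog p e ?l d s W w] B WhlT.prems WhlT.hyps by auto
  have C: "code_at prog ?p (ccom c ?p)" "maxcc c \<le> W" "8 * (W + t) + 8 \<le> w" using B WhlT.prems by auto
  from WhlT.IH(1)[OF C(1) d2(2,3) WhlT.prems(4) C(2) reach_bounded[OF d2(1)] C(3)] obtain d3 where
    d3: "reach prog w d2 t d3" "pc d3 = ?p + length (ccom c ?p)" "rel d3 s'" by blast
  let ?E = "\<lambda>c. exec (prog ! pc c) c"
  have b4: "bounded w (?E d3)" using reach_bounded[OF d3(1)] B d3 by (auto simp: bounded_def)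
  have r4: "reach prog w d (cost e + t + 3) (?E d3)"
    using reach_exec[OF reach_trans[OF d2(1) d3(1)] _ b4] B d3(2) by (simp add: eval_nat_numeral)
  have d4: "pc (?E d3) = p" "rel (?E d3) s'" using d3 B by (auto simp: rel_def)
  have "sbounded (W + t) s'" using big_sbounded[OF WhlT.hyps(2) WhlT.prems(4) C(2)] .
  moreover have "maxcc (Whl e c) \<le> W + t" "8 * (W + t + u) + 8 \<le> w" using WhlT.prems by auto
  ultimately obtain d5 where
    d5: "reach prog w (?E d3) u d5" "pc d5 = p + length (ccom (Whl e c) p)" "rel d5 s''"
    using WhlT.IH(2)[OF WhlT.prems(1) d4 _ _ b4] by blast
  have eq: "cost e + t + 3 + u = cost e + t + u + 3" by simp
  show ?case using reach_trans[OF r4 d5(1)] d5(2,3) unfolding eq by blast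
qed

text \<open>
  Spreads the input from the cells \<open>i\<close> to the cells \<open>8 * i\<close>, from the last one downwards so that no
  cell is overwritten before it has been read.
\<close>

definition prologue :: "instr list" where
  "prologue = [Const 3 1, Jle 3 0 3, Jle 0 0 12, Sub 0 0 3, Load 1 0, Const 5 0, Store 0 5,
     Add 5 0 0, Add 5 5 5, Add 5 5 5, Store 5 1, Jle 0 0 1]"

definition init_st :: "nat list \<Rightarrow> st" where
  "init_st x = \<lparr>vv = (\<lambda>_. 0),
     aa = (\<lambda>_ _. 0)(INP := (\<lambda>i. if i < length x then x ! i else 0)), oo = []\<rparr>"

definition moved :: "nat list \<Rightarrow> nat \<Rightarrow> nat \<Rightarrow> nat" where
  "moved x i a = (if a < i then x ! a
     else if 8 dvd a \<and> i \<le> a div 8 \<and> a div 8 < length x then x ! (a div 8) else 0)"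

text \<open>The source cell is cleared before the target is written. This order matters for i = 0,
  where both are the same cell.\<close>

lemma moved_step:
  assumes "Suc i \<le> length x"
  shows "(moved x (Suc i))(i := 0, 8 * i := moved x (Suc i) i) = moved x i"
  using assms by (fastforce simp: moved_def fun_eq_iff)

text \<open>Ten instructions per entry and two for leaving. The registers 0, 1, 3 and 5 used here
  belong to no variable, so all variables still have the value 0 afterwards.\<close>

lemma prologue_loop:
  assumes P: "code_at prog 0 prologue"
    and c: "pc c = Suc 0" "reg c 0 = i" "reg c 3 = 1" "\<And>v. reg c (rv v) = 0" "mem c = moved x i" "out c = []"
    and b: "bounded w c" "8 * length x \<le> w" "i \<le> length x"
  shows "\<exists>c'. reach prog w c (10 * i + 2) c' \<and> pc c' = 12 \<and> rel c' (init_st x)"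
  using c b
proof (induction i arbitrary: c)
  case 0
  have Q: "prog ! Suc 0 = Jle 3 0 3" "prog ! 2 = Jle 0 0 12" "12 \<le> length prog"
    using P by (auto simp: prologue_def eval_nat_numeral)
  let ?E = "\<lambda>c. exec (prog ! pc c) c"
  have b1: "bounded w (?E c)" using 0 Q by (auto simp: bounded_def)
  have r1: "reach prog w c 1 (?E c)" using reach_exec[OF reach_refl[OF 0(7)] _ b1] Q 0 by simp
  have b2: "bounded w (?E (?E c))" using 0 Q by (auto simp: bounded_def numeral_2_eq_2[symmetric])
  have r2: "reach prog w c 2 (?E (?E c))" using reach_exec[OF r1 _ b2] Q 0 by (simp add: numeral_2_eq_2)
  have m0: "moved x 0 (8 * j + ai a) = aa (init_st x) a j" for a j
  proof -
    have "8 dvd (8 * j + ai a) \<longleftrightarrow> a = INP"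
      by (cases a; simp; presburger)
    moreover have "(8 * j + ai a) div 8 = j" using ai_less[of a] by simp
    ultimately show ?thesis by (auto simp: moved_def init_st_def)
  qed
  have "rel (?E (?E c)) (init_st x)" using 0 Q m0
    by (auto simp: rel_def numeral_2_eq_2[symmetric] init_st_def)
  moreover have "pc (?E (?E c)) = 12" using 0 Q by (simp add: numeral_2_eq_2[symmetric])
  ultimately show ?case using r2 by (intro exI[of _ "?E (?E c)"]) (simp add: numeral_2_eq_2)
next
  case (Suc i)
  have Q: "prog ! Suc 0 = Jle 3 0 3" "prog ! 3 = Sub 0 0 3" "prog ! 4 = Load 1 0" "prog ! 5 = Const 5 0"
      "prog ! 6 = Store 0 5" "prog ! 7 = Add 5 0 0" "prog ! 8 = Add 5 5 5" "prog ! 9 = Add 5 5 5"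
      "prog ! 10 = Store 5 1" "prog ! 11 = Jle 0 0 1" "12 \<le> length prog"
    using P by (auto simp: prologue_def eval_nat_numeral)
  let ?E = "\<lambda>c. exec (prog ! pc c) c"
  have odd: "rv v \<noteq> 0" "rv v \<noteq> 1" "rv v \<noteq> Suc 0" "rv v \<noteq> 5" for v unfolding rv.simps by presburger+
  have mb: "mem c i \<le> w" "i \<le> w" "8 * i \<le> w" using Suc.prems by (auto simp: bounded_def)
  note S = Suc.prems(1-6) and B = Suc.prems(7) Q mb
  have b1: "bounded w (?E c)" using S B by (auto simp: bounded_def)
  have b2: "bounded w (?E (?E c))" using S B by (auto simp: bounded_def)
  have b3: "bounded w (?E (?E (?E c)))" using S B by (auto simp: bounded_def)
  have b4: "bounded w (?E (?E (?E (?E c))))" using S B by (auto simp: bounded_def)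
  have b5: "bounded w (?E (?E (?E (?E (?E c)))))" using S B by (auto simp: bounded_def)
  have b6: "bounded w (?E (?E (?E (?E (?E (?E c))))))" using S B by (auto simp: bounded_def)
  have b7: "bounded w (?E (?E (?E (?E (?E (?E (?E c)))))))" using S B by (auto simp: bounded_def)
  have b8: "bounded w (?E (?E (?E (?E (?E (?E (?E (?E c))))))))" using S B by (auto simp: bounded_def)
  have b9: "bounded w (?E (?E (?E (?E (?E (?E (?E (?E (?E c)))))))))" using S B by (auto simp: bounded_def)
  have b10: "bounded w (?E (?E (?E (?E (?E (?E (?E (?E (?E (?E c))))))))))" using S B by (auto simp: bounded_def)
  have r1: "reach prog w c 1 (?E c)" using reach_exec[OF reach_refl[OF Suc.prems(7)] _ b1] Q S by simp
  note r2 = reach_exec[OF r1 _ b2] note r3 = reach_exec[OF r2 _ b3] note r4 = reach_exec[OF r3 _ b4]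
  note r5 = reach_exec[OF r4 _ b5] note r6 = reach_exec[OF r5 _ b6] note r7 = reach_exec[OF r6 _ b7]
  note r8 = reach_exec[OF r7 _ b8] note r9 = reach_exec[OF r8 _ b9] note r10 = reach_exec[OF r9 _ b10]
  define d where "d = ?E (?E (?E (?E (?E (?E (?E (?E (?E (?E c)))))))))"
  have rd: "reach prog w c 10 d" unfolding d_def using r10 Q S by (simp add: eval_nat_numeral)
  have d: "pc d = Suc 0" "reg d 0 = i" "reg d 3 = 1" "reg d (rv v) = 0" "out d = []"
    "mem d = (moved x (Suc i))(i := 0, 8 * i := moved x (Suc i) i)" for v
    unfolding d_def using Q S odd[of v] by (simp_all add: fun_eq_iff)
  have "mem d = moved x i" using d(6) moved_step Suc.prems(9) by simp
  from Suc.IH[OF d(1,2,3,4) this d(5) _ Suc.prems(8)] Suc.prems(9) b10[folded d_def] obtain c' where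
    "reach prog w d (10 * i + 2) c' \<and> pc c' = 12 \<and> rel c' (init_st x)" by auto
  then show ?case using reach_trans[OF rd, of "10 * i + 2" c'] by auto
qed

theorem ram_of_com:
  assumes "big c (init_st x) t s"
  shows "computes (prologue @ ccom c 12) x (oo s) (10 * length x + 3 + t)
    (8 * (1 + maxcc c + length x + Max (insert 0 (set x)) + t) + 8)"
proof -
  let ?prog = "prologue @ ccom c 12"
  define mx where "mx = Max (insert 0 (set x))"
  define W where "W = 1 + maxcc c + length x + mx"
  define w where "w = 8 * (W + t) + 8"
  have P: "code_at ?prog 0 prologue" by (simp add: code_at_def nth_append)
  have len: "length prologue = 12" by (simp add: prologue_def)
  have C: "code_at ?prog 12 (ccom c 12)" by (simp add: code_at_def nth_append len)
  have xW: "x ! i \<le> W" if "i < length x" for i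
  proof -
    have "x ! i \<le> Max (insert 0 (set x))" using that by (intro Max_ge) auto
    then show ?thesis by (simp only: W_def mx_def)
  qed
  have W: "length x \<le> w" "8 * length x \<le> w" "1 \<le> w" "W \<le> w" "3 \<le> w" by (auto simp: w_def W_def)
  have b0: "bounded w (init x)" using W xW by (fastforce simp: bounded_def init_def)
  let ?d = "exec (?prog ! 0) (init x)"
  have p0: "?prog ! 0 = Const 3 1" by (simp add: prologue_def)
  have bd: "bounded w ?d" using b0 W p0 by (auto simp: bounded_def)
  have rd: "reach ?prog w (init x) 1 ?d"
    using reach_exec[OF reach_refl[OF b0], of ?prog] bd len by (simp add: init_def)
  have rv3: "rv v \<noteq> 3" "rv v \<noteq> 0" for v unfolding rv.simps by presburger+
  have "mem ?d = moved x (length x)" by (auto simp: p0 init_def moved_def fun_eq_iff)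
  then obtain d1 where d1: "reach ?prog w ?d (10 * length x + 2) d1" "pc d1 = 12" "rel d1 (init_st x)"
    using prologue_loop[OF P, of ?d "length x" x w] bd W rv3 by (auto simp: p0 init_def)
  have "sbounded W (init_st x)" using xW by (auto simp: sbounded_def init_st_def)
  then obtain d2 where d2: "reach ?prog w d1 t d2" "pc d2 = 12 + length (ccom c 12)" "rel d2 s"
    using ccom_correct[OF assms C d1(2,3) _ _ reach_bounded[OF d1(1)], of W] by (auto simp: W_def w_def)
  have eq: "1 + (10 * length x + 2) + t = 10 * length x + 3 + t" by simp
  have "reach ?prog w (init x) (10 * length x + 3 + t) d2"
    using reach_trans[OF reach_trans[OF rd d1(1)] d2(1)] unfolding eq .
  then have "computes ?prog x (oo s) (10 * length x + 3 + t) w"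
    using d2 len by (auto simp: reach_def computes_def run_def halted_def rel_def bounded_def)
  then show ?thesis by (simp only: w_def W_def mx_def)
qed

section \<open>Weakest preconditions with running time\<close>

inductive_simps big_Skip: "big Skip s t s'"
inductive_simps big_Asg: "big (Asg x e) s t s'"
inductive_simps big_St: "big (St a e f) s t s'"
inductive_simps big_Wr: "big (Wr e) s t s'"
inductive_simps big_Seq: "big (Seq c d) s t s'"
inductive_simps big_If: "big (If e c d) s t s'"

text \<open>One derivation is what \<open>ram_of_com\<close> consumes, so this predicate carries
  termination, result and exact time at once.\<close>

definition wp :: "com \<Rightarrow> (nat \<Rightarrow> st \<Rightarrow> bool) \<Rightarrow> st \<Rightarrow> bool" where
  "wp c Q s \<longleftrightarrow> (\<exists>t s'. big c s t s' \<and> Q t s')"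

lemma wp_Skip [simp]: "wp Skip Q s \<longleftrightarrow> Q 0 s"
  by (auto simp: wp_def big_Skip)

lemma wp_Asg [simp]: "wp (Asg x e) Q s \<longleftrightarrow> Q (cost e + 2) (s\<lparr>vv := (vv s)(x := eval e s)\<rparr>)"
  by (auto simp: wp_def big_Asg)

lemma wp_St [simp]: "wp (St a e f) Q s \<longleftrightarrow>
  Q (cost e + cost f + 6) (s\<lparr>aa := (aa s)(a := (aa s a)(eval e s := eval f s))\<rparr>)"
  by (auto simp: wp_def big_St)

lemma wp_Wr [simp]: "wp (Wr e) Q s \<longleftrightarrow> Q (cost e + 1) (s\<lparr>oo := oo s @ [eval e s]\<rparr>)"
  by (auto simp: wp_def big_Wr)

lemma wp_Seq [simp]: "wp (Seq c d) Q s \<longleftrightarrow> wp c (\<lambda>t. wp d (\<lambda>u. Q (t + u))) s"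
  unfolding wp_def big_Seq by blast

lemma wp_If [simp]: "wp (If e c d) Q s \<longleftrightarrow>
  (if eval e s \<noteq> 0 then wp c (\<lambda>t. Q (cost e + t + 3)) s else wp d (\<lambda>t. Q (cost e + t + 2)) s)"
  by (auto simp: wp_def big_If)

lemma wp_mono: "wp c Q s \<Longrightarrow> (\<And>t s'. Q t s' \<Longrightarrow> Q' t s') \<Longrightarrow> wp c Q' s"
  unfolding wp_def by blast

text \<open>The ghost value x records what the state shows only indirectly, such as the number coded
  by an array of digits. The potential bounds the remaining time and also proves termination, since
  every round pays at least 3.\<close>

lemma wp_Whl_ghost:
  assumes "J x s"
    and "\<And>x s. J x s \<Longrightarrow> eval e s \<noteq> 0 \<Longrightarrow> wp c (\<lambda>t s'. \<exists>x'. J x' s' \<and> t + cost e + 3 + \<Phi> x' \<le> \<Phi> x) s"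
  shows "wp (Whl e c) (\<lambda>t s'. (\<exists>x'. J x' s') \<and> eval e s' = 0 \<and> t \<le> \<Phi> x + cost e + 2) s"
  using assms(1)
proof (induction "\<Phi> x" arbitrary: x s rule: less_induct)
  case less
  show ?case
  proof (cases "eval e s = 0")
    case True
    then show ?thesis using less.prems unfolding wp_def by (blast intro: big.WhlF le_add2 add_le_mono1)
  next
    case False
    from assms(2)[OF less.prems False] obtain t s' x' where
      1: "big c s t s'" "J x' s'" "t + cost e + 3 + \<Phi> x' \<le> \<Phi> x" unfolding wp_def by blast
    then have "\<Phi> x' < \<Phi> x" by simp
    from less.hyps[OF this 1(2)] obtain u s'' where
      2: "big (Whl e c) s' u s''" "\<exists>x'. J x' s''" "eval e s'' = 0" "u \<le> \<Phi> x' + cost e + 2" unfolding wp_def by blast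
    have "cost e + t + u + 3 \<le> \<Phi> x + cost e + 2" using 1(3) 2(4) by simp
    then show ?thesis unfolding wp_def using big.WhlT[OF False 1(1) 2(1)] 2(2,3) by blast
  qed
qed

lemma wp_Whl:
  assumes "I s"
    and "\<And>s. I s \<Longrightarrow> eval e s \<noteq> 0 \<Longrightarrow> wp c (\<lambda>t s'. I s' \<and> t + cost e + 3 + \<Phi> s' \<le> \<Phi> s) s"
  shows "wp (Whl e c) (\<lambda>t s'. I s' \<and> eval e s' = 0 \<and> t \<le> \<Phi> s + cost e + 2) s"
  using wp_Whl_ghost[of "\<lambda>x s'. x = s' \<and> I s'" s s e c \<Phi>] assms by simp

fun modv :: "com \<Rightarrow> var set" where
  "modv (Asg x e) = {x}"
| "modv (Seq c d) = modv c \<union> modv d"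
| "modv (If e c d) = modv c \<union> modv d"
| "modv (Whl e c) = modv c"
| "modv _ = {}"

fun moda :: "com \<Rightarrow> arr set" where
  "moda (St a e f) = {a}"
| "moda (Seq c d) = moda c \<union> moda d"
| "moda (If e c d) = moda c \<union> moda d"
| "moda (Whl e c) = moda c"
| "moda _ = {}"

fun nowr :: "com \<Rightarrow> bool" where
  "nowr (Wr e) = False"
| "nowr (Seq c d) = (nowr c \<and> nowr d)"
| "nowr (If e c d) = (nowr c \<and> nowr d)"
| "nowr (Whl e c) = nowr c"
| "nowr _ = True"

definition same_but :: "com \<Rightarrow> st \<Rightarrow> st \<Rightarrow> bool" where
  "same_but c s s' \<longleftrightarrow> (\<forall>x. x \<notin> modv c \<longrightarrow> vv s' x = vv s x) \<and> (\<forall>a. a \<notin> moda c \<longrightarrow> aa s' a = aa s a) \<and>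
     (nowr c \<longrightarrow> oo s' = oo s)"

lemma big_same_but: "big c s t s' \<Longrightarrow> same_but c s s'"
  by (induction rule: big.induct) (auto simp: same_but_def)

lemma wp_frame: "wp c Q s \<Longrightarrow> wp c (\<lambda>t s'. Q t s' \<and> same_but c s s') s"
  unfolding wp_def using big_same_but by blast

text \<open>A frame rule: what a command leaves unchanged is read off its text, so specifications
  need to mention only what changes.\<close>

lemma wp_use:
  assumes "wp c Q s" "\<And>t s'. Q t s' \<Longrightarrow> same_but c s s' \<Longrightarrow> Q' t s'"
  shows "wp c Q' s"
  using wp_mono[OF wp_frame[OF assms(1)]] assms(2) by blast

text \<open>
  Truth values are 0 and 1; comparison, negation and conjunction are expressed by truncated subtraction.
\<close>

definition Le :: "exp \<Rightarrow> exp \<Rightarrow> exp" where "Le a b = Dif (Num 1) (Dif a b)"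
definition Lt :: "exp \<Rightarrow> exp \<Rightarrow> exp" where "Lt a b = Le (Inc a) b"
definition Neg' :: "exp \<Rightarrow> exp" where "Neg' a = Dif (Num 1) a"
definition And :: "exp \<Rightarrow> exp \<Rightarrow> exp" where "And a b = Dif a (Dif (Num 1) b)"
definition Eq :: "exp \<Rightarrow> exp \<Rightarrow> exp" where "Eq a b = And (Le a b) (Le b a)"

lemma eval_bool [simp]:
  "eval (Le a b) s = of_bool (eval a s \<le> eval b s)"
  "eval (Lt a b) s = of_bool (eval a s < eval b s)"
  "eval (Neg' a) s = of_bool (eval a s = 0)"
  "eval (And a b) s = eval a s - (1 - eval b s)"
  "eval (Eq a b) s = of_bool (eval a s = eval b s)"
  by (auto simp: Le_def Lt_def Neg'_def And_def Eq_def)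

text \<open>\<open>And\<close> lowers the value of its first argument by one if the second is 0,
  which is conjunction only when the first argument is a truth value.\<close>

lemma of_bool_and [simp]:
  "(of_bool P :: nat) - (Suc 0 - y) = of_bool (P \<and> y \<noteq> 0)"
  "Suc 0 - (Suc 0 - y) = of_bool (y \<noteq> 0)"
  by auto

lemma cost_bool [simp]:
  "cost (Le a b) = cost a + cost b + 3" "cost (Lt a b) = cost a + cost b + 5"
  "cost (Neg' a) = cost a + 2" "cost (And a b) = cost a + cost b + 3"
  "cost (Eq a b) = 2 * cost a + 2 * cost b + 9"
  by (auto simp: Le_def Lt_def Neg'_def And_def Eq_def)

section \<open>Sets and counters stored in arrays\<close>

definition ind :: "nat set \<Rightarrow> nat \<Rightarrow> nat" where "ind M i = of_bool (i \<in> M)"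

definition digits :: "nat \<Rightarrow> nat \<Rightarrow> nat \<Rightarrow> nat \<Rightarrow> nat" where
  "digits b r v i = (if i < r then (v div b ^ i) mod b else 0)"

lemma digits_0 [simp]: "digits b r 0 = (\<lambda>_. 0)" by (simp add: digits_def fun_eq_iff)

text \<open>Increment with carry. On overflow the array ends up all zero and the flag f is cleared,
  so a finished enumeration leaves its counter ready for the next one.\<close>

definition INC :: "arr \<Rightarrow> var \<Rightarrow> exp \<Rightarrow> var \<Rightarrow> com" where
  "INC A l m f = Seq (Asg Vi (Num 0)) (Seq
     (Whl (And (Lt (Var Vi) (Var l)) (Le m (Ld A (Var Vi))))
       (Seq (St A (Var Vi) (Num 0)) (Asg Vi (Inc (Var Vi)))))
     (If (Lt (Var Vi) (Var l)) (St A (Var Vi) (Inc (Ld A (Var Vi)))) (Asg f (Num 0))))"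

text \<open>If the i lowest digits are maximal and w = v div b^i, then v + 1 = (w + 1) b^i, and
  increasing w causes no further carry.\<close>

lemma digits_carry:
  assumes b: "2 \<le> b" and v: "v mod b ^ i = b ^ i - 1" and d: "(v div b ^ i) mod b < b - 1"
  shows "((v + 1) div b ^ j) mod b =
    (if j < i then 0 else if j = i then Suc ((v div b ^ i) mod b) else (v div b ^ j) mod b)"
proof -
  have bi: "0 < b ^ i" using b by simp
  let ?w = "v div b ^ i"
  have "v = ?w * b ^ i + (b ^ i - 1)" using v by (metis div_mult_mod_eq)
  then have "v + 1 = ?w * b ^ i + b ^ i" using bi by linarith
  then have v1: "v + 1 = (?w + 1) * b ^ i" by (simp only: add_mult_distrib mult_1)
  consider "j < i" | "j = i" | "i < j" by linarith
  then show ?thesis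
  proof cases
    case 1
    then have "i = i - Suc j + Suc j" by simp
    then have "b ^ i = b ^ (i - Suc j) * b ^ Suc j" by (metis power_add)
    then have "(?w + 1) * b ^ i = (?w + 1) * b ^ (i - Suc j) * b * b ^ j"
      by (simp only: power_Suc mult.assoc)
    then have "(v + 1) div b ^ j = (?w + 1) * b ^ (i - Suc j) * b" using v1 b by simp
    then show ?thesis using 1 by simp
  next
    case 2
    have "(?w + 1) mod b = Suc (?w mod b)" using d by (simp add: mod_Suc)
    then show ?thesis using 2 v1 bi by simp
  next
    case 3
    then obtain k where k: "j = i + (1 + k)" by (metis add.assoc add_Suc_right less_imp_Suc_add plus_1_eq_Suc)
    have "(?w + 1) div b = ?w div b" using d by (simp add: div_Suc mod_Suc)
    then have "(v + 1) div b ^ j = v div b ^ j"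
      unfolding k power_add div_mult2_eq using v1 bi by simp
    then show ?thesis using 3 by simp
  qed
qed

text \<open>The largest digit m is an expression because \<open>DIG\<close> counts in base 2 or 3
  according to \<open>Vnv\<close>. It has to be independent of \<open>Vi\<close> and of the arrays,
  which change during the loop.\<close>

lemma INC_correct:
  assumes s: "aa s A = digits b r v" "v < b ^ r" "2 \<le> b" "vv s l = r" "l \<noteq> Vi" "f \<noteq> Vi"
    and m: "\<And>s'. \<forall>x. x \<noteq> Vi \<longrightarrow> vv s' x = vv s x \<Longrightarrow> eval m s' = b - 1"
  shows "wp (INC A l m f) (\<lambda>t s'. aa s' A = digits b r (if v + 1 < b ^ r then v + 1 else 0) \<and>
    vv s' f = (if v + 1 < b ^ r then vv s f else 0) \<and> t \<le> (cost m + 80) * (r + 1)) s"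
proof -
  let ?c = "cost m + 50"
  let ?I = "\<lambda>s'. (\<forall>x. x \<noteq> Vi \<longrightarrow> vv s' x = vv s x) \<and> vv s' Vi \<le> r \<and> v mod b ^ vv s' Vi = b ^ vv s' Vi - 1 \<and>
    aa s' A = (\<lambda>j. if j < vv s' Vi then 0 else digits b r v j)"
  have key: "v mod b ^ Suc i = b ^ Suc i - 1" if "v mod b ^ i = b ^ i - 1" "b - 1 \<le> (v div b ^ i) mod b" for i
  proof -
    have "(v div b ^ i) mod b < b" using s(3) by simp
    then have e: "(v div b ^ i) mod b = b - 1" using that(2) by linarith
    have bi: "0 < b ^ i" using s(3) by simp
    have "v mod b ^ Suc i = b ^ i * ((v div b ^ i) mod b) + v mod b ^ i"
      by (simp add: mod_mult2_eq mult.commute[of b])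
    also have "\<dots> = b ^ i * (b - 1) + (b ^ i - 1)" using that(1) e by simp
    also have "\<dots> = b ^ Suc i - 1" using bi s(3) by (simp add: diff_mult_distrib2 mult.commute[of b])
    finally show ?thesis .
  qed
  have loop: "wp (Whl (And (Lt (Var Vi) (Var l)) (Le m (Ld A (Var Vi))))
       (Seq (St A (Var Vi) (Num 0)) (Asg Vi (Inc (Var Vi)))))
     (\<lambda>t s'. ?I s' \<and> eval (And (Lt (Var Vi) (Var l)) (Le m (Ld A (Var Vi)))) s' = 0 \<and>
        t \<le> (r - vv s1 Vi) * ?c + cost (And (Lt (Var Vi) (Var l)) (Le m (Ld A (Var Vi)))) + 2) s1"
    if "?I s1" for s1
  proof (rule wp_Whl[where \<Phi> = "\<lambda>s'. (r - vv s' Vi) * ?c"])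
    fix s2 assume I: "?I s2" and c: "eval (And (Lt (Var Vi) (Var l)) (Le m (Ld A (Var Vi)))) s2 \<noteq> 0"
    have m2: "eval m s2 = b - 1" using m I by blast
    have l2: "vv s2 l = r" using I s by metis
    from c have i: "vv s2 Vi < r" and ge: "b - 1 \<le> digits b r v (vv s2 Vi)" using I l2 m2 by (auto split: if_splits)
    then have ge': "b - 1 \<le> (v div b ^ vv s2 Vi) mod b" by (simp add: digits_def)
    have k: "v mod b ^ Suc (vv s2 Vi) = b ^ Suc (vv s2 Vi) - 1" using key I ge' by blast
    have dec: "(r - vv s2 Vi) * ?c = ?c + (r - Suc (vv s2 Vi)) * ?c" using i
      by (metis Suc_diff_Suc mult_Suc)
    show "wp (Seq (St A (Var Vi) (Num 0)) (Asg Vi (Inc (Var Vi))))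
      (\<lambda>t s'. ?I s' \<and> t + cost (And (Lt (Var Vi) (Var l)) (Le m (Ld A (Var Vi)))) + 3 + (r - vv s' Vi) * ?c
        \<le> (r - vv s2 Vi) * ?c) s2"
      using I i k by (auto simp: dec fun_eq_iff simp del: power_Suc)
  qed (rule that)
  show ?thesis unfolding INC_def wp_Seq wp_Asg
  proof (rule wp_mono[OF loop])
    show "?I (s\<lparr>vv := (vv s)(Vi := eval (Num 0) s)\<rparr>)" using s by auto
  next
    fix t s'
    assume A: "?I s' \<and> eval (And (Lt (Var Vi) (Var l)) (Le m (Ld A (Var Vi)))) s' = 0 \<and>
        t \<le> (r - vv (s\<lparr>vv := (vv s)(Vi := eval (Num 0) s)\<rparr>) Vi) * ?c + cost (And (Lt (Var Vi) (Var l)) (Le m (Ld A (Var Vi)))) + 2"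
    have m2: "eval m s' = b - 1" using m A by blast
    have l2: "vv s' l = r" and f2: "vv s' f = vv s f" using A s by metis+
    let ?i = "vv s' Vi"
    have "t \<le> r * ?c + cost m + 33" using A by simp
    then have t: "t \<le> (cost m + 80) * r + cost m + 33" by (simp add: algebra_simps)
    show "wp (If (Lt (Var Vi) (Var l)) (St A (Var Vi) (Inc (Ld A (Var Vi)))) (Asg f (Num 0)))
      (\<lambda>u s''. aa s'' A = digits b r (if v + 1 < b ^ r then v + 1 else 0) \<and>
    vv s'' f = (if v + 1 < b ^ r then vv s f else 0) \<and> cost (Num 0) + 2 + (t + u) \<le> (cost m + 80) * (r + 1)) s'"
    proof (cases "?i < r")
      case True
      then have lt: "(v div b ^ ?i) mod b < b - 1" using A l2 m2 by (auto simp: digits_def)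
      note dc = digits_carry[OF s(3) _ lt]
      have v1: "v + 1 < b ^ r"
      proof (rule ccontr)
        assume "\<not> v + 1 < b ^ r"
        then have "v + 1 = b ^ r" using s(2) by simp
        then have "(v + 1) div b ^ ?i = b ^ (r - ?i)" using True s(3)
          by (metis less_imp_le_nat less_le_trans pos2 power_diff_power_eq not_less0 gr0I)
        then have "((v + 1) div b ^ ?i) mod b = 0" using True by (metis dvd_imp_mod_0 dvd_power zero_less_diff)
        then show False using dc[of ?i] A by simp
      qed
      have "(aa s' A)(?i := Suc (aa s' A ?i)) = digits b r (v + 1)"
      proof
        fix j show "((aa s' A)(?i := Suc (aa s' A ?i))) j = digits b r (v + 1) j"
          using dc[of j] A True by (auto simp: digits_def)
      qed
      then show ?thesis using True l2 f2 v1 t by simp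
    next
      case False
      then have i: "?i = r" using A by simp
      then have "v + 1 = b ^ r" using A s(2,3) by simp
      moreover have "aa s' A = (\<lambda>_. 0)" using A i by (auto simp: digits_def fun_eq_iff)
      ultimately show ?thesis using l2 i t by simp
    qed
  qed
qed

section \<open>Searching for smaller models\<close>

lemma diff_mult_step: "(a::nat) < m \<Longrightarrow> (m - a) * B = (m - Suc a) * B + B"
  by (metis Suc_diff_Suc add.commute mult_Suc)

text \<open>
  Rule \<open>j\<close> occupies the slots \<open>3 * j\<close>, \<open>3 * j + 1\<close> and \<open>3 * j + 2\<close>. Slot \<open>p\<close> holds atom \<open>X p\<close> with kind
  \<open>K p\<close>: 1 for the head, 2 for the positive body, 3 for the negated body, 0 for an unused slot. For
  \<open>N \<subseteq> M\<close>, \<open>viol M N j\<close> says that rule \<open>j\<close> survives in the reduct with respect to \<open>M\<close> and \<open>N\<close> violates it.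
\<close>

locale slots =
  fixes n R :: nat and K X :: "nat \<Rightarrow> nat"
begin

definition slot_ok :: "nat set \<Rightarrow> nat set \<Rightarrow> nat \<Rightarrow> bool" where
  "slot_ok M N p \<longleftrightarrow> (K p = 1 \<longrightarrow> X p \<notin> N) \<and> (K p = 2 \<longrightarrow> X p \<in> N) \<and> (K p = 3 \<longrightarrow> X p \<notin> M)"

definition viol :: "nat set \<Rightarrow> nat set \<Rightarrow> nat \<Rightarrow> bool" where
  "viol M N j \<longleftrightarrow> slot_ok M N (3 * j) \<and> slot_ok M N (3 * j + 1) \<and> slot_ok M N (3 * j + 2)"

definition stable :: "nat set \<Rightarrow> nat set \<Rightarrow> bool" where
  "stable M N \<longleftrightarrow> (\<forall>j<R. \<not> viol M N j)"

definition fv :: "nat set \<Rightarrow> nat set \<Rightarrow> nat" where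
  "fv M N = (LEAST j. viol M N j)"

text \<open>
  The mode \<open>nv\<close> is 0 for shrinking, where body slots (kind 2) are repaired, and 1 for growing, where head
  slots (kind 1) are. When shrinking, some slot is a head, so falling back to slot 2 makes every body slot
  reachable with the digits 0 and 1 alone.
\<close>

definition pick :: "nat \<Rightarrow> nat \<Rightarrow> nat \<Rightarrow> nat" where
  "pick nv j d = (if K (3 * j + min d 2) = 2 - nv then 3 * j + min d 2 else 3 * j + 2)"

text \<open>Every digit string can be executed: a digit that selects no repairable slot leaves N
  alone. The condition on M keeps a growing set inside M.\<close>

definition act :: "nat \<Rightarrow> nat set \<Rightarrow> nat set \<Rightarrow> nat \<Rightarrow> nat set" where
  "act nv M N d = (let q = pick nv (fv M N) d in
     if K q = 2 - nv \<and> X q \<in> M then (if nv = 0 then N - {X q} else insert (X q) N) else N)"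

fun trial :: "nat \<Rightarrow> nat set \<Rightarrow> nat set \<Rightarrow> nat list \<Rightarrow> bool" where
  "trial nv M N [] = stable M N"
| "trial nv M N (d # ds) = (stable M N \<or> trial nv M (act nv M N d) ds)"

definition start :: "nat \<Rightarrow> nat set \<Rightarrow> nat \<Rightarrow> nat set" where
  "start nv M a = (if nv = 0 then M - {a} else {})"

text \<open>Growing starts from the same set for each a. Repeating it lets one program serve both
  modes and stays within the factor n that shrinking requires. For empty M there is no proper subset
  to look for, and nothing is found.\<close>

definition found :: "nat \<Rightarrow> nat \<Rightarrow> nat set \<Rightarrow> bool" where
  "found nv r M \<longleftrightarrow> (\<exists>a\<in>M. \<exists>v<(2 + nv) ^ r. trial nv M (start nv M a) (map (digits (2 + nv) r v) [0..<r]))"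

definition env :: "st \<Rightarrow> bool" where
  "env s \<longleftrightarrow> vv s Vn = n \<and> vv s Vend = 3 * R \<and> aa s KIND = K \<and> aa s IDX = X"

lemma env_same_but: "env s \<Longrightarrow> same_but c s s' \<Longrightarrow> Vn \<notin> modv c \<Longrightarrow> Vend \<notin> modv c \<Longrightarrow> KIND \<notin> moda c \<Longrightarrow>
  IDX \<notin> moda c \<Longrightarrow> env s'"
  by (simp add: env_def same_but_def)

lemma env_upd [simp]:
  "f Vn = vv s Vn \<Longrightarrow> f Vend = vv s Vend \<Longrightarrow> env (s\<lparr>vv := f\<rparr>) = env s"
  "g KIND = aa s KIND \<Longrightarrow> g IDX = aa s IDX \<Longrightarrow> env (s\<lparr>aa := g\<rparr>) = env s"
  "env (s\<lparr>oo := l\<rparr>) = env s"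
  by (simp_all add: env_def)

end

definition slotE :: "exp \<Rightarrow> exp" where
  "slotE e = And (Neg' (And (Eq (Ld KIND e) (Num 1)) (Ld NN (Ld IDX e))))
     (And (Neg' (And (Eq (Ld KIND e) (Num 2)) (Neg' (Ld NN (Ld IDX e)))))
       (Neg' (And (Eq (Ld KIND e) (Num 3)) (Ld MM (Ld IDX e)))))"

definition violE :: exp where
  "violE = And (slotE (Var Vp)) (And (slotE (Inc (Var Vp))) (slotE (Inc (Inc (Var Vp)))))"

definition FIND :: com where
  "FIND = Seq (Asg Vp (Num 0)) (Seq
     (Whl (And (Lt (Var Vp) (Var Vend)) (Neg' violE)) (Asg Vp (Inc (Inc (Inc (Var Vp))))))
     (Asg Vf (Lt (Var Vp) (Var Vend))))"

text \<open>Entries of \<open>MM\<close> are at most 1, so subtracting the mode yields a copy of M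
  when shrinking and the empty set when growing.\<close>

definition INITN :: com where
  "INITN = Seq (Asg Vi (Num 0)) (Whl (Lt (Var Vi) (Var Vn))
     (Seq (St NN (Var Vi) (Dif (Ld MM (Var Vi)) (Var Vnv))) (Asg Vi (Inc (Var Vi)))))"

definition STEP :: com where
  "STEP = Seq (Asg Vd (Ld DIG (Var Vt))) (Seq
     (If (Eq (Var Vd) (Num 0)) (Asg Vq (Var Vp))
       (If (Eq (Var Vd) (Num 1)) (Asg Vq (Inc (Var Vp))) (Asg Vq (Inc (Inc (Var Vp)))))) (Seq
     (If (Eq (Ld KIND (Var Vq)) (Dif (Num 2) (Var Vnv))) Skip (Asg Vq (Inc (Inc (Var Vp)))))
     (If (And (Eq (Ld KIND (Var Vq)) (Dif (Num 2) (Var Vnv))) (Ld MM (Ld IDX (Var Vq))))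
       (St NN (Ld IDX (Var Vq)) (Var Vnv)) Skip)))"

text \<open>\<open>Vbad\<close> is only ever set here, so it accumulates the outcome of several
  searches; the specifications therefore contain its initial value as a disjunct.\<close>

definition TRIAL :: com where
  "TRIAL = Seq (Asg Vt (Num 0)) (Seq (Asg Vgo (Num 1)) (Whl (Var Vgo)
     (Seq FIND (If (Var Vf)
       (If (Lt (Var Vt) (Var Vr)) (Seq STEP (Asg Vt (Inc (Var Vt)))) (Asg Vgo (Num 0)))
       (Seq (Asg Vbad (Num 1)) (Asg Vgo (Num 0)))))))"

definition ENUM :: com where
  "ENUM = Seq (Asg Vcont (Num 1)) (Whl (Var Vcont)
     (Seq INITN (Seq (St NN (Var Va) (Num 0)) (Seq TRIAL (INC DIG Vr (Inc (Var Vnv)) Vcont)))))"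

definition SEARCH :: com where
  "SEARCH = Seq (Asg Va (Num 0)) (Whl (Lt (Var Va) (Var Vn))
     (Seq (If (Ld MM (Var Va)) ENUM Skip) (Asg Va (Inc (Var Va)))))"

lemma ind_simps [simp]: "(ind N)(x := 0) = ind (N - {x})" "(ind N)(x := Suc 0) = ind (insert x N)"
  by (auto simp: ind_def fun_eq_iff)

lemma ind_eq_0 [simp]: "ind N x = 0 \<longleftrightarrow> x \<notin> N" "0 < ind N x \<longleftrightarrow> x \<in> N"
  by (auto simp: ind_def)

lemma ind_inj [simp]: "ind M = ind N \<longleftrightarrow> M = N"
  by (auto simp: ind_def fun_eq_iff)

lemma cost_violE [simp]: "cost violE = 498" by (simp add: violE_def slotE_def)

context slots
begin

lemma eval_slotE:
  assumes "env s" "aa s MM = ind M" "aa s NN = ind N"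
  shows "eval (slotE e) s = of_bool (slot_ok M N (eval e s))"
  using assms by (auto simp: slotE_def slot_ok_def env_def)

lemma eval_violE:
  assumes "env s" "aa s MM = ind M" "aa s NN = ind N" "vv s Vp = 3 * j"
  shows "eval violE s = of_bool (viol M N j)"
  using assms by (simp add: violE_def eval_slotE[OF assms(1-3)] viol_def)

lemma FIND_correct:
  assumes "env s" "aa s MM = ind M" "aa s NN = ind N"
  shows "wp FIND (\<lambda>t s'. vv s' Vf = of_bool (\<not> stable M N) \<and> (\<not> stable M N \<longrightarrow> vv s' Vp = 3 * fv M N) \<and>
    t \<le> 600 * (R + 1)) s"
proof -
  let ?b = "And (Lt (Var Vp) (Var Vend)) (Neg' violE)"
  let ?I = "\<lambda>s'. env s' \<and> aa s' MM = ind M \<and> aa s' NN = ind N \<and> (\<exists>j\<le>R. vv s' Vp = 3 * j \<and> (\<forall>i<j. \<not> viol M N i))"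
  have loop: "wp (Whl ?b (Asg Vp (Inc (Inc (Inc (Var Vp))))))
      (\<lambda>t s'. ?I s' \<and> eval ?b s' = 0 \<and> t \<le> (3 * R - vv s1 Vp) * 200 + cost ?b + 2) s1" if "?I s1" for s1
  proof (rule wp_Whl[where \<Phi> = "\<lambda>s'. (3 * R - vv s' Vp) * 200"])
    fix s2 assume I: "?I s2" and c: "eval ?b s2 \<noteq> 0"
    from I obtain j where j: "j \<le> R" "vv s2 Vp = 3 * j" "\<forall>i<j. \<not> viol M N i" by blast
    have v: "eval violE s2 = of_bool (viol M N j)" using I j by (intro eval_violE) auto
    have e: "vv s2 Vend = 3 * R" using I by (simp add: env_def)
    from c have c': "j < R" "\<not> viol M N j" using v j e by (auto simp: of_bool_def split: if_splits)
    show "wp (Asg Vp (Inc (Inc (Inc (Var Vp))))) (\<lambda>t s'. ?I s' \<and> t + cost ?b + 3 + (3 * R - vv s' Vp) * 200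
        \<le> (3 * R - vv s2 Vp) * 200) s2"
      using I j c' by (auto simp: env_def less_Suc_eq intro!: exI[of _ "Suc j"])
  qed (rule that)
  show ?thesis unfolding FIND_def wp_Seq wp_Asg
  proof (rule wp_mono[OF loop])
    show "?I (s\<lparr>vv := (vv s)(Vp := eval (Num 0) s)\<rparr>)" using assms by (auto simp: env_def)
  next
    fix t s'
    assume A: "?I s' \<and> eval ?b s' = 0 \<and> t \<le> (3 * R - vv (s\<lparr>vv := (vv s)(Vp := eval (Num 0) s)\<rparr>) Vp) * 200 + cost ?b + 2"
    from A obtain j where j: "j \<le> R" "vv s' Vp = 3 * j" "\<forall>i<j. \<not> viol M N i" by blast
    have v: "eval violE s' = of_bool (viol M N j)" using A j by (intro eval_violE) auto
    have e: "vv s' Vend = 3 * R" using A by (simp add: env_def)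
    show "vv (s'\<lparr>vv := (vv s')(Vf := eval (Lt (Var Vp) (Var Vend)) s')\<rparr>) Vf = of_bool (\<not> stable M N) \<and>
       (\<not> stable M N \<longrightarrow> vv (s'\<lparr>vv := (vv s')(Vf := eval (Lt (Var Vp) (Var Vend)) s')\<rparr>) Vp = 3 * fv M N) \<and>
       cost (Num 0) + 2 + (t + (cost (Lt (Var Vp) (Var Vend)) + 2)) \<le> 600 * (R + 1)"
    proof (cases "j < R")
      case True
      then have vj: "viol M N j" using A v e j by (auto simp: of_bool_def split: if_splits)
      then have "fv M N = j" unfolding fv_def using j(3) by (intro Least_equality) (auto simp: not_less[symmetric])
      moreover have "\<not> stable M N" using vj True by (auto simp: stable_def)
      ultimately show ?thesis using A j e True by simp
    next
      case False
      then have "stable M N" using j by (auto simp: stable_def)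
      then show ?thesis using A j e False by simp
    qed
  qed
qed

text \<open>Only cells below n are overwritten. The previous content must itself be a subset of
  {..<n} for the array to equal \<open>ind\<close> everywhere, which is why this property of
  \<open>NN\<close> is carried through all searches.\<close>

lemma INITN_correct:
  assumes "env s" "aa s MM = ind M" "M \<subseteq> {..<n}" "aa s NN = ind N" "N \<subseteq> {..<n}" "vv s Vnv = nv" "nv \<le> 1"
  shows "wp INITN (\<lambda>t s'. aa s' NN = ind (if nv = 0 then M else {}) \<and> t \<le> 50 * (n + 1)) s"
proof -
  let ?b = "Lt (Var Vi) (Var Vn)"
  let ?N = "if nv = 0 then M else {}"
  let ?I = "\<lambda>s'. env s' \<and> aa s' MM = ind M \<and> vv s' Vnv = nv \<and> vv s' Vi \<le> n \<and>
    aa s' NN = (\<lambda>i. if i < vv s' Vi then ind ?N i else ind N i)"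
  have loop: "wp (Whl ?b (Seq (St NN (Var Vi) (Dif (Ld MM (Var Vi)) (Var Vnv))) (Asg Vi (Inc (Var Vi)))))
      (\<lambda>t s'. ?I s' \<and> eval ?b s' = 0 \<and> t \<le> (n - vv s1 Vi) * 50 + cost ?b + 2) s1" if "?I s1" for s1
  proof (rule wp_Whl[where \<Phi> = "\<lambda>s'. (n - vv s' Vi) * 50"])
    fix s2 assume I: "?I s2" and c: "eval ?b s2 \<noteq> 0"
    have e: "vv s2 Vn = n" using I by (simp add: env_def)
    have "ind M (vv s2 Vi) - nv = ind ?N (vv s2 Vi)" using assms(7) by (auto simp: ind_def)
    then show "wp (Seq (St NN (Var Vi) (Dif (Ld MM (Var Vi)) (Var Vnv))) (Asg Vi (Inc (Var Vi))))
       (\<lambda>t s'. ?I s' \<and> t + cost ?b + 3 + (n - vv s' Vi) * 50 \<le> (n - vv s2 Vi) * 50) s2"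
      using I c e by (auto simp: env_def fun_eq_iff less_Suc_eq)
  qed (rule that)
  show ?thesis unfolding INITN_def wp_Seq wp_Asg
  proof (rule wp_mono[OF loop])
    show "?I (s\<lparr>vv := (vv s)(Vi := eval (Num 0) s)\<rparr>)" using assms by (auto simp: env_def)
  next
    fix t s'
    assume A: "?I s' \<and> eval ?b s' = 0 \<and> t \<le> (n - vv (s\<lparr>vv := (vv s)(Vi := eval (Num 0) s)\<rparr>) Vi) * 50 + cost ?b + 2"
    have i: "vv s' Vi = n" using A by (simp add: env_def)
    have "aa s' NN = ind ?N"
    proof
      fix j show "aa s' NN j = ind ?N j" using A i assms(3,5) by (auto simp: ind_def)
    qed
    then show "aa s' NN = ind ?N \<and> cost (Num 0) + 2 + t \<le> 50 * (n + 1)" using A by simp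
  qed
qed

lemma STEP_correct:
  assumes "env s" "aa s MM = ind M" "aa s NN = ind N" "vv s Vp = 3 * fv M N" "vv s Vnv = nv" "nv \<le> 1"
  shows "wp STEP (\<lambda>t s'. aa s' NN = ind (act nv M N (aa s DIG (vv s Vt))) \<and> t \<le> 300) s"
proof -
  let ?d = "aa s DIG (vv s Vt)" and ?j = "fv M N"
  define q where "q = 3 * ?j + min ?d 2"
  define q' where "q' = (if K q = 2 - nv then q else 3 * ?j + 2)"
  have K: "aa s KIND = K" and X: "aa s IDX = X" using assms(1) by (auto simp: env_def)
  have act: "act nv M N ?d = (if K q' = 2 - nv \<and> X q' \<in> M then (if nv = 0 then N - {X q'} else insert (X q') N) else N)"
    by (simp only: act_def pick_def Let_def q_def[symmetric] q'_def[symmetric])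
  have sel: "wp (If (Eq (Var Vd) (Num 0)) (Asg Vq (Var Vp))
       (If (Eq (Var Vd) (Num 1)) (Asg Vq (Inc (Var Vp))) (Asg Vq (Inc (Inc (Var Vp))))))
     (\<lambda>t s'. s' = s1\<lparr>vv := (vv s1)(Vq := q)\<rparr> \<and> t \<le> 60) s1" if "vv s1 Vd = ?d" "vv s1 Vp = 3 * ?j" for s1
    using that by (auto simp: q_def)
  show ?thesis unfolding STEP_def wp_Seq wp_Asg
  proof (rule wp_mono[OF sel])
    fix t :: nat and s2
    assume A: "s2 = s\<lparr>vv := (vv s)(Vd := eval (Ld DIG (Var Vt)) s),
      vv := (vv (s\<lparr>vv := (vv s)(Vd := eval (Ld DIG (Var Vt)) s)\<rparr>))(Vq := q)\<rparr> \<and> t \<le> 60"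
    then have s2: "vv s2 Vq = q" "vv s2 Vp = 3 * ?j" "vv s2 Vnv = nv" "aa s2 = aa s" using assms by auto
    have "wp (If (Eq (Ld KIND (Var Vq)) (Dif (Num 2) (Var Vnv))) Skip (Asg Vq (Inc (Inc (Var Vp)))))
      (\<lambda>u s'. vv s' Vq = q' \<and> vv s' Vnv = nv \<and> aa s' = aa s \<and> u \<le> 60) s2"
      using s2 K by (auto simp: q'_def)
    then show "wp (If (Eq (Ld KIND (Var Vq)) (Dif (Num 2) (Var Vnv))) Skip (Asg Vq (Inc (Inc (Var Vp)))))
      (\<lambda>ta. wp (If (And (Eq (Ld KIND (Var Vq)) (Dif (Num 2) (Var Vnv))) (Ld MM (Ld IDX (Var Vq))))
           (St NN (Ld IDX (Var Vq)) (Var Vnv)) Skip)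
         (\<lambda>u s'. aa s' NN = ind (act nv M N ?d) \<and> cost (Ld DIG (Var Vt)) + 2 + (t + (ta + u)) \<le> 300)) s2"
    proof (rule wp_mono)
      fix u :: nat and s3 :: st assume B: "vv s3 Vq = q' \<and> vv s3 Vnv = nv \<and> aa s3 = aa s \<and> u \<le> 60"
      have nv: "nv = 0 \<or> nv = Suc 0" using assms(6) by auto
      have up: "(ind N)(X q' := nv) = ind (if nv = 0 then N - {X q'} else insert (X q') N)" using nv by auto
      show "wp (If (And (Eq (Ld KIND (Var Vq)) (Dif (Num 2) (Var Vnv))) (Ld MM (Ld IDX (Var Vq))))
           (St NN (Ld IDX (Var Vq)) (Var Vnv)) Skip)
         (\<lambda>ua s'. aa s' NN = ind (act nv M N ?d) \<and> cost (Ld DIG (Var Vt)) + 2 + (t + (u + ua)) \<le> 300) s3"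
        unfolding act using A B K X assms(2,3) by (simp add: up)
    qed
  qed (use assms in simp_all)
qed

lemma TRIAL_correct:
  assumes "env s" "aa s MM = ind M" "aa s NN = ind N" "vv s Vnv = nv" "nv \<le> 1" "vv s Vbad \<le> 1"
    and r: "vv s Vr = r"
  shows "wp TRIAL (\<lambda>t s'. vv s' Vbad = of_bool (vv s Vbad = 1 \<or> trial nv M N (map (aa s DIG) [0..<r])) \<and>
    (\<exists>N'. aa s' NN = ind N' \<and> (M \<union> N \<subseteq> {..<n} \<longrightarrow> N' \<subseteq> {..<n})) \<and> t \<le> 1000 * (R + 1) * (r + 2)) s"
proof -
  let ?body = "Seq FIND (If (Var Vf)
       (If (Lt (Var Vt) (Var Vr)) (Seq STEP (Asg Vt (Inc (Var Vt)))) (Asg Vgo (Num 0)))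
       (Seq (Asg Vbad (Num 1)) (Asg Vgo (Num 0))))"
  let ?g = "aa s DIG"
  let ?I = "\<lambda>s'. env s' \<and> aa s' MM = ind M \<and> vv s' Vnv = nv \<and> vv s' Vr = r \<and> aa s' DIG = ?g \<and> vv s' Vt \<le> r \<and>
    vv s' Vgo \<le> 1 \<and>
    (\<exists>N'. aa s' NN = ind N' \<and> (M \<union> N \<subseteq> {..<n} \<longrightarrow> N' \<subseteq> {..<n}) \<and>
      (vv s' Vgo = 1 \<longrightarrow> vv s' Vbad = vv s Vbad \<and>
        trial nv M N (map ?g [0..<r]) = trial nv M N' (map ?g [vv s' Vt..<r]))) \<and>
      (vv s' Vgo = 0 \<longrightarrow> vv s' Vbad = of_bool (vv s Vbad = 1 \<or> trial nv M N (map ?g [0..<r])))"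
  \<comment> \<open>The factor \<open>vv s' Vgo\<close> lets the potential drop to 0 when the loop
    is left. A round consists of one \<open>FIND\<close> and at most one \<open>STEP\<close>, which
    fit into 1000 * (R + 1).\<close>
  let ?P = "\<lambda>s'. vv s' Vgo * (r + 1 - vv s' Vt) * (1000 * (R + 1))"
  have loop: "wp (Whl (Var Vgo) ?body) (\<lambda>t s'. ?I s' \<and> eval (Var Vgo) s' = 0 \<and> t \<le> ?P s1 + cost (Var Vgo) + 2) s1"
    if "?I s1" for s1
  proof (rule wp_Whl[where \<Phi> = ?P])
    fix s2 assume I: "?I s2" and c: "eval (Var Vgo) s2 \<noteq> 0"
    then have go: "vv s2 Vgo = 1" by simp
    from I go obtain N' where N': "aa s2 NN = ind N'" "M \<union> N \<subseteq> {..<n} \<longrightarrow> N' \<subseteq> {..<n}" "vv s2 Vbad = vv s Vbad"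
        "trial nv M N (map ?g [0..<r]) = trial nv M N' (map ?g [vv s2 Vt..<r])" by auto
    have F: "wp FIND (\<lambda>t s'. vv s' Vf = of_bool (\<not> stable M N') \<and> (\<not> stable M N' \<longrightarrow> vv s' Vp = 3 * fv M N') \<and>
      t \<le> 600 * (R + 1)) s2" using I N' by (intro FIND_correct) auto
    show "wp ?body (\<lambda>t s'. ?I s' \<and> t + cost (Var Vgo) + 3 + ?P s' \<le> ?P s2) s2"
      unfolding wp_Seq
    proof (rule wp_use[OF F])
      fix t s3
      assume A: "vv s3 Vf = of_bool (\<not> stable M N') \<and> (\<not> stable M N' \<longrightarrow> vv s3 Vp = 3 * fv M N') \<and> t \<le> 600 * (R + 1)"
        and sb: "same_but FIND s2 s3"
      have e3: "env s3" using env_same_but[OF _ sb] I by (simp add: FIND_def)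
      have s3: "aa s3 = aa s2" "vv s3 Vnv = nv" "vv s3 Vr = r" "vv s3 Vt = vv s2 Vt" "vv s3 Vgo = 1" "vv s3 Vbad = vv s Vbad"
        using sb I go N' by (auto simp: same_but_def FIND_def fun_eq_iff)
      have P2: "?P s2 = (r + 1 - vv s2 Vt) * (1000 * (R + 1))" using go by simp
      have "1 \<le> r + 1 - vv s2 Vt" using I by linarith
      then have "1000 * (R + 1) \<le> ?P s2" unfolding P2 using mult_le_mono1[of 1] by fastforce
      moreover define pv where "pv = ?P s2"
      ultimately have P2': "1000 * (R + 1) \<le> pv" by simp
      consider (st) "stable M N'" | (stop) "\<not> stable M N'" "\<not> vv s2 Vt < r" | (more) "\<not> stable M N'" "vv s2 Vt < r" by blast
      then have "wp (If (Var Vf)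
           (If (Lt (Var Vt) (Var Vr)) (Seq STEP (Asg Vt (Inc (Var Vt)))) (Asg Vgo (Num 0)))
           (Seq (Asg Vbad (Num 1)) (Asg Vgo (Num 0))))
           (\<lambda>u s'. ?I s' \<and> t + u + cost (Var Vgo) + 3 + ?P s' \<le> pv) s3"
      proof cases
        case st
        then have "trial nv M N' (map ?g [vv s2 Vt..<r])" by (cases "map ?g [vv s2 Vt..<r]") auto
        then show ?thesis using A I s3 e3 st N' P2' assms(6) by (simp add: env_def)
      next
        case stop
        then have "trial nv M N' (map ?g [vv s2 Vt..<r]) = False" by simp
        then show ?thesis using A I s3 e3 stop N' P2' assms(6) by (simp add: env_def of_bool_def)
      next
        case more
        let ?N2 = "act nv M N' (?g (vv s2 Vt))"
        have "[vv s2 Vt..<r] = vv s2 Vt # [Suc (vv s2 Vt)..<r]" using more by (simp add: upt_conv_Cons)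
        then have tr: "trial nv M N' (map ?g [vv s2 Vt..<r]) = trial nv M ?N2 (map ?g [Suc (vv s2 Vt)..<r])"
          using more by simp
        have S: "wp STEP (\<lambda>t s'. aa s' NN = ind ?N2 \<and> t \<le> 300) s3"
          using STEP_correct[of s3 M N' nv] e3 s3 N' I A more assms(5) by auto
        have dec: "pv = (r + 1 - Suc (vv s2 Vt)) * (1000 * (R + 1)) + 1000 * (R + 1)"
          unfolding pv_def P2 using more by (metis Suc_diff_Suc add.commute add_Suc_right less_SucI mult_Suc Suc_eq_plus1)
        have sub: "M \<union> N \<subseteq> {..<n} \<longrightarrow> ?N2 \<subseteq> {..<n}" using N'(2) by (auto simp: act_def Let_def)
        have "wp STEP (\<lambda>u. wp (Asg Vt (Inc (Var Vt))) (\<lambda>w s'. ?I s' \<and> t + (cost (Var Vf) + (cost (Lt (Var Vt) (Var Vr)) + (u + w) + 3) + 3)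
            + cost (Var Vgo) + 3 + ?P s' \<le> pv)) s3"
        proof (rule wp_use[OF S])
          fix u :: nat and s4 :: st
          assume B: "aa s4 NN = ind ?N2 \<and> u \<le> 300" and sb4: "same_but STEP s3 s4"
          have e4: "env s4" using env_same_but[OF e3 sb4] by (simp add: STEP_def)
          have s4: "aa s4 MM = ind M" "aa s4 DIG = ?g" "vv s4 Vnv = nv" "vv s4 Vr = r" "vv s4 Vt = vv s2 Vt" "vv s4 Vgo = 1"
              "vv s4 Vbad = vv s Vbad"
            using sb4 s3 I by (auto simp: same_but_def STEP_def)
          show "wp (Asg Vt (Inc (Var Vt))) (\<lambda>w s'. ?I s' \<and> t + (cost (Var Vf) + (cost (Lt (Var Vt) (Var Vr)) + (u + w) + 3) + 3)
            + cost (Var Vgo) + 3 + ?P s' \<le> pv) s4"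
            unfolding dec using e4 s4 B A more N'(4) tr sub by (simp add: env_def)
        qed
        then show ?thesis using A s3 more by (simp add: add.assoc)
      qed
      then show "wp (If (Var Vf)
           (If (Lt (Var Vt) (Var Vr)) (Seq STEP (Asg Vt (Inc (Var Vt)))) (Asg Vgo (Num 0)))
           (Seq (Asg Vbad (Num 1)) (Asg Vgo (Num 0))))
           (\<lambda>u s'. ?I s' \<and> t + u + cost (Var Vgo) + 3 + ?P s' \<le> ?P s2) s3"
        unfolding pv_def .
    qed
  qed (rule that)
  show ?thesis unfolding TRIAL_def wp_Seq wp_Asg
  proof (rule wp_mono[OF loop])
    let ?s = "(s\<lparr>vv := (vv s)(Vt := eval (Num 0) s)\<rparr>)"
    show "?I (?s\<lparr>vv := (vv ?s)(Vgo := eval (Num 1) ?s)\<rparr>)"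
      using assms by simp
  next
    let ?s = "(s\<lparr>vv := (vv s)(Vt := eval (Num 0) s)\<rparr>)"
    fix t s' assume "?I s' \<and> eval (Var Vgo) s' = 0 \<and> t \<le> ?P (?s\<lparr>vv := (vv ?s)(Vgo := eval (Num 1) ?s)\<rparr>) + cost (Var Vgo) + 2"
    then show "vv s' Vbad = of_bool (vv s Vbad = 1 \<or> trial nv M N (map (aa s DIG) [0..<r])) \<and>
      (\<exists>N'. aa s' NN = ind N' \<and> (M \<union> N \<subseteq> {..<n} \<longrightarrow> N' \<subseteq> {..<n})) \<and>
      cost (Num 0) + 2 + (cost (Num 1) + 2 + t) \<le> 1000 * (R + 1) * (r + 2)"
      by (simp add: algebra_simps) blast
  qed
qed

lemma INC_DIG_correct:
  assumes "aa s DIG = digits (2 + nv) r v" "v < (2 + nv) ^ r" "vv s Vr = r" "vv s Vnv = nv" "vv s Vcont = 1"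
  shows "wp (INC DIG Vr (Inc (Var Vnv)) Vcont) (\<lambda>t s'.
    aa s' DIG = digits (2 + nv) r (if Suc v < (2 + nv) ^ r then Suc v else 0) \<and>
    vv s' Vcont = of_bool (Suc v < (2 + nv) ^ r) \<and> t \<le> 84 * (r + 1)) s"
  by (rule wp_mono[OF INC_correct[where b = "2 + nv" and r = r and v = v]]) (use assms in auto)

definition hit :: "nat \<Rightarrow> nat \<Rightarrow> nat set \<Rightarrow> nat \<Rightarrow> nat \<Rightarrow> bool" where
  "hit nv r M a v \<longleftrightarrow> trial nv M (start nv M a) (map (digits (2 + nv) r v) [0..<r])"

lemma ENUM_correct:
  assumes s: "env s" "aa s MM = ind M" "M \<subseteq> {..<n}" "aa s NN = ind N" "N \<subseteq> {..<n}" "aa s DIG = (\<lambda>_. 0)"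
    "vv s Vnv = nv" "nv \<le> 1" "vv s Vr = r" "vv s Vbad \<le> 1" "vv s Va = a"
  shows "wp ENUM (\<lambda>t s'. vv s' Vbad = of_bool (vv s Vbad = 1 \<or> (\<exists>v<(2 + nv) ^ r. hit nv r M a v)) \<and>
    aa s' DIG = (\<lambda>_. 0) \<and> (\<exists>N'\<subseteq>{..<n}. aa s' NN = ind N') \<and>
    t \<le> (2 + nv) ^ r * (1500 * (R + 1) * (n + r + 2)) + 10) s"
proof -
  let ?b = "2 + nv" and ?B = "1500 * (R + 1) * (n + r + 2)"
  let ?body = "Seq INITN (Seq (St NN (Var Va) (Num 0)) (Seq TRIAL (INC DIG Vr (Inc (Var Vnv)) Vcont)))"
  \<comment> \<open>The ghost value v counts the digit strings tried. After the last one the counter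
    has wrapped around to zero, which restores the assumption on \<open>DIG\<close> for the next
    atom.\<close>
  let ?J = "\<lambda>v s'. env s' \<and> aa s' MM = ind M \<and> vv s' Vnv = nv \<and> vv s' Vr = r \<and> vv s' Va = a \<and>
    (\<exists>N'\<subseteq>{..<n}. aa s' NN = ind N') \<and> v \<le> ?b ^ r \<and> vv s' Vcont = of_bool (v < ?b ^ r) \<and>
    aa s' DIG = digits ?b r (if v < ?b ^ r then v else 0) \<and>
    vv s' Vbad = of_bool (vv s Vbad = 1 \<or> (\<exists>v'<v. hit nv r M a v'))"
  have Bge: "50 * (n + 1) + 1000 * (R + 1) * (r + 2) + 84 * (r + 1) + 40 \<le> ?B"
  proof -
    have "(R + 1) * (r + 2) \<le> (R + 1) * (n + r + 2)" by (intro mult_le_mono2) simp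
    moreover have "1 * (n + r + 2) \<le> (R + 1) * (n + r + 2)" by (intro mult_le_mono1) simp
    ultimately have "1000 * ((R + 1) * (r + 2)) \<le> 1000 * ((R + 1) * (n + r + 2))"
      "500 * (n + r + 2) \<le> 500 * ((R + 1) * (n + r + 2))" by (simp_all only: mult_le_mono2 mult_1)
    moreover have "50 * (n + 1) + 84 * (r + 1) + 40 \<le> 500 * (n + r + 2)" by simp
    moreover define P Q where "P = (R + 1) * (n + r + 2)" and "Q = (R + 1) * (r + 2)"
    ultimately have "50 * (n + 1) + 84 * (r + 1) + 40 \<le> 500 * P" "1000 * Q \<le> 1000 * P"
      by (auto intro: order_trans simp del: mult_Suc)
    then have "50 * (n + 1) + 1000 * Q + 84 * (r + 1) + 40 \<le> 1500 * P" by simp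
    then show ?thesis unfolding P_def Q_def mult.assoc .
  qed
  have loop: "wp (Whl (Var Vcont) ?body) (\<lambda>t s'. (\<exists>v. ?J v s') \<and> eval (Var Vcont) s' = 0 \<and>
      t \<le> (?b ^ r - v1) * ?B + cost (Var Vcont) + 2) s1" if "?J v1 s1" for v1 s1
  proof (rule wp_Whl_ghost[where \<Phi> = "\<lambda>v. (?b ^ r - v) * ?B" and J = ?J])
    fix v s2 assume J: "?J v s2" and c: "eval (Var Vcont) s2 \<noteq> 0"
    then have v: "v < ?b ^ r" by (simp split: if_splits)
    from J obtain N' where N': "N' \<subseteq> {..<n}" "aa s2 NN = ind N'" by blast
    have dec: "(?b ^ r - v) * ?B = (?b ^ r - Suc v) * ?B + ?B" by (rule diff_mult_step[OF v])
    have W1: "wp INITN (\<lambda>t s'. aa s' NN = ind (if nv = 0 then M else {}) \<and> t \<le> 50 * (n + 1)) s2"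
      by (rule INITN_correct[of s2 M N']) (use J N' s in auto)
    show "wp ?body (\<lambda>t s'. \<exists>v'. ?J v' s' \<and> t + cost (Var Vcont) + 3 + (?b ^ r - v') * ?B \<le> (?b ^ r - v) * ?B) s2"
      unfolding wp_Seq wp_St
    proof (rule wp_use[OF W1])
      fix t1 :: nat and s3 :: st
      assume A: "aa s3 NN = ind (if nv = 0 then M else {}) \<and> t1 \<le> 50 * (n + 1)" and sb: "same_but INITN s2 s3"
      define s4 where "s4 = s3\<lparr>aa := (aa s3)(NN := (aa s3 NN)(eval (Var Va) s3 := eval (Num 0) s3))\<rparr>"
      have e3: "env s3" using env_same_but[OF _ sb] J by (simp add: INITN_def)
      have s3: "aa s3 MM = ind M" "vv s3 Vnv = nv" "vv s3 Vr = r" "vv s3 Va = a" "vv s3 Vcont = 1"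
        "aa s3 DIG = digits ?b r v" "vv s3 Vbad = vv s2 Vbad"
        using sb J v by (auto simp: same_but_def INITN_def)
      have e4: "env s4" using e3 by (simp add: s4_def)
      have s4: "aa s4 MM = ind M" "vv s4 Vnv = nv" "vv s4 Vr = r" "vv s4 Va = a" "vv s4 Vcont = 1"
        "aa s4 DIG = digits ?b r v" "vv s4 Vbad = vv s2 Vbad" "aa s4 NN = ind (start nv M a)"
        using s3 A by (auto simp: s4_def start_def)
      have b4: "vv s4 Vbad \<le> 1" using s4 J by simp
      have W2: "wp TRIAL (\<lambda>t s'. vv s' Vbad = of_bool (vv s4 Vbad = 1 \<or> trial nv M (start nv M a) (map (aa s4 DIG) [0..<r])) \<and>
        (\<exists>N'. aa s' NN = ind N' \<and> (M \<union> start nv M a \<subseteq> {..<n} \<longrightarrow> N' \<subseteq> {..<n})) \<and> t \<le> 1000 * (R + 1) * (r + 2)) s4"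
        by (rule TRIAL_correct) (use e4 s4 b4 s in auto)
      have "wp TRIAL (\<lambda>t. wp (INC DIG Vr (Inc (Var Vnv)) Vcont)
         (\<lambda>u s'. \<exists>v'. ?J v' s' \<and> t1 + (cost (Var Va) + cost (Num 0) + 6 + (t + u)) + cost (Var Vcont) + 3 + (?b ^ r - v') * ?B
           \<le> (?b ^ r - v) * ?B)) s4"
      proof (rule wp_use[OF W2])
        fix t2 :: nat and s5 :: st
        assume B: "vv s5 Vbad = of_bool (vv s4 Vbad = 1 \<or> trial nv M (start nv M a) (map (aa s4 DIG) [0..<r])) \<and>
          (\<exists>N'. aa s5 NN = ind N' \<and> (M \<union> start nv M a \<subseteq> {..<n} \<longrightarrow> N' \<subseteq> {..<n})) \<and> t2 \<le> 1000 * (R + 1) * (r + 2)"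
          and sb5: "same_but TRIAL s4 s5"
        have e5: "env s5" using env_same_but[OF e4 sb5] by (simp add: TRIAL_def FIND_def STEP_def)
        have s5: "aa s5 MM = ind M" "vv s5 Vnv = nv" "vv s5 Vr = r" "vv s5 Va = a" "vv s5 Vcont = 1"
          "aa s5 DIG = digits ?b r v"
          using sb5 s4 by (auto simp: same_but_def TRIAL_def FIND_def STEP_def)
        have "M \<union> start nv M a \<subseteq> {..<n}" using s(3) by (auto simp: start_def)
        then obtain N5 where N5: "aa s5 NN = ind N5" "N5 \<subseteq> {..<n}" using B by blast
        have bad5: "vv s5 Vbad = of_bool (vv s Vbad = 1 \<or> (\<exists>v'<Suc v. hit nv r M a v'))"
          using B s4 J by (auto simp: hit_def less_Suc_eq)
        show "wp (INC DIG Vr (Inc (Var Vnv)) Vcont)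
         (\<lambda>u s'. \<exists>v'. ?J v' s' \<and> t1 + (cost (Var Va) + cost (Num 0) + 6 + (t2 + u)) + cost (Var Vcont) + 3 + (?b ^ r - v') * ?B
           \<le> (?b ^ r - v) * ?B) s5"
        proof (rule wp_use[OF INC_DIG_correct[OF s5(6) v s5(3,2,5)]])
          fix t3 :: nat and s6 :: st
          assume C: "aa s6 DIG = digits ?b r (if Suc v < ?b ^ r then Suc v else 0) \<and>
             vv s6 Vcont = of_bool (Suc v < ?b ^ r) \<and> t3 \<le> 84 * (r + 1)"
            and sb6: "same_but (INC DIG Vr (Inc (Var Vnv)) Vcont) s5 s6"
          have e6: "env s6" using env_same_but[OF e5 sb6] by (simp add: INC_def)
          have s6: "aa s6 MM = ind M" "vv s6 Vnv = nv" "vv s6 Vr = r" "vv s6 Va = a" "aa s6 NN = ind N5" "vv s6 Vbad = vv s5 Vbad"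
            using sb6 s5 N5 by (auto simp: same_but_def INC_def)
          have "?J (Suc v) s6" using e6 s6 bad5 C v N5 by auto
          moreover have "t1 + (cost (Var Va) + cost (Num 0) + 6 + (t2 + t3)) + cost (Var Vcont) + 3 + (?b ^ r - Suc v) * ?B
             \<le> (?b ^ r - v) * ?B"
          proof -
            have "t1 + (cost (Var Va) + cost (Num 0) + 6 + (t2 + t3)) + cost (Var Vcont) + 3 \<le> ?B"
              using A B C Bge by simp
            then show ?thesis unfolding dec by linarith
          qed
          ultimately show "\<exists>v'. ?J v' s6 \<and> t1 + (cost (Var Va) + cost (Num 0) + 6 + (t2 + t3)) + cost (Var Vcont) + 3 + (?b ^ r - v') * ?B
             \<le> (?b ^ r - v) * ?B" by blast
        qed
      qed
      then show "wp TRIAL (\<lambda>t. wp (INC DIG Vr (Inc (Var Vnv)) Vcont)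
         (\<lambda>u s'. \<exists>v'. ?J v' s' \<and> t1 + (cost (Var Va) + cost (Num 0) + 6 + (t + u)) + cost (Var Vcont) + 3 + (?b ^ r - v') * ?B
           \<le> (?b ^ r - v) * ?B)) (s3\<lparr>aa := (aa s3)(NN := (aa s3 NN)(eval (Var Va) s3 := eval (Num 0) s3))\<rparr>)"
        unfolding s4_def .
    qed
  qed (rule that)
  have J0: "?J 0 (s\<lparr>vv := (vv s)(Vcont := eval (Num 1) s)\<rparr>)" using s by auto
  show ?thesis unfolding ENUM_def wp_Seq wp_Asg
  proof (rule wp_mono[OF loop[OF J0]])
    fix t s' assume A: "(\<exists>v. ?J v s') \<and> eval (Var Vcont) s' = 0 \<and> t \<le> (?b ^ r - 0) * ?B + cost (Var Vcont) + 2"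
    then obtain v where J: "?J v s'" by blast
    then have "\<not> v < ?b ^ r" using A by auto
    then have v: "v = ?b ^ r" using J by simp
    have "t + 3 \<le> ?b ^ r * ?B + 10" using A by simp
    then show "vv s' Vbad = of_bool (vv s Vbad = 1 \<or> (\<exists>v<?b ^ r. hit nv r M a v)) \<and> aa s' DIG = (\<lambda>_. 0) \<and>
       (\<exists>N'\<subseteq>{..<n}. aa s' NN = ind N') \<and> cost (Num 1) + 2 + t \<le> ?b ^ r * ?B + 10"
      using J v by auto
  qed
qed

lemma SEARCH_correct:
  assumes s: "env s" "aa s MM = ind M" "M \<subseteq> {..<n}" "aa s NN = ind N" "N \<subseteq> {..<n}" "aa s DIG = (\<lambda>_. 0)"
    "vv s Vnv = nv" "nv \<le> 1" "vv s Vr = r" "vv s Vbad \<le> 1"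
  shows "wp SEARCH (\<lambda>t s'. vv s' Vbad = of_bool (vv s Vbad = 1 \<or> found nv r M) \<and>
    aa s' DIG = (\<lambda>_. 0) \<and> (\<exists>N'\<subseteq>{..<n}. aa s' NN = ind N') \<and>
    t \<le> (n + 1) * ((2 + nv) ^ r * (1500 * (R + 1) * (n + r + 2)) + 100)) s"
proof -
  let ?B = "(2 + nv) ^ r * (1500 * (R + 1) * (n + r + 2))"
  let ?e = "Lt (Var Va) (Var Vn)"
  let ?body = "Seq (If (Ld MM (Var Va)) ENUM Skip) (Asg Va (Inc (Var Va)))"
  let ?I = "\<lambda>s'. env s' \<and> aa s' MM = ind M \<and> vv s' Vnv = nv \<and> vv s' Vr = r \<and> vv s' Va \<le> n \<and>
    (\<exists>N'\<subseteq>{..<n}. aa s' NN = ind N') \<and> aa s' DIG = (\<lambda>_. 0) \<and>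
    vv s' Vbad = of_bool (vv s Vbad = 1 \<or> (\<exists>a\<in>M. a < vv s' Va \<and> (\<exists>v<(2 + nv) ^ r. hit nv r M a v)))"
  have loop: "wp (Whl ?e ?body) (\<lambda>t s'. ?I s' \<and> eval ?e s' = 0 \<and> t \<le> (n - vv s1 Va) * (?B + 100) + cost ?e + 2) s1"
    if "?I s1" for s1
  proof (rule wp_Whl[where \<Phi> = "\<lambda>s'. (n - vv s' Va) * (?B + 100)"])
    fix s2 assume I: "?I s2" and c: "eval ?e s2 \<noteq> 0"
    have vn: "vv s2 Vn = n" using I by (simp add: env_def)
    have a: "vv s2 Va < n" using c vn by simp
    from I obtain N' where N': "N' \<subseteq> {..<n}" "aa s2 NN = ind N'" by blast
    have dec: "(n - vv s2 Va) * (?B + 100) = (n - Suc (vv s2 Va)) * (?B + 100) + (?B + 100)"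
      by (rule diff_mult_step[OF a])
    have bad2: "vv s2 Vbad \<le> 1" using I by simp
    show "wp ?body (\<lambda>t s'. ?I s' \<and> t + cost ?e + 3 + (n - vv s' Va) * (?B + 100) \<le> (n - vv s2 Va) * (?B + 100)) s2"
    proof (cases "vv s2 Va \<in> M")
      case True
      have W: "wp ENUM (\<lambda>t s'. vv s' Vbad = of_bool (vv s2 Vbad = 1 \<or> (\<exists>v<(2 + nv) ^ r. hit nv r M (vv s2 Va) v)) \<and>
          aa s' DIG = (\<lambda>_. 0) \<and> (\<exists>N'\<subseteq>{..<n}. aa s' NN = ind N') \<and> t \<le> ?B + 10) s2"
        by (rule ENUM_correct[OF _ _ s(3) N'(2,1) _ _ s(8) _ bad2 refl]) (use I in simp_all)
      have "wp ENUM (\<lambda>t. wp (Asg Va (Inc (Var Va))) (\<lambda>u s'. ?I s' \<and> cost (Ld MM (Var Va)) + t + 3 + u + cost ?e + 3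
          + (n - vv s' Va) * (?B + 100) \<le> (n - vv s2 Va) * (?B + 100))) s2"
      proof (rule wp_use[OF W])
        fix t :: nat and s3 :: st
        assume A: "vv s3 Vbad = of_bool (vv s2 Vbad = 1 \<or> (\<exists>v<(2 + nv) ^ r. hit nv r M (vv s2 Va) v)) \<and>
          aa s3 DIG = (\<lambda>_. 0) \<and> (\<exists>N'\<subseteq>{..<n}. aa s3 NN = ind N') \<and> t \<le> ?B + 10"
          and sb: "same_but ENUM s2 s3"
        have e3: "env s3" using env_same_but[OF _ sb] I by (simp add: ENUM_def INITN_def TRIAL_def FIND_def STEP_def INC_def)
        have s3: "aa s3 MM = ind M" "vv s3 Vnv = nv" "vv s3 Vr = r" "vv s3 Va = vv s2 Va"
          using sb I by (auto simp: same_but_def ENUM_def INITN_def TRIAL_def FIND_def STEP_def INC_def)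
        have b3: "vv s3 Vbad = of_bool (vv s Vbad = 1 \<or> (\<exists>a\<in>M. a < Suc (vv s2 Va) \<and> (\<exists>v<(2 + nv) ^ r. hit nv r M a v)))"
        proof -
          have "(\<exists>a\<in>M. a < Suc (vv s2 Va) \<and> (\<exists>v<(2 + nv) ^ r. hit nv r M a v)) \<longleftrightarrow>
            (\<exists>a\<in>M. a < vv s2 Va \<and> (\<exists>v<(2 + nv) ^ r. hit nv r M a v)) \<or> (\<exists>v<(2 + nv) ^ r. hit nv r M (vv s2 Va) v)"
            using True by (auto simp: less_Suc_eq)
          then show ?thesis using A I by (simp add: disj_assoc)
        qed
        have tm: "cost (Ld MM (Var Va)) + t + 3 + (cost (Inc (Var Va)) + 2) + cost ?e + 3 \<le> ?B + 100" using A by simp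
        show "wp (Asg Va (Inc (Var Va))) (\<lambda>u s'. ?I s' \<and> cost (Ld MM (Var Va)) + t + 3 + u + cost ?e + 3
          + (n - vv s' Va) * (?B + 100) \<le> (n - vv s2 Va) * (?B + 100)) s3"
          unfolding wp_Asg dec using e3 s3 b3 A a tm by simp
      qed
      then show ?thesis using True I by (simp add: add.assoc)
    next
      case False
      have "(\<exists>a\<in>M. a < Suc (vv s2 Va) \<and> (\<exists>v<(2 + nv) ^ r. hit nv r M a v)) \<longleftrightarrow>
         (\<exists>a\<in>M. a < vv s2 Va \<and> (\<exists>v<(2 + nv) ^ r. hit nv r M a v))" using False by (auto simp: less_Suc_eq)
      then show ?thesis unfolding dec using False I a by simp
    qed
  qed (rule that)
  have "vv s Vbad = of_bool (vv s Vbad = 1)" using s(10) by auto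
  then have I0: "?I (s\<lparr>vv := (vv s)(Va := eval (Num 0) s)\<rparr>)" using s by simp
  show ?thesis unfolding SEARCH_def wp_Seq wp_Asg
  proof (rule wp_mono[OF loop[OF I0]])
    fix t s' assume A: "?I s' \<and> eval ?e s' = 0 \<and>
      t \<le> (n - vv (s\<lparr>vv := (vv s)(Va := eval (Num 0) s)\<rparr>) Va) * (?B + 100) + cost ?e + 2"
    have vn: "vv s' Va = n" using A by (simp add: env_def)
    have "(\<exists>a\<in>M. a < n \<and> (\<exists>v<(2 + nv) ^ r. hit nv r M a v)) \<longleftrightarrow> found nv r M"
      using s(3) by (auto simp: found_def hit_def)
    then show "vv s' Vbad = of_bool (vv s Vbad = 1 \<or> found nv r M) \<and> aa s' DIG = (\<lambda>_. 0) \<and>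
      (\<exists>N'\<subseteq>{..<n}. aa s' NN = ind N') \<and> cost (Num 0) + 2 + t \<le> (n + 1) * (?B + 100)"
      using A vn by simp
  qed
qed

end

section \<open>Enumeration of all candidates\<close>

text \<open>Division by 8 without a division: \<open>Ve\<close> counts modulo 8 and each of its
  overflows adds 3 to \<open>Vr1\<close>.\<close>

definition COUNT :: com where
  "COUNT = Seq (Asg Vi (Num 0)) (Seq (Asg Vk (Num 0)) (Seq (Asg Ve (Num 0)) (Seq (Asg Vr1 (Num 0))
     (Whl (Lt (Var Vi) (Var Vn)) (Seq
       (If (Ld MM (Var Vi)) (Seq (Asg Vk (Inc (Var Vk))) (Seq (Asg Ve (Inc (Var Ve)))
          (If (Eq (Var Ve) (Num 8)) (Seq (Asg Ve (Num 0)) (Asg Vr1 (Inc (Inc (Inc (Var Vr1)))))) Skip))) Skip)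
       (Asg Vi (Inc (Var Vi))))))))"

text \<open>With \<open>Vr\<close> = 0 the search is the local test. Once that is passed, both long
  searches run, so their costs add up.\<close>

definition TEST :: com where
  "TEST = Seq (Asg Vbad (Num 0)) (Seq (Asg Vnv (Num 0)) (Seq INITN (Seq FIND
     (If (Var Vf) (Asg Vbad (Num 1))
       (Seq (Asg Vr (Num 0)) (Seq SEARCH (If (Var Vbad) Skip
         (Seq (Asg Vr (Dif (Var Vk) (Var Vr1))) (Seq SEARCH
         (Seq (Asg Vnv (Num 1)) (Seq (Asg Vr (Var Vr1)) SEARCH)))))))))))"

definition OUT :: com where
  "OUT = If (Var Vbad) Skip (Seq (Wr (Var Vk)) (Seq (Asg Vi (Num 0)) (Whl (Lt (Var Vi) (Var Vn))
     (Seq (If (Ld MM (Var Vi)) (Wr (Ld NAME (Var Vi))) Skip) (Asg Vi (Inc (Var Vi)))))))"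

definition MAIN :: com where
  "MAIN = Seq (Asg Vmore (Num 1)) (Whl (Var Vmore)
     (Seq COUNT (Seq TEST (Seq OUT (INC MM Vn (Num 1) Vmore)))))"

lemmas progs = COUNT_def TEST_def OUT_def SEARCH_def ENUM_def INITN_def TRIAL_def FIND_def STEP_def INC_def

context slots
begin

lemma COUNT_correct:
  assumes "env s" "aa s MM = ind M"
  shows "wp COUNT (\<lambda>t s'. vv s' Vk = card (M \<inter> {..<n}) \<and> vv s' Vr1 = 3 * (card (M \<inter> {..<n}) div 8) \<and> t \<le> 100 * (n + 1)) s"
proof -
  let ?e = "Lt (Var Vi) (Var Vn)"
  let ?body = "Seq (If (Ld MM (Var Vi)) (Seq (Asg Vk (Inc (Var Vk))) (Seq (Asg Ve (Inc (Var Ve)))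
          (If (Eq (Var Ve) (Num 8)) (Seq (Asg Ve (Num 0)) (Asg Vr1 (Inc (Inc (Inc (Var Vr1)))))) Skip))) Skip)
       (Asg Vi (Inc (Var Vi)))"
  let ?c = "\<lambda>i. card (M \<inter> {..<i})"
  let ?I = "\<lambda>s'. env s' \<and> aa s' MM = ind M \<and> vv s' Vi \<le> n \<and> vv s' Vk = ?c (vv s' Vi) \<and> vv s' Ve = ?c (vv s' Vi) mod 8 \<and>
    vv s' Vr1 = 3 * (?c (vv s' Vi) div 8)"
  have loop: "wp (Whl ?e ?body) (\<lambda>t s'. ?I s' \<and> eval ?e s' = 0 \<and> t \<le> (n - vv s1 Vi) * 100 + cost ?e + 2) s1"
    if "?I s1" for s1
  proof (rule wp_Whl[where \<Phi> = "\<lambda>s'. (n - vv s' Vi) * 100"])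
    fix s2 assume I: "?I s2" and c: "eval ?e s2 \<noteq> 0"
    have vn: "vv s2 Vn = n" using I by (simp add: env_def)
    have i: "vv s2 Vi < n" using c vn by simp
    note dec = diff_mult_step[OF i, of 100]
    have cs: "?c (Suc j) = (if j \<in> M then Suc (?c j) else ?c j)" for j
      by (simp add: lessThan_Suc Int_insert_right)
    show "wp ?body (\<lambda>t s'. ?I s' \<and> t + cost ?e + 3 + (n - vv s' Vi) * 100 \<le> (n - vv s2 Vi) * 100) s2"
      using I i cs[of "vv s2 Vi"] by (simp add: dec mod_Suc div_Suc)
  qed (rule that)
  show ?thesis unfolding COUNT_def wp_Seq wp_Asg
  proof (rule wp_mono[OF loop])
    fix t :: nat and s' :: st
    let ?s1 = "s\<lparr>vv := (vv s)(Vi := eval (Num 0) s)\<rparr>"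
    let ?s2 = "?s1\<lparr>vv := (vv ?s1)(Vk := eval (Num 0) ?s1)\<rparr>"
    let ?s3 = "?s2\<lparr>vv := (vv ?s2)(Ve := eval (Num 0) ?s2)\<rparr>"
    let ?s4 = "?s3\<lparr>vv := (vv ?s3)(Vr1 := eval (Num 0) ?s3)\<rparr>"
    assume A: "?I s' \<and> eval ?e s' = 0 \<and> t \<le> (n - vv ?s4 Vi) * 100 + cost ?e + 2"
    have "vv s' Vi = n" using A by (simp add: env_def)
    then show "vv s' Vk = ?c n \<and> vv s' Vr1 = 3 * (?c n div 8) \<and>
      cost (Num 0) + 2 + (cost (Num 0) + 2 + (cost (Num 0) + 2 + (cost (Num 0) + 2 + t))) \<le> 100 * (n + 1)"
      using A by simp
  qed (use assms in simp)
qed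

text \<open>
  \<open>found 0 0 M\<close> is a shrinking search without repair steps: it succeeds iff some \<open>M - {a}\<close> is stable.
\<close>

definition pass :: "nat set \<Rightarrow> bool" where
  "pass M \<longleftrightarrow> stable M M \<and> \<not> found 0 0 M"

text \<open>The two budgets add up to \<open>card M\<close>. A proper subset with more than
  \<open>rN M\<close> elements is therefore reached from some M - {a} by fewer than
  \<open>rD M\<close> deletions.\<close>

definition rN :: "nat set \<Rightarrow> nat" where "rN M = 3 * (card M div 8)"
definition rD :: "nat set \<Rightarrow> nat" where "rD M = card M - rN M"

definition good :: "nat set \<Rightarrow> bool" where
  "good M \<longleftrightarrow> pass M \<and> \<not> found 0 (rD M) M \<and> \<not> found 1 (rN M) M"

text \<open>The polynomial factor: n starting atoms, and for each digit string up to n repair steps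
  that scan R rules. The additions of 1 cover empty inputs.\<close>

definition base :: nat where "base = (R + 1) * (n + 1)\<^sup>2"

definition work :: "nat set \<Rightarrow> nat" where
  "work M = (if pass M then 2 ^ rD M + 3 ^ rN M else 0)"

lemma SEARCH_base:
  assumes s: "env s" "aa s MM = ind M" "M \<subseteq> {..<n}" "aa s NN = ind N" "N \<subseteq> {..<n}" "aa s DIG = (\<lambda>_. 0)"
    "vv s Vnv = nv" "nv \<le> 1" "vv s Vr = r" "vv s Vbad \<le> 1" "r \<le> n"
  shows "wp SEARCH (\<lambda>t s'. vv s' Vbad = of_bool (vv s Vbad = 1 \<or> found nv r M) \<and>
    aa s' DIG = (\<lambda>_. 0) \<and> (\<exists>N'\<subseteq>{..<n}. aa s' NN = ind N') \<and> t \<le> 3100 * base * (2 + nv) ^ r) s"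
proof (rule wp_mono[OF SEARCH_correct[OF s(1-10)]])
  fix t :: nat and s' :: st
  let ?p = "(2 + nv) ^ r"
  assume A: "vv s' Vbad = of_bool (vv s Vbad = 1 \<or> found nv r M) \<and>
    aa s' DIG = (\<lambda>_. 0) \<and> (\<exists>N'\<subseteq>{..<n}. aa s' NN = ind N') \<and>
    t \<le> (n + 1) * (?p * (1500 * (R + 1) * (n + r + 2)) + 100)"
  have "(n + 1) * (?p * (1500 * (R + 1) * (n + r + 2)) + 100) \<le> (n + 1) * (?p * (1500 * (R + 1) * (2 * (n + 1))) + 100 * (?p * ((R + 1) * (n + 1))))"
  proof (intro mult_le_mono2 add_le_mono)
    have "1 * (1 * 1) \<le> ?p * ((R + 1) * (n + 1))" by (intro mult_le_mono) auto
    then show "100 \<le> 100 * (?p * ((R + 1) * (n + 1)))" by simp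
  qed (use s(11) in simp)
  also have "\<dots> = 3100 * base * ?p" by (simp add: base_def power2_eq_square algebra_simps)
  finally show "vv s' Vbad = of_bool (vv s Vbad = 1 \<or> found nv r M) \<and>
    aa s' DIG = (\<lambda>_. 0) \<and> (\<exists>N'\<subseteq>{..<n}. aa s' NN = ind N') \<and> t \<le> 3100 * base * ?p"
    using A order_trans by blast
qed

lemma base_ge: "n + 1 \<le> base" "R + 1 \<le> base" "1 \<le> base"
proof -
  have "1 * ((n + 1) * 1) \<le> (R + 1) * ((n + 1) * (n + 1))" by (intro mult_le_mono) auto
  then show "n + 1 \<le> base" by (simp add: base_def power2_eq_square)
  have "(R + 1) * (1 * 1) \<le> (R + 1) * ((n + 1) * (n + 1))" by (intro mult_le_mono) auto
  then show "R + 1 \<le> base" by (simp add: base_def power2_eq_square)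
  then show "1 \<le> base" by simp
qed

lemma TEST_correct:
  assumes s: "env s" "aa s MM = ind M" "M \<subseteq> {..<n}" "aa s NN = ind N" "N \<subseteq> {..<n}" "aa s DIG = (\<lambda>_. 0)"
    "vv s Vk = card M" "vv s Vr1 = rN M"
  shows "wp TEST (\<lambda>t s'. vv s' Vbad = of_bool (\<not> good M) \<and> aa s' DIG = (\<lambda>_. 0) \<and> (\<exists>N'\<subseteq>{..<n}. aa s' NN = ind N') \<and>
    t \<le> 4000 * base * (1 + work M)) s"
proof -
  have cM: "card M \<le> n" using card_mono[OF _ s(3)] by simp
  have rn: "rN M \<le> n" "rD M \<le> n" using cM by (auto simp: rN_def rD_def)
  let ?Q = "\<lambda>b t s'. vv s' Vbad = of_bool b \<and> aa s' DIG = (\<lambda>_. 0) \<and> (\<exists>N'\<subseteq>{..<n}. aa s' NN = ind N')"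
  \<comment> \<open>The command is specified from its end: \<open>S3\<close> is the growing search,
    \<open>S2\<close> puts the shrinking search in front of it and \<open>S1\<close> the local
    test.\<close>
  have S3: "wp (Seq (Asg Vnv (Num 1)) (Seq (Asg Vr (Var Vr1)) SEARCH))
     (\<lambda>t s'. ?Q (b \<or> found 1 (rN M) M) t s' \<and> t \<le> 3100 * base * 3 ^ rN M + 10) s1"
    if "env s1" "aa s1 MM = ind M" "?Q b t s1" "vv s1 Vr1 = rN M" for b t s1
  proof -
    from that obtain N1 where N1: "N1 \<subseteq> {..<n}" "aa s1 NN = ind N1" by blast
    show ?thesis unfolding wp_Seq wp_Asg
      by (rule wp_mono[OF SEARCH_base[where M = M and N = N1 and nv = 1 and r = "rN M"]])
        (use that s N1 rn in \<open>auto simp: numeral_3_eq_3\<close>)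
  qed
  have S2: "wp (Seq (Asg Vr (Dif (Var Vk) (Var Vr1))) (Seq SEARCH (Seq (Asg Vnv (Num 1)) (Seq (Asg Vr (Var Vr1)) SEARCH))))
     (\<lambda>t s'. ?Q (found 0 (rD M) M \<or> found 1 (rN M) M) t s' \<and> t \<le> 3100 * base * (2 ^ rD M + 3 ^ rN M) + 30) s1"
    if P: "env s1" "aa s1 MM = ind M" "?Q False t s1" "vv s1 Vr1 = rN M" "vv s1 Vk = card M" "vv s1 Vnv = 0" for t s1
  proof -
    from P obtain N1 where N1: "N1 \<subseteq> {..<n}" "aa s1 NN = ind N1" by blast
    let ?s = "s1\<lparr>vv := (vv s1)(Vr := eval (Dif (Var Vk) (Var Vr1)) s1)\<rparr>"
    have W: "wp SEARCH (\<lambda>t s'. ?Q (found 0 (rD M) M) t s' \<and> t \<le> 3100 * base * 2 ^ rD M) ?s"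
      by (rule wp_mono[OF SEARCH_base[where M = M and N = N1 and nv = 0 and r = "rD M"]])
        (use P s N1 rn in \<open>auto simp: rD_def\<close>)
    show ?thesis
      unfolding wp_Seq[of "Asg Vr (Dif (Var Vk) (Var Vr1))"] wp_Asg wp_Seq[of SEARCH]
    proof (rule wp_use[OF W])
      fix t :: nat and s2 :: st
      assume A: "?Q (found 0 (rD M) M) t s2 \<and> t \<le> 3100 * base * 2 ^ rD M" and sb: "same_but SEARCH ?s s2"
      have e2: "env s2" using env_same_but[OF _ sb] P(1) by (simp add: progs)
      have s2: "aa s2 MM = ind M" "vv s2 Vr1 = rN M" using sb P by (auto simp: same_but_def progs)
      show "wp (Seq (Asg Vnv (Num 1)) (Seq (Asg Vr (Var Vr1)) SEARCH))
        (\<lambda>u s'. ?Q (found 0 (rD M) M \<or> found 1 (rN M) M) (cost (Dif (Var Vk) (Var Vr1)) + 2 + (t + u)) s' \<and>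
          cost (Dif (Var Vk) (Var Vr1)) + 2 + (t + u) \<le> 3100 * base * (2 ^ rD M + 3 ^ rN M) + 30) s2"
        by (rule wp_mono[OF S3[OF e2 s2(1) conjunct1[OF A] s2(2)]]) (use A in \<open>simp add: distrib_left\<close>)
    qed
  qed
  have S1: "wp (Seq (Asg Vr (Num 0)) (Seq SEARCH (If (Var Vbad) Skip
       (Seq (Asg Vr (Dif (Var Vk) (Var Vr1))) (Seq SEARCH (Seq (Asg Vnv (Num 1)) (Seq (Asg Vr (Var Vr1)) SEARCH)))))))
     (\<lambda>t s'. ?Q (found 0 0 M \<or> found 0 (rD M) M \<or> found 1 (rN M) M) t s' \<and>
        t \<le> 3100 * base * (1 + (if found 0 0 M then 0 else 2 ^ rD M + 3 ^ rN M)) + 50) s1"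
    if P: "env s1" "aa s1 MM = ind M" "?Q False t s1" "vv s1 Vr1 = rN M" "vv s1 Vk = card M" "vv s1 Vnv = 0" for t s1
  proof -
    from P obtain N1 where N1: "N1 \<subseteq> {..<n}" "aa s1 NN = ind N1" by blast
    let ?s = "s1\<lparr>vv := (vv s1)(Vr := eval (Num 0) s1)\<rparr>"
    let ?rest = "Seq (Asg Vr (Dif (Var Vk) (Var Vr1))) (Seq SEARCH (Seq (Asg Vnv (Num 1)) (Seq (Asg Vr (Var Vr1)) SEARCH)))"
    have W: "wp SEARCH (\<lambda>t s'. ?Q (found 0 0 M) t s' \<and> t \<le> 3100 * base) ?s"
      by (rule wp_mono[OF SEARCH_base[where M = M and N = N1 and nv = 0 and r = 0]])
        (use P s N1 rn in auto)
    show ?thesis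
      unfolding wp_Seq[of "Asg Vr (Num 0)"] wp_Asg[of Vr "Num 0"] wp_Seq[of SEARCH "If (Var Vbad) Skip ?rest"]
    proof (rule wp_use[OF W])
      fix t :: nat and s2 :: st
      assume A: "?Q (found 0 0 M) t s2 \<and> t \<le> 3100 * base" and sb: "same_but SEARCH ?s s2"
      have e2: "env s2" using env_same_but[OF _ sb] P(1) by (simp add: progs)
      have s2: "aa s2 MM = ind M" "vv s2 Vr1 = rN M" "vv s2 Vk = card M" "vv s2 Vnv = 0"
        using sb P by (auto simp: same_but_def progs)
      show "wp (If (Var Vbad) Skip ?rest)
        (\<lambda>u s'. ?Q (found 0 0 M \<or> found 0 (rD M) M \<or> found 1 (rN M) M) (cost (Num 0) + 2 + (t + u)) s' \<and>
          cost (Num 0) + 2 + (t + u) \<le> 3100 * base * (1 + (if found 0 0 M then 0 else 2 ^ rD M + 3 ^ rN M)) + 50) s2"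
      proof (cases "found 0 0 M")
        case True
        then show ?thesis using A by simp
      next
        case False
        then have Q: "?Q False t s2" using A by simp
        show ?thesis unfolding wp_If
          using wp_mono[OF S2[OF e2 s2(1) Q s2(2,3,4)], of "\<lambda>u s'.
            ?Q (found 0 0 M \<or> found 0 (rD M) M \<or> found 1 (rN M) M) (cost (Num 0) + 2 + (t + (cost (Var Vbad) + u + 2))) s' \<and>
          cost (Num 0) + 2 + (t + (cost (Var Vbad) + u + 2)) \<le> 3100 * base * (1 + (if found 0 0 M then 0 else 2 ^ rD M + 3 ^ rN M)) + 50"]
            False A by (simp add: distrib_left)
      qed
    qed
  qed
  have W1: "wp INITN (\<lambda>t s'. aa s' NN = ind (if 0 = (0::nat) then M else {}) \<and> t \<le> 50 * (n + 1))
    (s\<lparr>vv := (vv s)(Vbad := eval (Num 0) s),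
       vv := (vv (s\<lparr>vv := (vv s)(Vbad := eval (Num 0) s)\<rparr>))(Vnv := eval (Num 0) (s\<lparr>vv := (vv s)(Vbad := eval (Num 0) s)\<rparr>))\<rparr>)"
    (is "wp INITN _ ?s1")
    by (rule INITN_correct[where N = N]) (use s in auto)
  let ?tail = "Seq (Asg Vr (Num 0)) (Seq SEARCH (If (Var Vbad) Skip
       (Seq (Asg Vr (Dif (Var Vk) (Var Vr1))) (Seq SEARCH (Seq (Asg Vnv (Num 1)) (Seq (Asg Vr (Var Vr1)) SEARCH))))))"
  show ?thesis
    unfolding TEST_def wp_Seq[of "Asg Vbad (Num 0)"] wp_Seq[of "Asg Vnv (Num 0)"] wp_Seq[of INITN] wp_Seq[of FIND]
      wp_Asg[of Vbad "Num 0"] wp_Asg[of Vnv "Num 0"]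
  proof (rule wp_use[OF W1])
    fix t1 :: nat and s2 :: st
    assume A: "aa s2 NN = ind (if 0 = (0::nat) then M else {}) \<and> t1 \<le> 50 * (n + 1)" and sb: "same_but INITN ?s1 s2"
    have e2: "env s2" using env_same_but[OF _ sb] s(1) by (simp add: progs)
    have s2: "aa s2 MM = ind M" "vv s2 Vr1 = rN M" "vv s2 Vk = card M" "vv s2 Vnv = 0" "vv s2 Vbad = 0" "aa s2 DIG = (\<lambda>_. 0)"
      using sb s by (auto simp: same_but_def progs)
    have n2: "aa s2 NN = ind M" using A by simp
    show "wp FIND (\<lambda>t. wp (If (Var Vf) (Asg Vbad (Num 1)) ?tail)
       (\<lambda>u s'. vv s' Vbad = of_bool (\<not> good M) \<and> aa s' DIG = (\<lambda>_. 0) \<and> (\<exists>N'\<subseteq>{..<n}. aa s' NN = ind N') \<and>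
        cost (Num 0) + 2 + (cost (Num 0) + 2 + (t1 + (t + u))) \<le> 4000 * base * (1 + work M))) s2"
    proof (rule wp_use[OF FIND_correct[OF e2 s2(1) n2]])
      fix t2 :: nat and s3 :: st
      assume B: "vv s3 Vf = of_bool (\<not> stable M M) \<and> (\<not> stable M M \<longrightarrow> vv s3 Vp = 3 * fv M M) \<and> t2 \<le> 600 * (R + 1)"
        and sb3: "same_but FIND s2 s3"
      have e3: "env s3" using env_same_but[OF e2 sb3] by (simp add: progs)
      have s3: "aa s3 MM = ind M" "vv s3 Vr1 = rN M" "vv s3 Vk = card M" "vv s3 Vnv = 0" "vv s3 Vbad = 0" "aa s3 DIG = (\<lambda>_. 0)"
          "aa s3 NN = ind M"
        using sb3 s2 n2 by (auto simp: same_but_def progs)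
      have "t1 \<le> 50 * (n + 1)" "t2 \<le> 600 * (R + 1)" using A B by blast+
      then have t12: "t1 + t2 \<le> 650 * base" using base_ge by simp
      show "wp (If (Var Vf) (Asg Vbad (Num 1)) ?tail)
       (\<lambda>u s'. vv s' Vbad = of_bool (\<not> good M) \<and> aa s' DIG = (\<lambda>_. 0) \<and> (\<exists>N'\<subseteq>{..<n}. aa s' NN = ind N') \<and>
        cost (Num 0) + 2 + (cost (Num 0) + 2 + (t1 + (t2 + u))) \<le> 4000 * base * (1 + work M)) s3"
      proof (cases "stable M M")
        case False
        then have g: "\<not> good M" "work M = 0" by (auto simp: good_def pass_def work_def)
        then show ?thesis using B False s3 s(3) t12 base_ge by auto
      next
        case True
        have Q: "?Q False t2 s3" using s3 s(3) by auto
        have g: "good M \<longleftrightarrow> \<not> (found 0 0 M \<or> found 0 (rD M) M \<or> found 1 (rN M) M)"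
          "work M = (if found 0 0 M then 0 else 2 ^ rD M + 3 ^ rN M)"
          using True by (auto simp: good_def pass_def work_def)
        have f: "eval (Var Vf) s3 = 0" using B True by simp
        have bound: "t1 + t2 + (3100 * base * (1 + work M) + 50) + 50 \<le> 4000 * base * (1 + work M)"
        proof -
          have "base * 1 \<le> base * (1 + work M)" by (intro mult_le_mono2) simp
          then have "750 * base \<le> 750 * (base * (1 + work M))" by simp
          moreover have "100 \<le> 100 * base" using base_ge by simp
          moreover define z where "z = base * (1 + work M)"
          ultimately have "t1 + t2 + (3100 * z + 50) + 50 \<le> 4000 * z" using t12 by simp
          then show ?thesis by (simp only: z_def mult.assoc)
        qed
        have "wp ?tail (\<lambda>u s'. vv s' Vbad = of_bool (\<not> good M) \<and> aa s' DIG = (\<lambda>_. 0) \<and> (\<exists>N'\<subseteq>{..<n}. aa s' NN = ind N') \<and>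
          cost (Num 0) + 2 + (cost (Num 0) + 2 + (t1 + (t2 + (cost (Var Vf) + u + 2)))) \<le> 4000 * base * (1 + work M)) s3"
          by (rule wp_mono[OF S1[OF e3 s3(1) Q s3(2,3,4)]]) (use bound in \<open>simp add: g\<close>)
        then show ?thesis unfolding wp_If using f by simp
      qed
    qed
  qed
qed

definition outM :: "(nat \<Rightarrow> nat) \<Rightarrow> nat set \<Rightarrow> nat list" where
  "outM nm M = card M # map nm (filter (\<lambda>i. i \<in> M) [0..<n])"

lemma OUT_correct:
  assumes s: "env s" "aa s MM = ind M" "vv s Vk = card M"
  shows "wp OUT (\<lambda>t s'. oo s' = oo s @ (if vv s Vbad = 0 then outM (aa s NAME) M else []) \<and> t \<le> 100 * (n + 1)) s"
proof (cases "vv s Vbad = 0")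
  case True
  let ?e = "Lt (Var Vi) (Var Vn)" and ?nm = "aa s NAME"
  let ?body = "Seq (If (Ld MM (Var Vi)) (Wr (Ld NAME (Var Vi))) Skip) (Asg Vi (Inc (Var Vi)))"
  let ?I = "\<lambda>s'. env s' \<and> aa s' MM = ind M \<and> aa s' NAME = ?nm \<and> vv s' Vi \<le> n \<and>
    oo s' = oo s @ card M # map ?nm (filter (\<lambda>i. i \<in> M) [0..<vv s' Vi])"
  have loop: "wp (Whl ?e ?body) (\<lambda>t s'. ?I s' \<and> eval ?e s' = 0 \<and> t \<le> (n - vv s1 Vi) * 70 + cost ?e + 2) s1"
    if "?I s1" for s1
  proof (rule wp_Whl[where \<Phi> = "\<lambda>s'. (n - vv s' Vi) * 70"])
    fix s2 assume I: "?I s2" and c: "eval ?e s2 \<noteq> 0"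
    have vn: "vv s2 Vn = n" using I by (simp add: env_def)
    have i: "vv s2 Vi < n" using c vn by simp
    note dec = diff_mult_step[OF i, of 70]
    show "wp ?body (\<lambda>t s'. ?I s' \<and> t + cost ?e + 3 + (n - vv s' Vi) * 70 \<le> (n - vv s2 Vi) * 70) s2"
      using I i by (simp add: dec)
  qed (rule that)
  have "wp (Seq (Wr (Var Vk)) (Seq (Asg Vi (Num 0)) (Whl ?e ?body)))
     (\<lambda>t s'. oo s' = oo s @ outM ?nm M \<and> t \<le> 70 * (n + 1)) s"
    unfolding wp_Seq[of "Wr _"] wp_Seq[of "Asg _ _"] wp_Asg[of Vi "Num 0"] wp_Wr[of "Var Vk"]
  proof (rule wp_mono[OF loop])
    fix t :: nat and s' :: st
    let ?s1 = "s\<lparr>oo := oo s @ [eval (Var Vk) s]\<rparr>"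
    let ?s2 = "?s1\<lparr>vv := (vv ?s1)(Vi := eval (Num 0) ?s1)\<rparr>"
    assume A: "?I s' \<and> eval ?e s' = 0 \<and> t \<le> (n - vv ?s2 Vi) * 70 + cost ?e + 2"
    have "vv s' Vi = n" using A by (simp add: env_def)
    then show "oo s' = oo s @ outM ?nm M \<and> cost (Var Vk) + 1 + (cost (Num 0) + 2 + t) \<le> 70 * (n + 1)"
      using A by (simp add: outM_def)
  qed (use s in simp)
  from wp_mono[OF this, of "\<lambda>t s'. oo s' = oo s @ outM ?nm M \<and> cost (Var Vbad) + t + 2 \<le> 100 * (n + 1)"]
  show ?thesis unfolding OUT_def wp_If using True by simp
next
  case False
  then show ?thesis by (simp add: OUT_def)
qed

definition Mset :: "nat \<Rightarrow> nat set" where "Mset v = {i. i < n \<and> odd (v div 2 ^ i)}"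

lemma digits_Mset: "digits 2 n v = ind (Mset v)"
  by (auto simp: digits_def ind_def Mset_def fun_eq_iff odd_iff_mod_2_eq_one)

lemma Mset_subset: "Mset v \<subseteq> {..<n}" by (auto simp: Mset_def)

lemma MAIN_correct:
  assumes s: "env s" "aa s MM = (\<lambda>_. 0)" "aa s NN = (\<lambda>_. 0)" "aa s DIG = (\<lambda>_. 0)"
  shows "wp MAIN (\<lambda>t s'. oo s' = oo s @ concat (map (\<lambda>v. if good (Mset v) then outM (aa s NAME) (Mset v) else []) [0..<2 ^ n]) \<and>
    t \<le> 5000 * base * (\<Sum>v<2 ^ n. 1 + work (Mset v)) + 10) s"
proof -
  let ?nm = "aa s NAME"
  let ?body = "Seq COUNT (Seq TEST (Seq OUT (INC MM Vn (Num 1) Vmore)))"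
  let ?o = "\<lambda>v. if good (Mset v) then outM ?nm (Mset v) else []"
  \<comment> \<open>The potential is the cost of the sets still to come. The total thus becomes a
    sum over all sets instead of 2^n times the worst case.\<close>
  let ?P = "\<lambda>v. 5000 * base * (\<Sum>v'\<in>{v..<2 ^ n}. 1 + work (Mset v'))"
  let ?J = "\<lambda>v s'. env s' \<and> v \<le> 2 ^ n \<and> aa s' MM = digits 2 n (if v < 2 ^ n then v else 0) \<and> aa s' DIG = (\<lambda>_. 0) \<and>
    (\<exists>N'\<subseteq>{..<n}. aa s' NN = ind N') \<and> vv s' Vmore = of_bool (v < 2 ^ n) \<and> aa s' NAME = ?nm \<and>
    oo s' = oo s @ concat (map ?o [0..<v])"
  have loop: "wp (Whl (Var Vmore) ?body) (\<lambda>t s'. (\<exists>v. ?J v s') \<and> eval (Var Vmore) s' = 0 \<and>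
      t \<le> ?P v1 + cost (Var Vmore) + 2) s1" if "?J v1 s1" for v1 s1
  proof (rule wp_Whl_ghost[where \<Phi> = ?P and J = ?J])
    fix v s2 assume J: "?J v s2" and c: "eval (Var Vmore) s2 \<noteq> 0"
    then have v: "v < 2 ^ n" by (simp split: if_splits)
    from J obtain N' where N': "N' \<subseteq> {..<n}" "aa s2 NN = ind N'" by blast
    let ?M = "Mset v"
    have e2: "env s2" and s2: "aa s2 MM = ind ?M" "aa s2 DIG = (\<lambda>_. 0)" "aa s2 NAME = ?nm" "vv s2 Vmore = 1"
        "oo s2 = oo s @ concat (map ?o [0..<v])" using J v by (simp_all add: digits_Mset)
    have Mn: "?M \<inter> {..<n} = ?M" using Mset_subset by blast
    have dec: "?P v = ?P (Suc v) + 5000 * base * (1 + work ?M)"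
    proof -
      have "(\<Sum>v'\<in>{v..<2 ^ n}. 1 + work (Mset v')) = (1 + work ?M) + (\<Sum>v'\<in>{Suc v..<2 ^ n}. 1 + work (Mset v'))"
        using v by (rule sum.atLeast_Suc_lessThan)
      then show ?thesis by (simp only: distrib_left add.commute)
    qed
    have tb: "100 * (n + 1) + 4000 * base * (1 + work ?M) + 100 * (n + 1) + 81 * (n + 1) + 10 \<le> 5000 * base * (1 + work ?M)"
    proof -
      have "base * 1 \<le> base * (1 + work ?M)" by (intro mult_le_mono2) simp
      then have "n + 1 \<le> base * (1 + work ?M)" using base_ge(1) by linarith
      moreover define z where "z = base * (1 + work ?M)"
      ultimately have "n + 1 \<le> z" by simp
      then have "100 * (n + 1) + 4000 * z + 100 * (n + 1) + 81 * (n + 1) + 10 \<le> 5000 * z" by simp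
      then show ?thesis by (simp only: z_def mult.assoc)
    qed
    let ?Q = "\<lambda>t s'. \<exists>v'. ?J v' s' \<and> t + cost (Var Vmore) + 3 + ?P v' \<le> ?P v"
    show "wp ?body ?Q s2"
      unfolding wp_Seq
    proof (rule wp_use[OF COUNT_correct[OF e2 s2(1)]])
      fix t1 :: nat and s3 :: st
      assume A: "vv s3 Vk = card (?M \<inter> {..<n}) \<and> vv s3 Vr1 = 3 * (card (?M \<inter> {..<n}) div 8) \<and> t1 \<le> 100 * (n + 1)"
        and sb: "same_but COUNT s2 s3"
      have e3: "env s3" using env_same_but[OF e2 sb] by (simp add: progs)
      have s3: "aa s3 MM = ind ?M" "aa s3 DIG = (\<lambda>_. 0)" "aa s3 NN = ind N'" "aa s3 NAME = ?nm" "vv s3 Vmore = 1"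
          "oo s3 = oo s @ concat (map ?o [0..<v])" "vv s3 Vk = card ?M" "vv s3 Vr1 = rN ?M"
        using sb s2 N' A by (simp_all add: same_but_def progs Mn rN_def)
      show "wp TEST (\<lambda>t. wp OUT (\<lambda>u. wp (INC MM Vn (Num 1) Vmore) (\<lambda>w. ?Q (t1 + (t + (u + w)))))) s3"
      proof (rule wp_use[OF TEST_correct[OF e3 s3(1) Mset_subset s3(3) N'(1) s3(2) s3(7,8)]])
        fix t2 :: nat and s4 :: st
        assume B: "vv s4 Vbad = of_bool (\<not> good ?M) \<and> aa s4 DIG = (\<lambda>_. 0) \<and> (\<exists>N'\<subseteq>{..<n}. aa s4 NN = ind N') \<and>
            t2 \<le> 4000 * base * (1 + work ?M)" and sb4: "same_but TEST s3 s4"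
        have e4: "env s4" using env_same_but[OF e3 sb4] by (simp add: progs)
        have s4: "aa s4 MM = ind ?M" "aa s4 NAME = ?nm" "vv s4 Vmore = 1" "oo s4 = oo s @ concat (map ?o [0..<v])" "vv s4 Vk = card ?M"
          using sb4 s3 by (simp_all add: same_but_def progs)
        show "wp OUT (\<lambda>u. wp (INC MM Vn (Num 1) Vmore) (\<lambda>w. ?Q (t1 + (t2 + (u + w))))) s4"
        proof (rule wp_use[OF OUT_correct[OF e4 s4(1,5)]])
          fix t3 :: nat and s5 :: st
          assume C: "oo s5 = oo s4 @ (if vv s4 Vbad = 0 then outM (aa s4 NAME) ?M else []) \<and> t3 \<le> 100 * (n + 1)"
            and sb5: "same_but OUT s4 s5"
          have e5: "env s5" using env_same_but[OF e4 sb5] by (simp add: progs)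
          have s5: "aa s5 MM = digits 2 n v" "aa s5 NAME = ?nm" "vv s5 Vmore = 1" "aa s5 DIG = (\<lambda>_. 0)"
              "\<exists>N'\<subseteq>{..<n}. aa s5 NN = ind N'"
            using sb5 s4 B by (simp_all add: same_but_def progs digits_Mset)
          have o5: "oo s5 = oo s @ concat (map ?o [0..<Suc v])" using C B s4 by simp
          have vn: "vv s5 Vn = n" using e5 by (simp add: env_def)
          have W: "wp (INC MM Vn (Num 1) Vmore) (\<lambda>t s'. aa s' MM = digits 2 n (if v + 1 < 2 ^ n then v + 1 else 0) \<and>
              vv s' Vmore = (if v + 1 < 2 ^ n then vv s5 Vmore else 0) \<and> t \<le> (cost (Num 1) + 80) * (n + 1)) s5"
            by (rule INC_correct[OF s5(1) v]) (use vn in auto)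
          show "wp (INC MM Vn (Num 1) Vmore) (\<lambda>w. ?Q (t1 + (t2 + (t3 + w)))) s5"
          proof (rule wp_use[OF W])
            fix t4 :: nat and s6 :: st
            assume D: "aa s6 MM = digits 2 n (if v + 1 < 2 ^ n then v + 1 else 0) \<and>
              vv s6 Vmore = (if v + 1 < 2 ^ n then vv s5 Vmore else 0) \<and> t4 \<le> (cost (Num 1) + 80) * (n + 1)"
              and sb6: "same_but (INC MM Vn (Num 1) Vmore) s5 s6"
            have e6: "env s6" using env_same_but[OF e5 sb6] by (simp add: progs)
            have s6: "aa s6 NAME = ?nm" "aa s6 DIG = (\<lambda>_. 0)" "\<exists>N'\<subseteq>{..<n}. aa s6 NN = ind N'" "oo s6 = oo s5"
              using sb6 s5 by (simp_all add: same_but_def progs)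
            have "?J (Suc v) s6" using e6 s6 o5 D v s5(3) by simp
            moreover have "t1 + (t2 + (t3 + t4)) + cost (Var Vmore) + 3 + ?P (Suc v) \<le> ?P v"
            proof -
              have "t1 \<le> 100 * (n + 1)" "t2 \<le> 4000 * base * (1 + work ?M)" "t3 \<le> 100 * (n + 1)" "t4 \<le> 81 * (n + 1)"
                using A B C D by simp_all
              then have "t1 + (t2 + (t3 + t4)) + cost (Var Vmore) + 3 \<le> 5000 * base * (1 + work ?M)" using tb by simp
              then show ?thesis unfolding dec by linarith
            qed
            ultimately show "?Q (t1 + (t2 + (t3 + t4))) s6" by blast
          qed
        qed
      qed
    qed
  qed (rule that)
  have nn: "\<exists>N'\<subseteq>{..<n}. aa s NN = ind N'" using s(3) by (intro exI[of _ "{}"]) (auto simp: ind_def)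
  have J0: "?J 0 (s\<lparr>vv := (vv s)(Vmore := eval (Num 1) s)\<rparr>)" using s nn by simp
  show ?thesis unfolding MAIN_def wp_Seq wp_Asg
  proof (rule wp_mono[OF loop[OF J0]])
    fix t s' assume A: "(\<exists>v. ?J v s') \<and> eval (Var Vmore) s' = 0 \<and> t \<le> ?P 0 + cost (Var Vmore) + 2"
    then obtain v where J: "?J v s'" by blast
    then have "\<not> v < 2 ^ n" using A by auto
    then have v: "v = 2 ^ n" using J by simp
    have "t + 3 \<le> ?P 0 + 10" using A by simp
    then show "oo s' = oo s @ concat (map ?o [0..<2 ^ n]) \<and>
      cost (Num 1) + 2 + t \<le> 5000 * base * (\<Sum>v<2 ^ n. 1 + work (Mset v)) + 10"
      using J v by (simp add: lessThan_atLeast0)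
  qed
qed

end

section \<open>Correctness and total work of the search\<close>

lemma digit_mod_cong:
  fixes b :: nat
  assumes "\<And>i. i < r \<Longrightarrow> (v div b ^ i) mod b = (w div b ^ i) mod b"
  shows "v mod b ^ r = w mod b ^ r"
  using assms
proof (induction r)
  case (Suc r)
  have "u mod b ^ Suc r = b ^ r * ((u div b ^ r) mod b) + u mod b ^ r" for u
    by (simp add: mod_mult2_eq mult.commute[of b])
  then show ?case using Suc by simp
qed simp

lemma digit_surj:
  fixes b :: nat
  assumes "\<And>i. i < r \<Longrightarrow> g i < b"
  shows "\<exists>v<b ^ r. \<forall>i<r. (v div b ^ i) mod b = g i"
  using assms
proof (induction r)
  case (Suc r)
  then obtain v where v: "v < b ^ r" "\<forall>i<r. (v div b ^ i) mod b = g i" by auto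
  have b: "0 < b" using Suc.prems[of r] by simp
  let ?w = "v + g r * b ^ r"
  have "?w div b ^ r = g r" using v(1) b by simp
  then have top: "(?w div b ^ r) mod b = g r" using Suc.prems[of r] by simp
  have low: "(?w div b ^ i) mod b = g i" if "i < r" for i
  proof -
    have "r = i + (Suc (r - Suc i))" using that by simp
    then have e: "b ^ r = b ^ i * (b * b ^ (r - Suc i))" by (metis power_Suc power_add)
    have "?w = v + (b * (g r * b ^ (r - Suc i))) * b ^ i" by (simp add: e mult_ac)
    then have "?w div b ^ i = (v + (b * (g r * b ^ (r - Suc i))) * b ^ i) div b ^ i" by (rule arg_cong)
    also have "\<dots> = b * (g r * b ^ (r - Suc i)) + v div b ^ i" by (rule div_mult_self1) (use b in simp)
    finally have "(?w div b ^ i) mod b = (v div b ^ i) mod b" by (simp only: mod_mult_self4)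
    then show ?thesis using v(2) that by simp
  qed
  have "?w < b ^ r + g r * b ^ r" using v(1) by simp
  also have "\<dots> = Suc (g r) * b ^ r" by simp
  also have "\<dots> \<le> b * b ^ r" using Suc.prems[of r] by (intro mult_le_mono1) simp
  finally have "?w < b ^ Suc r" by simp
  then show ?case using top low by (metis less_Suc_eq)
qed simp

lemma digits_list_surj:
  assumes "length ds = r" "\<And>d. d \<in> set ds \<Longrightarrow> d < b"
  shows "\<exists>v<b ^ r. map (digits b r v) [0..<r] = ds"
proof -
  obtain v where v: "v < b ^ r" "\<forall>i<r. (v div b ^ i) mod b = ds ! i"
    using digit_surj[of r "\<lambda>i. ds ! i" b] assms by auto
  have "map (digits b r v) [0..<r] = ds" using v assms(1) by (intro nth_equalityI) (auto simp: digits_def)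
  then show ?thesis using v by blast
qed

context slots
begin

lemma bij_Mset: "bij_betw Mset {..<2 ^ n} (Pow {..<n})"
proof (rule bij_betwI')
  fix v w :: nat assume vw: "v \<in> {..<2 ^ n}" "w \<in> {..<2 ^ n}"
  show "Mset v = Mset w \<longleftrightarrow> v = w"
  proof
    assume e: "Mset v = Mset w"
    have "(v div 2 ^ i) mod 2 = (w div 2 ^ i) mod 2" if "i < n" for i
      using arg_cong[OF e, of "\<lambda>M. i \<in> M"] that by (simp add: Mset_def) (metis odd_iff_mod_2_eq_one not_mod_2_eq_1_eq_0)
    then have "v mod 2 ^ n = w mod 2 ^ n" by (rule digit_mod_cong)
    then show "v = w" using vw by simp
  qed simp
next
  fix v :: nat show "Mset v \<in> Pow {..<n}" using Mset_subset by blast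
next
  fix M assume M: "M \<in> Pow {..<n}"
  have "\<exists>v<2 ^ n. \<forall>i<n. (v div 2 ^ i) mod 2 = (of_bool (i \<in> M) :: nat)"
    by (rule digit_surj) simp
  then obtain v where v: "v < 2 ^ n" "\<forall>i<n. (v div 2 ^ i) mod 2 = (of_bool (i \<in> M) :: nat)" by blast
  have "odd (v div 2 ^ i) \<longleftrightarrow> i \<in> M" if "i < n" for i
    using v(2) that by (auto simp: odd_iff_mod_2_eq_one)
  then have "Mset v = M" using M by (auto simp: Mset_def)
  then show "\<exists>v\<in>{..<2 ^ n}. M = Mset v" using v(1) by auto
qed

text \<open>The size bound is what makes growing sound: from the empty set fewer than
  \<open>card M\<close> atoms are added, so the set found is a proper subset. When shrinking, N'
  \<subseteq> N serves this purpose, as N lacks the deleted atom.\<close>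

lemma trial_sound:
  assumes "trial nv M N ds" "N \<subseteq> M" "finite M"
  shows "\<exists>N'. stable M N' \<and> N' \<subseteq> M \<and> (nv = 0 \<longrightarrow> N' \<subseteq> N) \<and> card N' \<le> card N + length ds"
  using assms
proof (induction ds arbitrary: N)
  case (Cons d ds)
  show ?case
  proof (cases "stable M N")
    case False
    let ?A = "act nv M N d"
    have fin: "finite N" using Cons.prems finite_subset by blast
    have A: "?A \<subseteq> M" "nv = 0 \<longrightarrow> ?A \<subseteq> N" using Cons.prems(2) by (auto simp: act_def Let_def)
    have "card ?A \<le> Suc (card N)"
      using fin by (auto simp: act_def Let_def card_insert_if intro: le_SucI card_Diff1_le)
    moreover obtain N' where "stable M N'" "N' \<subseteq> M" "nv = 0 \<longrightarrow> N' \<subseteq> ?A" "card N' \<le> card ?A + length ds"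
      using Cons.IH[OF _ A(1) Cons.prems(3)] Cons.prems(1) False by auto
    ultimately show ?thesis using A(2) by (intro exI[of _ N']) auto
  qed (use Cons.prems in auto)
qed auto

lemma trial_if_stable: "stable M N \<Longrightarrow> trial nv M N ds"
  by (cases ds) auto

lemma viol_fv: "\<not> stable M N \<Longrightarrow> viol M N (fv M N) \<and> fv M N < R"
proof -
  assume "\<not> stable M N"
  then obtain j where j: "j < R" "viol M N j" by (auto simp: stable_def)
  then have "viol M N (fv M N)" "fv M N \<le> j" unfolding fv_def by (auto intro: LeastI Least_le)
  then show ?thesis using j by simp
qed

text \<open>The target S stays below N. A rule violated by N is satisfied by S, and since S
  \<subseteq> N this must be due to a body atom in N - S; deleting that atom brings N closer to S.
  The rule is also satisfied by M, and since N \<subseteq> M this must be due to a head atom, so one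
  slot is never a choice.\<close>

lemma trial_complete0:
  assumes "finite M" "stable M M" "stable M S" "S \<subseteq> N" "N \<subseteq> M" "card (N - S) \<le> r"
  shows "\<exists>ds. length ds = r \<and> set ds \<subseteq> {0, 1} \<and> trial 0 M N ds"
  using assms(4-)
proof (induction r arbitrary: N)
  case 0
  have "finite (N - S)" using 0 assms(1) by (meson finite_Diff finite_subset)
  then have "N = S" using 0 by auto
  then show ?case using assms(3) by auto
next
  case (Suc r)
  show ?case
  proof (cases "stable M N")
    case True
    then show ?thesis by (intro exI[of _ "replicate (Suc r) 0"]) (auto simp: trial_if_stable)
  next
    case False
    let ?j = "fv M N"
    have v: "viol M N ?j" "?j < R" using viol_fv[OF False] by auto
    have "\<not> viol M S ?j" "\<not> viol M M ?j" using assms(2,3) v(2) by (auto simp: stable_def)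
    then obtain q p where q: "q \<in> {3 * ?j, 3 * ?j + 1, 3 * ?j + 2}" "\<not> slot_ok M S q"
      and p: "p \<in> {3 * ?j, 3 * ?j + 1, 3 * ?j + 2}" "\<not> slot_ok M M p" by (auto simp: viol_def)
    have "slot_ok M N q" "slot_ok M N p" using v(1) q(1) p(1) by (auto simp: viol_def)
    then have K: "K q = 2" "X q \<in> N" "X q \<notin> S" "K p = 1"
      using q(2) p(2) Suc.prems by (auto simp: slot_ok_def)
    have "\<exists>d\<in>{0, 1}. pick 0 ?j d = q"
    proof (cases "q = 3 * ?j + 2")
      case False
      then show ?thesis using q(1) K by (auto simp: pick_def)
    next
      case True
      \<comment> \<open>The digit that points at the head slot p makes \<open>pick\<close> fall back
        to slot 2.\<close>
      then have "p = 3 * ?j \<or> p = 3 * ?j + 1" using p(1) K by auto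
      then show ?thesis using True K by (auto simp: pick_def)
    qed
    then obtain d where d: "d \<in> {0, 1}" "pick 0 ?j d = q" by blast
    have act: "act 0 M N d = N - {X q}" using d K Suc.prems by (auto simp: act_def Let_def)
    have "finite (N - S)" using Suc.prems assms(1) by (meson finite_Diff finite_subset)
    moreover have "N - {X q} - S = (N - S) - {X q}" by auto
    ultimately have "card (N - {X q} - S) \<le> r" using K Suc.prems(3) by (simp add: card_Diff_singleton)
    then obtain ds where "length ds = r" "set ds \<subseteq> {0, 1}" "trial 0 M (N - {X q}) ds"
      using Suc.IH[of "N - {X q}"] Suc.prems K by blast
    then show ?thesis using d act by (intro exI[of _ "d # ds"]) auto
  qed
qed

text \<open>The dual argument: S satisfies a rule violated by N \<subseteq> S, so one of its head
  atoms lies in S - N. All three slots may be heads, which is why three digits occur.\<close>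

lemma trial_complete1:
  assumes "finite M" "stable M S" "S \<subseteq> M" "N \<subseteq> S" "card (S - N) \<le> r"
  shows "\<exists>ds. length ds = r \<and> set ds \<subseteq> {0, 1, 2} \<and> trial 1 M N ds"
  using assms(4-)
proof (induction r arbitrary: N)
  case 0
  have "finite (S - N)" using assms by (meson finite_Diff finite_subset)
  then have "N = S" using 0 by auto
  then show ?case using assms(2) by auto
next
  case (Suc r)
  show ?case
  proof (cases "stable M N")
    case True
    then show ?thesis by (intro exI[of _ "replicate (Suc r) 0"]) (auto simp: trial_if_stable)
  next
    case False
    let ?j = "fv M N"
    have v: "viol M N ?j" "?j < R" using viol_fv[OF False] by auto
    have "\<not> viol M S ?j" using assms(2) v(2) by (auto simp: stable_def)
    then have "\<exists>d\<in>{0, 1, 2}. \<not> slot_ok M S (3 * ?j + d)" by (simp add: viol_def)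
    then obtain d where d: "d \<in> {0, 1, 2}" "\<not> slot_ok M S (3 * ?j + d)" by blast
    let ?q = "3 * ?j + d"
    have "slot_ok M N ?q" using v(1) d(1) by (auto simp: viol_def)
    then have K: "K ?q = 1" "X ?q \<in> S" "X ?q \<notin> N" using d(2) Suc.prems by (auto simp: slot_ok_def)
    have "min d 2 = d" using d(1) by auto
    then have "pick 1 ?j d = ?q" using K by (simp add: pick_def)
    then have act: "act 1 M N d = insert (X ?q) N" using K assms(3) by (auto simp: act_def Let_def)
    have "finite (S - N)" using assms by (meson finite_Diff finite_subset)
    moreover have "S - insert (X ?q) N = (S - N) - {X ?q}" by auto
    ultimately have "card (S - insert (X ?q) N) \<le> r" using K Suc.prems(2) by (simp add: card_Diff_singleton)
    then obtain ds where "length ds = r" "set ds \<subseteq> {0, 1, 2}" "trial 1 M (insert (X ?q) N) ds"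
      using Suc.IH[of "insert (X ?q) N"] Suc.prems K by blast
    then show ?thesis using d act by (intro exI[of _ "d # ds"]) auto
  qed
qed

theorem good_iff:
  assumes "M \<subseteq> {..<n}"
  shows "good M \<longleftrightarrow> stable M M \<and> (\<forall>N. N \<subset> M \<longrightarrow> \<not> stable M N)"
proof
  have fin: "finite M" using assms finite_subset by blast
  {
    assume r: "stable M M \<and> (\<forall>N. N \<subset> M \<longrightarrow> \<not> stable M N)"
    have f0: "\<not> found 0 r M" for r
    proof
      assume "found 0 r M"
      then obtain a v where a: "a \<in> M" "trial 0 M (M - {a}) (map (digits 2 r v) [0..<r])"
        by (auto simp: found_def start_def)
      from trial_sound[OF a(2) _ fin] obtain N' where "stable M N'" "N' \<subseteq> M - {a}" by auto
      moreover then have "N' \<subset> M" using a(1) by auto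
      ultimately show False using r by blast
    qed
    have f1: "\<not> found 1 (rN M) M"
    proof
      assume "found 1 (rN M) M"
      then obtain a v where a: "a \<in> M" "trial 1 M {} (map (digits 3 (rN M) v) [0..<rN M])"
        by (auto simp: found_def start_def)
      from trial_sound[OF a(2) _ fin] obtain N' where N': "stable M N'" "N' \<subseteq> M" "card N' \<le> rN M" by auto
      have "0 < card M" using a(1) fin card_gt_0_iff by blast
      \<comment> \<open>The budget is at most 3/8 of the size, hence strictly smaller once M is
        nonempty.\<close>
      then have "rN M < card M" by (simp add: rN_def)
      then have "N' \<noteq> M" using N'(3) by auto
      then show False using r N' by blast
    qed
    show "good M" using r f0 f1 by (auto simp: good_def pass_def)
  }
  assume g: "good M"
  then have st: "stable M M" by (simp add: good_def pass_def)
  have "\<not> stable M N" if N: "N \<subset> M" for N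
  proof
    assume sN: "stable M N"
    obtain a where a: "a \<in> M" "a \<notin> N" using N by blast
    have finN: "finite N" using N fin finite_subset by blast
    have c: "card (M - {a} - N) = card M - card N - 1"
    proof -
      have "M - {a} - N = (M - N) - {a}" by auto
      then show ?thesis using a N fin finN by (simp add: card_Diff_subset less_imp_le)
    qed
    have cN: "card N < card M" using N fin by (rule psubset_card_mono[rotated])
    have rk: "rN M \<le> card M" by (simp add: rN_def)
    show False
    proof (cases "card M - card N - 1 \<le> rD M")
      case True
      then obtain ds where "length ds = rD M" "set ds \<subseteq> {0, 1}" "trial 0 M (M - {a}) ds"
        using trial_complete0[OF fin st sN, of "M - {a}" "rD M"] a N c by auto
      moreover obtain v where "v < 2 ^ rD M" "map (digits 2 (rD M) v) [0..<rD M] = ds"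
        using digits_list_surj[of ds "rD M" 2] calculation by force
      ultimately have "found 0 (rD M) M" using a by (auto simp: found_def start_def)
      then show False using g by (simp add: good_def)
    next
      case False
      then have "card N \<le> rN M" using cN rk by (auto simp: rD_def)
      then obtain ds where ds: "length ds = rN M" "set ds \<subseteq> {0, 1, 2}" "trial 1 M {} ds"
        using trial_complete1[OF fin sN, of "{}" "rN M"] N by auto
      moreover obtain v where "v < 3 ^ rN M" "map (digits 3 (rN M) v) [0..<rN M] = ds"
        using digits_list_surj[of ds "rN M" 3] ds by force
      ultimately have "found 1 (rN M) M" using a by (auto simp: found_def start_def)
      then show False using g by (simp add: good_def)
    qed
  qed
  then show "stable M M \<and> (\<forall>N. N \<subset> M \<longrightarrow> \<not> stable M N)" using st by blast
qed

text \<open>The critical set of a in M consists of the atoms of a rule that M satisfies and M - {a}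
  violates in the reduct by M; the three slots bound its size.\<close>

lemma sum_pass_le:
  assumes idx: "\<And>p. p < 3 * R \<Longrightarrow> K p \<noteq> 0 \<Longrightarrow> X p < n"
  shows "(\<Sum>M\<in>{M. M \<subseteq> {..<n} \<and> pass M}. 1.543 ^ card M) \<le> (91 / 40 :: real) ^ n"
proof -
  let ?F = "{M. M \<subseteq> {..<n} \<and> pass M}"
  let ?p = "51 / 91 :: real"
  have ex: "\<exists>j<R. viol M (M - {a}) j" if "M \<in> ?F" "a \<in> M" for M a
  proof -
    have "\<not> found 0 0 M" using that(1) by (simp add: pass_def)
    then have "\<not> stable M (M - {a})" using that(2) by (simp add: found_def start_def)
    then show ?thesis by (auto simp: stable_def)
  qed
  define J where "J M a = (SOME j. j < R \<and> viol M (M - {a}) j)" for M a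
  have J: "J M a < R" "viol M (M - {a}) (J M a)" if "M \<in> ?F" "a \<in> M" for M a
    using someI_ex[OF ex[OF that]] by (auto simp: J_def)
  define P where "P M a = {3 * J M a, 3 * J M a + 1, 3 * J M a + 2}" for M a
  define S where "S M a = X ` {p \<in> P M a. K p \<noteq> 0}" for M a
  have ok: "slot_ok M (M - {a}) p" if "M \<in> ?F" "a \<in> M" "p \<in> P M a" for M a p
    using J(2)[OF that(1,2)] that(3) by (auto simp: viol_def P_def)
  have viol_iff: "viol M' M' (J M a) \<longleftrightarrow> (\<forall>p\<in>P M a. slot_ok M' M' p)" for M M' a
    by (simp add: viol_def P_def)
  have SP: "S M a \<subseteq> {..<n} \<and> a \<in> S M a \<and> card (S M a) \<le> 3" if M: "M \<in> ?F" "a \<in> M" for M a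
  proof (intro conjI)
    have "p < 3 * R" if "p \<in> P M a" for p using that J(1)[OF M] by (auto simp: P_def)
    then show "S M a \<subseteq> {..<n}" using idx by (auto simp: S_def)
    have "card (S M a) \<le> card {p \<in> P M a. K p \<noteq> 0}" unfolding S_def by (rule card_image_le) (simp add: P_def)
    also have "\<dots> \<le> card (P M a)" by (rule card_mono) (auto simp: P_def)
    also have "\<dots> \<le> 3" by (simp add: P_def)
    finally show "card (S M a) \<le> 3" .
    \<comment> \<open>The slot in which M and M - {a} differ in favour of M can only be a head slot
      containing a itself.\<close>
    have "\<not> viol M M (J M a)" using M J(1)[OF M] by (auto simp: pass_def stable_def)
    then obtain p where p: "p \<in> P M a" "\<not> slot_ok M M p" unfolding viol_iff by blast
    then have Kp: "K p = 1" "X p = a" using ok[OF M p(1)] by (auto simp: slot_ok_def)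
    then have "X p \<in> S M a" unfolding S_def using p(1) by (intro imageI) simp
    then show "a \<in> S M a" using Kp by simp
  qed
  have crit: "a \<in> M'" if M: "M \<in> ?F" "a \<in> M" and M': "M' \<in> ?F"
    and e: "M' \<inter> (S M a - {a}) = M \<inter> (S M a - {a})" for M M' a
  proof (rule ccontr)
    assume a: "a \<notin> M'"
    \<comment> \<open>Without a, the set M' would agree with M - {a} on all atoms of the rule, keep
      the rule in its own reduct and violate it, contradicting that M' is a model.\<close>
    have iff: "X p \<in> M' \<longleftrightarrow> X p \<in> M" if "p \<in> P M a" "K p \<noteq> 0" "X p \<noteq> a" for p
      using e that by (auto simp: S_def)
    have "slot_ok M' M' p" if p: "p \<in> P M a" for p
    proof (cases "X p = a")
      case True
      then show ?thesis using ok[OF M p] a M(2) by (auto simp: slot_ok_def)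
    next
      case False
      then show ?thesis using ok[OF M p] iff[OF p _ False] by (auto simp: slot_ok_def)
    qed
    then have "viol M' M' (J M a)" unfolding viol_iff by blast
    then show False using M' J(1)[OF M] by (auto simp: pass_def stable_def)
  qed
  have "(\<Sum>M\<in>?F. ?p powr (2 / 3 * card M) * (1 - ?p) ^ (card {..<n} - card M)) \<le> 1"
  proof (rule ppz_count[where S = S])
    show "?F \<subseteq> Pow {..<n}" by blast
    show "a \<in> M'" if "M \<in> ?F" "M' \<in> ?F" "a \<in> M" "M' \<inter> (S M a - {a}) = M \<inter> (S M a - {a})" for M M' a
      using crit[OF that(1,3,2,4)] .
    show "S M a \<subseteq> {..<n} \<and> a \<in> S M a \<and> card (S M a) \<le> 3" if "M \<in> ?F" "a \<in> M" for M a
      using SP[OF that] .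
  qed simp_all
  then have ppz: "(\<Sum>M\<in>?F. ?p powr (2 / 3 * card M) * (40 / 91) ^ (n - card M)) \<le> 1" by simp
  have pw: "(x powr e) ^ m = x powr (e * real m)" if "0 < x" for x e :: real and m
    using that by (simp add: powr_realpow[symmetric] powr_powr)
  \<comment> \<open>The condition that fixes p: cubing removes the fractional exponent. It gives
    p^(2/3) / (1 - p) \<ge> 1.543, so dividing the coding weights by (1 - p)^n leaves at least
    1.543^k.\<close>
  have base: "1.543 * (40 / 91) \<le> ?p powr (2 / 3)"
  proof (rule power_le_imp_le_base)
    have "(?p powr (2 / 3)) ^ 3 = ?p powr 2" using pw[of ?p "2 / 3" 3] by simp
    also have "\<dots> = ?p ^ 2" by (rule powr_numeral) simp
    finally show "(1.543 * (40 / 91)) ^ Suc 2 \<le> (?p powr (2 / 3)) ^ Suc 2" by (simp add: eval_nat_numeral)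
  qed simp
  have summand: "1.543 ^ card M * (40 / 91) ^ n \<le> ?p powr (2 / 3 * card M) * (40 / 91 :: real) ^ (n - card M)"
    if "M \<in> ?F" for M
  proof -
    have c: "card M \<le> n" using that card_mono[of "{..<n}" M] by simp
    have "1.543 ^ card M * (40 / 91 :: real) ^ n = (1.543 * (40 / 91)) ^ card M * (40 / 91) ^ (n - card M)"
      using c by (simp only: power_mult_distrib mult.assoc power_add[symmetric] le_add_diff_inverse)
    also have "\<dots> \<le> (?p powr (2 / 3)) ^ card M * (40 / 91) ^ (n - card M)"
      by (intro mult_right_mono power_mono base) simp_all
    also have "(?p powr (2 / 3)) ^ card M = ?p powr (2 / 3 * card M)" by (rule pw) simp
    finally show ?thesis .
  qed
  have "(\<Sum>M\<in>?F. 1.543 ^ card M) * (40 / 91 :: real) ^ n = (\<Sum>M\<in>?F. 1.543 ^ card M * (40 / 91) ^ n)"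
    by (rule sum_distrib_right)
  also have "\<dots> \<le> (\<Sum>M\<in>?F. ?p powr (2 / 3 * card M) * (40 / 91) ^ (n - card M))" by (rule sum_mono) (rule summand)
  also note ppz
  finally have "(\<Sum>M\<in>?F. 1.543 ^ card M) \<le> 1 / (40 / 91 :: real) ^ n" by (simp add: le_divide_eq)
  also have "\<dots> = (91 / 40) ^ n" by (simp add: power_divide)
  finally show ?thesis .
qed

text \<open>A block of eight atoms costs 2^5 = 32 when shrinking and 3^3 = 27 when growing, both
  below 1.543^8 = 32.13. Up to seven remaining atoms add the factor 2^7 = 128 to the shrinking
  search only.\<close>

lemma work_le: "real (work M) \<le> 129 * 1.543 ^ card M" if "pass M"
proof -
  let ?q = "card M div 8" and ?e = "card M mod 8"
  have k: "card M = 8 * ?q + ?e" by simp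
  have e: "?e \<le> 7" by simp
  have "rD M = 5 * ?q + ?e" unfolding rD_def rN_def using k by linarith
  then have "(2::real) ^ rD M = (2 ^ 5) ^ ?q * 2 ^ ?e" by (simp only: power_add power_mult)
  also have "\<dots> \<le> (1.543 ^ 8) ^ ?q * 128"
  proof (intro mult_mono power_mono)
    have "(2::real) ^ ?e \<le> 2 ^ 7" using e by (intro power_increasing) auto
    then show "(2::real) ^ ?e \<le> 128" by simp
  qed (simp_all add: power_divide)
  also have "\<dots> = 128 * 1.543 ^ (8 * ?q)" by (simp only: power_mult mult.commute)
  also have "\<dots> \<le> 128 * 1.543 ^ card M" by (intro mult_left_mono power_increasing) auto
  finally have d: "(2::real) ^ rD M \<le> 128 * 1.543 ^ card M" .
  have "(3::real) ^ rN M = (3 ^ 3) ^ ?q" by (simp only: rN_def power_mult)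
  also have "\<dots> \<le> (1.543 ^ 8) ^ ?q" by (intro power_mono) (simp_all add: power_divide)
  also have "\<dots> = 1.543 ^ (8 * ?q)" by (simp only: power_mult)
  also have "\<dots> \<le> 1.543 ^ card M" by (intro power_increasing) auto
  finally show ?thesis using d that by (simp add: work_def)
qed

theorem sum_work_le:
  assumes idx: "\<And>p. p < 3 * R \<Longrightarrow> K p \<noteq> 0 \<Longrightarrow> X p < n"
  shows "real (\<Sum>v<2 ^ n. 1 + work (Mset v)) \<le> 130 * (91 / 40) ^ n"
proof -
  have "(\<Sum>v<2 ^ n. work (Mset v)) = (\<Sum>M\<in>Pow {..<n}. work M)"
    by (rule sum.reindex_bij_betw[OF bij_Mset])
  also have "\<dots> = (\<Sum>M\<in>{M. M \<subseteq> {..<n} \<and> pass M}. work M)"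
    by (rule sum.mono_neutral_right) (auto simp: work_def)
  finally have "real (\<Sum>v<2 ^ n. work (Mset v)) = (\<Sum>M\<in>{M. M \<subseteq> {..<n} \<and> pass M}. real (work M))" by simp
  also have "\<dots> \<le> (\<Sum>M\<in>{M. M \<subseteq> {..<n} \<and> pass M}. 129 * 1.543 ^ card M)"
    by (intro sum_mono) (use work_le in blast)
  also have "\<dots> \<le> 129 * (91 / 40) ^ n"
    unfolding sum_distrib_left[symmetric] by (intro mult_left_mono sum_pass_le[OF idx]) auto
  finally have "real (\<Sum>v<2 ^ n. work (Mset v)) \<le> 129 * (91 / 40) ^ n" .
  moreover have "(2::real) ^ n \<le> (91 / 40) ^ n" by (intro power_mono) auto
  ultimately show ?thesis by (simp add: sum.distrib)
qed

end

section \<open>Parsing\<close>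

text \<open>The parsing loops follow the encoded lists, so they are verified by list induction, one
  round at a time, instead of by an invariant.\<close>

lemma wp_Whl_unfold:
  "wp (Whl e c) Q s \<longleftrightarrow> (if eval e s = 0 then Q (cost e + 2) s
     else wp c (\<lambda>t. wp (Whl e c) (\<lambda>u. Q (cost e + t + u + 3))) s)"
proof -
  have "big (Whl e c) s t s'' \<longleftrightarrow> (if eval e s = 0 then t = cost e + 2 \<and> s'' = s
      else \<exists>u w s'. t = cost e + u + w + 3 \<and> big c s u s' \<and> big (Whl e c) s' w s'')" for t s''
    by (subst big.simps) auto
  then show ?thesis unfolding wp_def by (simp split: if_splits) blast
qed

lemma wp_Asg_abs: "wp (Asg x e) Q = (\<lambda>s. Q (cost e + 2) (s\<lparr>vv := (vv s)(x := eval e s)\<rparr>))"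
  by (rule ext) simp

text \<open>Atoms of the input are arbitrary numbers, whereas the search needs indices below n, so
  atoms are numbered by first occurrence. Linear search costs O(n) per occurrence, O(m n) in
  total.\<close>

definition ENTRY :: com where
  "ENTRY = Seq (Asg Vi (Num 0)) (Seq
     (Whl (And (Lt (Var Vi) (Var Vn)) (Neg' (Eq (Ld NAME (Var Vi)) (Var Vname)))) (Asg Vi (Inc (Var Vi)))) (Seq
     (If (Lt (Var Vi) (Var Vn)) Skip (Seq (St NAME (Var Vn) (Var Vname)) (Asg Vn (Inc (Var Vn))))) (Seq
     (St KIND (Var Vp) (Var Vkind)) (Seq
     (St IDX (Var Vp) (Var Vi))
     (Asg Vp (Inc (Var Vp)))))))"

definition names :: "st \<Rightarrow> nat list \<Rightarrow> bool" where
  "names s nm \<longleftrightarrow> vv s Vn = length nm \<and> (\<forall>i<length nm. aa s NAME i = nm ! i)"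

definition intern :: "nat list \<Rightarrow> nat \<Rightarrow> nat list" where
  "intern nm a = (if a \<in> set nm then nm else nm @ [a])"

lemma ENTRY_correct:
  assumes nm: "names s nm"
  shows "wp ENTRY (\<lambda>t s'. names s' (intern nm (vv s Vname)) \<and> vv s' Vp = Suc (vv s Vp) \<and>
    aa s' KIND = (aa s KIND)(vv s Vp := vv s Vkind) \<and>
    (\<exists>i<length (intern nm (vv s Vname)). intern nm (vv s Vname) ! i = vv s Vname \<and> aa s' IDX = (aa s IDX)(vv s Vp := i)) \<and>
    t \<le> 80 * (length nm + 2)) s"
proof -
  let ?e = "And (Lt (Var Vi) (Var Vn)) (Neg' (Eq (Ld NAME (Var Vi)) (Var Vname)))"
  let ?a = "vv s Vname"
  let ?I = "\<lambda>s'. names s' nm \<and> vv s' Vname = ?a \<and> vv s' Vp = vv s Vp \<and> vv s' Vkind = vv s Vkind \<and>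
    aa s' = aa s \<and> vv s' Vi \<le> length nm \<and> (\<forall>i<vv s' Vi. nm ! i \<noteq> ?a)"
  have loop: "wp (Whl ?e (Asg Vi (Inc (Var Vi)))) (\<lambda>t s'. ?I s' \<and> eval ?e s' = 0 \<and> t \<le> (length nm - vv s1 Vi) * 80 + cost ?e + 2) s1"
    if "?I s1" for s1
  proof (rule wp_Whl[where \<Phi> = "\<lambda>s'. (length nm - vv s' Vi) * 80"])
    fix s2 assume I: "?I s2" and c: "eval ?e s2 \<noteq> 0"
    have vn: "vv s2 Vn = length nm" using I by (simp add: names_def)
    have i: "vv s2 Vi < length nm" "nm ! vv s2 Vi \<noteq> ?a" using c vn I by (auto simp: names_def split: if_splits)
    note dec = diff_mult_step[OF i(1), of 80]
    show "wp (Asg Vi (Inc (Var Vi))) (\<lambda>t s'. ?I s' \<and> t + cost ?e + 3 + (length nm - vv s' Vi) * 80 \<le> (length nm - vv s2 Vi) * 80) s2"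
      using I i by (auto simp: dec names_def less_Suc_eq)
  qed (rule that)
  show ?thesis unfolding ENTRY_def wp_Seq[of "Asg Vi (Num 0)"] wp_Asg[of Vi "Num 0"] wp_Seq[of "Whl _ _"]
  proof (rule wp_mono[OF loop])
    show "?I (s\<lparr>vv := (vv s)(Vi := eval (Num 0) s)\<rparr>)" using nm by (simp add: names_def)
  next
    fix t :: nat and s' :: st
    assume A: "?I s' \<and> eval ?e s' = 0 \<and> t \<le> (length nm - vv (s\<lparr>vv := (vv s)(Vi := eval (Num 0) s)\<rparr>) Vi) * 80 + cost ?e + 2"
    let ?i = "vv s' Vi"
    have vn: "vv s' Vn = length nm" using A by (simp add: names_def)
    have t: "t \<le> length nm * 80 + 50" using A by simp
    show "wp (Seq (If (Lt (Var Vi) (Var Vn)) Skip (Seq (St NAME (Var Vn) (Var Vname)) (Asg Vn (Inc (Var Vn))))) (Seq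
     (St KIND (Var Vp) (Var Vkind)) (Seq (St IDX (Var Vp) (Var Vi)) (Asg Vp (Inc (Var Vp))))))
      (\<lambda>u s'. names s' (intern nm ?a) \<and> vv s' Vp = Suc (vv s Vp) \<and>
        aa s' KIND = (aa s KIND)(vv s Vp := vv s Vkind) \<and>
        (\<exists>i<length (intern nm ?a). intern nm ?a ! i = ?a \<and> aa s' IDX = (aa s IDX)(vv s Vp := i)) \<and>
        cost (Num 0) + 2 + (t + u) \<le> 80 * (length nm + 2)) s'"
    proof (cases "?i < length nm")
      case True
      then have "nm ! ?i = ?a" using A vn by (auto simp: names_def)
      then have "intern nm ?a = nm" using nth_mem[OF True] by (simp add: intern_def)
      then show ?thesis using A True \<open>nm ! ?i = ?a\<close> vn t by (auto simp: names_def)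
    next
      case False
      then have i: "?i = length nm" using A by simp
      then have "?a \<notin> set nm" using A by (auto simp: in_set_conv_nth)
      then have "intern nm ?a = nm @ [?a]" by (simp add: intern_def)
      then show ?thesis using A i vn t by (auto simp: names_def nth_append)
    qed
  qed
qed

type_synonym grule = "(nat \<times> nat) list"

text \<open>All j are included, even beyond the last rule: untouched slots have kind 0. Hence short
  rules are padded automatically and opening a new rule costs nothing.\<close>

definition layout :: "(nat \<Rightarrow> nat) \<Rightarrow> (nat \<Rightarrow> nat) \<Rightarrow> nat list \<Rightarrow> grule list \<Rightarrow> bool" where
  "layout K X nm Ls \<longleftrightarrow> (\<forall>j r. r < 3 \<longrightarrow>
     (if j < length Ls \<and> r < length (Ls ! j)
      then K (3 * j + r) = fst (Ls ! j ! r) \<and> X (3 * j + r) < length nm \<and> nm ! X (3 * j + r) = snd (Ls ! j ! r)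
      else K (3 * j + r) = 0))"

lemma layout_new: "layout K X nm Ls \<Longrightarrow> layout K X nm (Ls @ [[]])"
  by (auto simp: layout_def nth_append)

lemma layout_add:
  assumes l: "layout K X nm (Ls @ [L])" "length L < 3" and nm': "nm' = nm @ ext" "i < length nm'" "nm' ! i = snd e"
  shows "layout (K(3 * length Ls + length L := fst e)) (X(3 * length Ls + length L := i)) nm' (Ls @ [L @ [e]])"
  unfolding layout_def
proof (intro allI impI)
  fix j r :: nat assume r: "r < 3"
  let ?p = "3 * length Ls + length L"
  have eq: "3 * j + r = ?p \<longleftrightarrow> j = length Ls \<and> r = length L" using r l(2) by presburger
  have old: "if j < length (Ls @ [L]) \<and> r < length ((Ls @ [L]) ! j)
      then K (3 * j + r) = fst ((Ls @ [L]) ! j ! r) \<and> X (3 * j + r) < length nm \<and> nm ! X (3 * j + r) = snd ((Ls @ [L]) ! j ! r)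
      else K (3 * j + r) = 0" using l(1) r unfolding layout_def by blast
  show "if j < length (Ls @ [L @ [e]]) \<and> r < length ((Ls @ [L @ [e]]) ! j)
      then (K(?p := fst e)) (3 * j + r) = fst ((Ls @ [L @ [e]]) ! j ! r) \<and>
           (X(?p := i)) (3 * j + r) < length nm' \<and> nm' ! (X(?p := i)) (3 * j + r) = snd ((Ls @ [L @ [e]]) ! j ! r)
      else (K(?p := fst e)) (3 * j + r) = 0"
  proof (cases "3 * j + r = ?p")
    case True
    then have "j = length Ls" "r = length L" using eq by auto
    then show ?thesis using nm' by (simp add: nth_append)
  next
    case False
    consider "j < length Ls" | "j = length Ls" "r < length L" | "j = length Ls" "length L < r" | "length Ls < j"
      using False eq by linarith
    then show ?thesis using old False nm'(1) by cases (auto simp: nth_append split: if_splits)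
  qed
qed

definition PS :: "st \<Rightarrow> nat list \<Rightarrow> grule list \<Rightarrow> bool" where
  "PS s nm Ls \<longleftrightarrow> names s nm \<and> layout (aa s KIND) (aa s IDX) nm Ls \<and> distinct nm \<and>
     set nm = (\<Union>L\<in>set Ls. snd ` set L)"

lemma PS_ENTRY:
  assumes "PS s nm (Ls @ [L])" "length L < 3" "vv s Vp = 3 * length Ls + length L"
  shows "wp ENTRY (\<lambda>t s'. \<exists>nm'. PS s' nm' (Ls @ [L @ [(vv s Vkind, vv s Vname)]]) \<and>
    vv s' Vp = 3 * length Ls + Suc (length L) \<and> t \<le> 80 * (length nm + 2)) s"
proof -
  let ?a = "vv s Vname"
  have n: "names s nm" using assms by (simp add: PS_def)
  show ?thesis
  proof (rule wp_mono[OF ENTRY_correct[OF n]])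
    fix t :: nat and s' :: st
    assume A: "names s' (intern nm ?a) \<and> vv s' Vp = Suc (vv s Vp) \<and>
      aa s' KIND = (aa s KIND)(vv s Vp := vv s Vkind) \<and>
      (\<exists>i<length (intern nm ?a). intern nm ?a ! i = ?a \<and> aa s' IDX = (aa s IDX)(vv s Vp := i)) \<and> t \<le> 80 * (length nm + 2)"
    then obtain i where i: "i < length (intern nm ?a)" "intern nm ?a ! i = ?a" "aa s' IDX = (aa s IDX)(vv s Vp := i)" by blast
    obtain ext where ext: "intern nm ?a = nm @ ext" by (cases "?a \<in> set nm") (auto simp: intern_def)
    have lay: "layout (aa s KIND) (aa s IDX) nm (Ls @ [L])" using assms(1) by (simp add: PS_def)
    have "layout (aa s' KIND) (aa s' IDX) (intern nm ?a) (Ls @ [L @ [(vv s Vkind, ?a)]])"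
      using layout_add[OF lay assms(2) ext i(1), of "(vv s Vkind, ?a)"] i A assms(3) by simp
    moreover have "distinct (intern nm ?a)" "set (intern nm ?a) = insert ?a (set nm)"
      using assms(1) by (auto simp: PS_def intern_def)
    moreover have "(\<Union>L'\<in>set (Ls @ [L @ [(vv s Vkind, ?a)]]). snd ` set L') = insert ?a (\<Union>L\<in>set (Ls @ [L]). snd ` set L)"
      by auto
    ultimately have "PS s' (intern nm ?a) (Ls @ [L @ [(vv s Vkind, ?a)]])"
      using A assms(1) by (simp add: PS_def)
    then show "\<exists>nm'. PS s' nm' (Ls @ [L @ [(vv s Vkind, ?a)]]) \<and> vv s' Vp = 3 * length Ls + Suc (length L) \<and>
      t \<le> 80 * (length nm + 2)" using A assms(3) by auto
  qed
qed

section \<open>Reading rules independently of the input format\<close>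

definition inp :: "st \<Rightarrow> nat list \<Rightarrow> bool" where
  "inp s xs \<longleftrightarrow> (\<forall>i<length xs. aa s INP (vv s Vpos + i) = xs ! i)"

lemma inp_Cons [simp]: "inp s (x # xs) \<longleftrightarrow> aa s INP (vv s Vpos) = x \<and> (\<forall>i<length xs. aa s INP (Suc (vv s Vpos + i)) = xs ! i)"
  by (auto simp: inp_def less_Suc_eq_0_disj all_conj_distrib)

text \<open>
  \<open>Q\<close> restricts the admissible entries in terms of the kind kept in \<open>Vk\<close>: in a program the kind of an
  atom is given by the block it occurs in, in a clause by its sign.
\<close>

definition reader :: "com \<Rightarrow> (nat \<Rightarrow> nat \<times> nat \<Rightarrow> bool) \<Rightarrow> (nat \<times> nat \<Rightarrow> nat list) \<Rightarrow> bool" where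
  "reader c Q enc \<longleftrightarrow> modv c \<subseteq> {Vkind, Vname, Vpos} \<and> moda c = {} \<and>
     (\<forall>s e xs. Q (vv s Vk) e \<longrightarrow> inp s (enc e @ xs) \<longrightarrow>
        wp c (\<lambda>t s'. vv s' Vkind = fst e \<and> vv s' Vname = snd e \<and> inp s' xs \<and> t \<le> 100) s)"

definition INNER :: "com \<Rightarrow> com" where
  "INNER c = Whl (Var Vlen) (Seq c (Seq ENTRY (Asg Vlen (Dif (Var Vlen) (Num 1)))))"

lemma PS_cong: "PS s nm Ls \<Longrightarrow> vv s' Vn = vv s Vn \<Longrightarrow> aa s' NAME = aa s NAME \<Longrightarrow> aa s' KIND = aa s KIND \<Longrightarrow>
  aa s' IDX = aa s IDX \<Longrightarrow> PS s' nm Ls"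
  by (simp add: PS_def names_def)

lemma PS_length: "PS s nm Ls \<Longrightarrow> (\<Union>L\<in>set Ls. snd ` set L) \<subseteq> U \<Longrightarrow> finite U \<Longrightarrow> length nm \<le> card U"
  unfolding PS_def by (metis card_mono distinct_card)

lemma INNER_correct:
  assumes c: "reader c Q enc" and U: "finite U"
    and "PS s nm (Ls @ [L])" "vv s Vlen = length es" "vv s Vp = 3 * length Ls + length L"
    "inp s (concat (map enc es) @ xs)" "length L + length es \<le> 3" "\<forall>e\<in>set es. Q (vv s Vk) e"
    "(\<Union>L\<in>set (Ls @ [L @ es]). snd ` set L) \<subseteq> U"
  shows "wp (INNER c) (\<lambda>t s'. \<exists>nm'. PS s' nm' (Ls @ [L @ es]) \<and> vv s' Vp = 3 * length Ls + length L + length es \<and>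
    inp s' xs \<and> t \<le> 300 * (card U + 1) * length es + 4) s"
  using assms(3-)
proof (induction es arbitrary: s nm L)
  case Nil
  then show ?case unfolding INNER_def by (subst wp_Whl_unfold) auto
next
  case (Cons e es)
  let ?body = "Seq c (Seq ENTRY (Asg Vlen (Dif (Var Vlen) (Num 1))))"
  have len: "length L < 3" using Cons.prems(5) by simp
  have rd: "wp c (\<lambda>t s'. vv s' Vkind = fst e \<and> vv s' Vname = snd e \<and> inp s' (concat (map enc es) @ xs) \<and> t \<le> 100) s"
    using c Cons.prems(4,6) by (simp add: reader_def)
  have mc: "modv c \<subseteq> {Vkind, Vname, Vpos}" "moda c = {}" using c by (auto simp: reader_def)
  have nmU: "length nm \<le> card U" using PS_length[OF Cons.prems(1) _ U] Cons.prems(7) by auto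
  let ?T = "\<lambda>t s'. \<exists>nm'. PS s' nm' (Ls @ [L @ e # es]) \<and> vv s' Vp = 3 * length Ls + length L + length (e # es) \<and>
    inp s' xs \<and> t \<le> 300 * (card U + 1) * length (e # es) + 4"
  have "wp ?body (\<lambda>t. wp (INNER c) (\<lambda>u. ?T (cost (Var Vlen) + t + u + 3))) s"
    unfolding wp_Seq
  proof (rule wp_use[OF rd])
    fix t1 :: nat and s2 :: st
    assume A: "vv s2 Vkind = fst e \<and> vv s2 Vname = snd e \<and> inp s2 (concat (map enc es) @ xs) \<and> t1 \<le> 100"
      and sb: "same_but c s s2"
    have same: "vv s2 x = vv s x" if "x \<notin> {Vkind, Vname, Vpos}" for x using sb mc that unfolding same_but_def by blast
    have samea: "aa s2 = aa s" using sb mc by (auto simp: same_but_def)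
    have ps2: "PS s2 nm (Ls @ [L])" using PS_cong[OF Cons.prems(1)] same samea by simp
    have vp2: "vv s2 Vp = 3 * length Ls + length L" using same Cons.prems(3) by simp
    have pair: "(vv s2 Vkind, vv s2 Vname) = e" using A by simp
    show "wp ENTRY (\<lambda>t. wp (Asg Vlen (Dif (Var Vlen) (Num 1))) (\<lambda>u. wp (INNER c) (\<lambda>w. ?T (cost (Var Vlen) + (t1 + (t + u)) + w + 3)))) s2"
    proof (rule wp_use[OF PS_ENTRY[OF ps2 len vp2, unfolded pair]])
      fix t2 :: nat and s3 :: st
      assume B: "\<exists>nm'. PS s3 nm' (Ls @ [L @ [e]]) \<and> vv s3 Vp = 3 * length Ls + Suc (length L) \<and> t2 \<le> 80 * (length nm + 2)"
        and sb3: "same_but ENTRY s2 s3"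
      from B obtain nm3 where nm3: "PS s3 nm3 (Ls @ [L @ [e]])" "vv s3 Vp = 3 * length Ls + Suc (length L)" "t2 \<le> 80 * (length nm + 2)" by blast
      have s3: "vv s3 Vlen = Suc (length es)" "vv s3 Vk = vv s Vk" "vv s3 Vpos = vv s2 Vpos" "aa s3 INP = aa s2 INP"
        using sb3 same Cons.prems(2) by (simp_all add: same_but_def ENTRY_def)
      define s4 where "s4 = s3\<lparr>vv := (vv s3)(Vlen := eval (Dif (Var Vlen) (Num 1)) s3)\<rparr>"
      have ps4: "PS s4 nm3 (Ls @ [L @ [e]])" using PS_cong[OF nm3(1)] by (simp add: s4_def)
      have s4: "vv s4 Vlen = length es" "vv s4 Vp = 3 * length Ls + length (L @ [e])" "vv s4 Vk = vv s Vk"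
        "inp s4 (concat (map enc es) @ xs)"
        using s3 nm3 A by (simp_all add: s4_def inp_def)
      have IH: "wp (INNER c) (\<lambda>t s'. \<exists>nm'. PS s' nm' (Ls @ [(L @ [e]) @ es]) \<and>
        vv s' Vp = 3 * length Ls + length (L @ [e]) + length es \<and> inp s' xs \<and> t \<le> 300 * (card U + 1) * length es + 4) s4"
        by (rule Cons.IH[OF ps4 s4(1,2,4)]) (use Cons.prems s4(3) in auto)
      have "wp (INNER c) (\<lambda>w. ?T (cost (Var Vlen) + (t1 + (t2 + (cost (Dif (Var Vlen) (Num 1)) + 2))) + w + 3)) s4"
      proof (rule wp_mono[OF IH])
        fix w :: nat and s5 :: st
        assume C: "\<exists>nm'. PS s5 nm' (Ls @ [(L @ [e]) @ es]) \<and>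
        vv s5 Vp = 3 * length Ls + length (L @ [e]) + length es \<and> inp s5 xs \<and> w \<le> 300 * (card U + 1) * length es + 4"
        have "t2 \<le> 80 * (card U + 2)" using nm3(3) nmU by simp
        then have "cost (Var Vlen) + (t1 + (t2 + (cost (Dif (Var Vlen) (Num 1)) + 2))) + 3 \<le> 300 * (card U + 1)"
          using A by simp
        then show "?T (cost (Var Vlen) + (t1 + (t2 + (cost (Dif (Var Vlen) (Num 1)) + 2))) + w + 3) s5"
          using C by auto
      qed
      then show "wp (Asg Vlen (Dif (Var Vlen) (Num 1))) (\<lambda>u. wp (INNER c) (\<lambda>w. ?T (cost (Var Vlen) + (t1 + (t2 + u)) + w + 3))) s3"
        unfolding wp_Asg s4_def .
    qed
  qed
  then show ?case using Cons.prems(2) unfolding INNER_def by (subst wp_Whl_unfold) simp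
qed


definition BLK :: "nat \<Rightarrow> com \<Rightarrow> com" where
  "BLK k c = Seq (Asg Vk (Num k)) (Seq (Asg Vlen (Ld INP (Var Vpos))) (Seq (Asg Vpos (Inc (Var Vpos))) (INNER c)))"

lemma BLK_correct:
  assumes c: "reader c Q enc" and U: "finite U"
    and s: "PS s nm (Ls @ [L])" "vv s Vp = 3 * length Ls + length L"
    "inp s (length es # concat (map enc es) @ xs)" "length L + length es \<le> 3" "\<forall>e\<in>set es. Q k e"
    "(\<Union>L\<in>set (Ls @ [L @ es]). snd ` set L) \<subseteq> U"
  shows "wp (BLK k c) (\<lambda>t s'. \<exists>nm'. PS s' nm' (Ls @ [L @ es]) \<and> vv s' Vp = 3 * length Ls + length L + length es \<and>
    inp s' xs \<and> t \<le> 300 * (card U + 1) * length es + 40) s"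
proof -
  define s1 where "s1 = s\<lparr>vv := (vv s)(Vk := k, Vlen := length es, Vpos := Suc (vv s Vpos))\<rparr>"
  have 1: "PS s1 nm (Ls @ [L])" using PS_cong[OF s(1)] by (simp add: s1_def)
  have s3: "aa s INP (vv s Vpos) = length es"
    "\<forall>i<length (concat (map enc es) @ xs). aa s INP (Suc (vv s Vpos + i)) = (concat (map enc es) @ xs) ! i"
    using s(3) unfolding inp_Cons by blast+
  then have 2: "inp s1 (concat (map enc es) @ xs)" by (simp add: s1_def inp_def)
  have W: "wp (INNER c) (\<lambda>t s'. \<exists>nm'. PS s' nm' (Ls @ [L @ es]) \<and> vv s' Vp = 3 * length Ls + length L + length es \<and>
    inp s' xs \<and> t \<le> 300 * (card U + 1) * length es + 4) s1"
    by (rule INNER_correct[OF c U 1 _ _ 2]) (use s in \<open>auto simp: s1_def\<close>)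
  have "wp (INNER c) (\<lambda>t s'. \<exists>nm'. PS s' nm' (Ls @ [L @ es]) \<and> vv s' Vp = 3 * length Ls + length L + length es \<and>
    inp s' xs \<and> 3 + (10 + (6 + t)) \<le> 300 * (card U + 1) * length es + 40) s1"
    by (rule wp_mono[OF W]) auto
  then show ?thesis using s3(1) by (simp add: BLK_def s1_def)
qed

text \<open>The interface behind which the two input formats are hidden. A rule parser must respect
  the loop variables, the input and the arrays of the search. The set U of all atoms bounds the name
  table throughout the run.\<close>

definition rparser :: "com \<Rightarrow> (grule \<Rightarrow> bool) \<Rightarrow> (grule \<Rightarrow> nat list) \<Rightarrow> bool" where
  "rparser c ok enc \<longleftrightarrow> modv c \<inter> {Vrules, Vbase} = {} \<and> moda c \<subseteq> {NAME, KIND, IDX} \<and> nowr c \<and>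
     (\<forall>s nm Ls L xs U. finite U \<longrightarrow> PS s nm (Ls @ [[]]) \<longrightarrow> vv s Vp = 3 * length Ls \<longrightarrow> inp s (enc L @ xs) \<longrightarrow> ok L \<longrightarrow>
        (\<Union>L\<in>set (Ls @ [L]). snd ` set L) \<subseteq> U \<longrightarrow>
        wp c (\<lambda>t s'. \<exists>nm'. PS s' nm' (Ls @ [L]) \<and> inp s' xs \<and> t \<le> 300 * (card U + 1) * length L + 140) s)"

text \<open>Resetting \<open>Vp\<close> to \<open>Vbase\<close> skips the free slots of a rule with
  fewer than three entries.\<close>

definition LOOP :: "com \<Rightarrow> com" where
  "LOOP c = Whl (Var Vrules) (Seq (Asg Vp (Var Vbase)) (Seq c (Seq (Asg Vbase (Inc (Inc (Inc (Var Vbase)))))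
     (Asg Vrules (Dif (Var Vrules) (Num 1))))))"

definition PARSE :: "com \<Rightarrow> com" where
  "PARSE c = Seq (Asg Vrules (Ld INP (Num 0))) (Seq (Asg Vpos (Num 1)) (Seq (Asg Vbase (Num 0))
     (Seq (LOOP c) (Asg Vend (Var Vbase)))))"

lemma LOOP_correct:
  assumes c: "rparser c ok enc" and U: "finite U"
    and "PS s nm Ls" "vv s Vbase = 3 * length Ls" "vv s Vrules = length Rs" "inp s (concat (map enc Rs))"
    "\<forall>L\<in>set Rs. ok L" "(\<Union>L\<in>set (Ls @ Rs). snd ` set L) \<subseteq> U"
  shows "wp (LOOP c) (\<lambda>t s'. \<exists>nm'. PS s' nm' (Ls @ Rs) \<and> vv s' Vbase = 3 * length (Ls @ Rs) \<and>
    t \<le> 300 * (card U + 1) * (\<Sum>L\<leftarrow>Rs. length L + 1) + 4) s"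
  using assms(3-)
proof (induction Rs arbitrary: s nm Ls)
  case Nil
  then show ?case unfolding LOOP_def by (subst wp_Whl_unfold) auto
next
  case (Cons L Rs)
  let ?rest = "Seq (Asg Vbase (Inc (Inc (Inc (Var Vbase))))) (Asg Vrules (Dif (Var Vrules) (Num 1)))"
  let ?T = "\<lambda>t s'. \<exists>nm'. PS s' nm' (Ls @ L # Rs) \<and> vv s' Vbase = 3 * length (Ls @ L # Rs) \<and>
    t \<le> 300 * (card U + 1) * (\<Sum>L\<leftarrow>L # Rs. length L + 1) + 4"
  define s1 where "s1 = s\<lparr>vv := (vv s)(Vp := eval (Var Vbase) s)\<rparr>"
  have ps1: "PS s1 nm (Ls @ [[]])"
  proof -
    have "PS s nm (Ls @ [[]])" using Cons.prems(1) layout_new by (auto simp: PS_def)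
    then show ?thesis by (rule PS_cong) (simp_all add: s1_def)
  qed
  have W: "wp c (\<lambda>t s'. \<exists>nm'. PS s' nm' (Ls @ [L]) \<and> inp s' (concat (map enc Rs)) \<and> t \<le> 300 * (card U + 1) * length L + 140) s1"
  proof -
    have "vv s1 Vp = 3 * length Ls" "inp s1 (enc L @ concat (map enc Rs))" "ok L" "(\<Union>L\<in>set (Ls @ [L]). snd ` set L) \<subseteq> U"
      using Cons.prems by (auto simp: s1_def inp_def)
    then show ?thesis using c U ps1 unfolding rparser_def by blast
  qed
  have mc: "modv c \<inter> {Vrules, Vbase} = {}" using c by (simp add: rparser_def)
  have "wp c (\<lambda>t. wp ?rest (\<lambda>u. wp (LOOP c) (\<lambda>w. ?T (cost (Var Vrules) + (cost (Var Vbase) + 2 + (t + u)) + w + 3)))) s1"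
  proof (rule wp_use[OF W])
    fix t1 :: nat and s2 :: st
    assume A: "\<exists>nm'. PS s2 nm' (Ls @ [L]) \<and> inp s2 (concat (map enc Rs)) \<and> t1 \<le> 300 * (card U + 1) * length L + 140"
      and sb: "same_but c s1 s2"
    then obtain nm2 where nm2: "PS s2 nm2 (Ls @ [L])" "inp s2 (concat (map enc Rs))" "t1 \<le> 300 * (card U + 1) * length L + 140" by blast
    have s2: "vv s2 Vbase = 3 * length Ls" "vv s2 Vrules = Suc (length Rs)"
      using sb mc Cons.prems by (auto simp: same_but_def s1_def)
    define s3 where "s3 = s2\<lparr>vv := (vv s2)(Vbase := Suc (Suc (Suc (vv s2 Vbase))), Vrules := length Rs)\<rparr>"
    have ps3: "PS s3 nm2 (Ls @ [L])" using PS_cong[OF nm2(1)] by (simp add: s3_def)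
    have s3: "vv s3 Vbase = 3 * length (Ls @ [L])" "vv s3 Vrules = length Rs" "inp s3 (concat (map enc Rs))"
      using s2 nm2 by (simp_all add: s3_def inp_def)
    have IH: "wp (LOOP c) (\<lambda>t s'. \<exists>nm'. PS s' nm' ((Ls @ [L]) @ Rs) \<and> vv s' Vbase = 3 * length ((Ls @ [L]) @ Rs) \<and>
      t \<le> 300 * (card U + 1) * (\<Sum>L\<leftarrow>Rs. length L + 1) + 4) s3"
      by (rule Cons.IH[OF ps3 s3]) (use Cons.prems in auto)
    have "wp (LOOP c) (\<lambda>w. ?T (4 + t1 + w + 30)) s3"
    proof (rule wp_mono[OF IH])
      fix w :: nat and s4 :: st
      assume B: "\<exists>nm'. PS s4 nm' ((Ls @ [L]) @ Rs) \<and> vv s4 Vbase = 3 * length ((Ls @ [L]) @ Rs) \<and>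
        w \<le> 300 * (card U + 1) * (\<Sum>L\<leftarrow>Rs. length L + 1) + 4"
      have "300 * (card U + 1) * (\<Sum>L\<leftarrow>L # Rs. length L + 1) =
         300 * (card U + 1) * length L + 300 * (card U + 1) + 300 * (card U + 1) * (\<Sum>L\<leftarrow>Rs. length L + 1)"
        by (simp add: algebra_simps)
      then have "4 + t1 + w + 30 \<le> 300 * (card U + 1) * (\<Sum>L\<leftarrow>L # Rs. length L + 1) + 4"
        using B nm2(3) by auto
      then show "?T (4 + t1 + w + 30) s4" using B by auto
    qed
    then have "wp (LOOP c) (\<lambda>w. ?T (cost (Var Vrules) + (cost (Var Vbase) + 2 + (t1 + (10 + 6))) + w + 3)) s3"
      by (rule wp_mono) auto
    then show "wp ?rest (\<lambda>u. wp (LOOP c) (\<lambda>w. ?T (cost (Var Vrules) + (cost (Var Vbase) + 2 + (t1 + u)) + w + 3))) s2"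
      using s2 by (simp add: s3_def)
  qed
  moreover have "(eval (Var Vrules) s = 0) = False" using Cons.prems(3) by simp
  ultimately show ?case unfolding s1_def LOOP_def
    by (subst wp_Whl_unfold) (simp only: if_False wp_Seq[of "Asg Vp _"] wp_Seq[of c] wp_Asg[of Vp])
qed

lemma PARSE_correct:
  assumes c: "rparser c ok enc" and ok: "\<forall>L\<in>set Rs. ok L"
    and x: "x = length Rs # concat (map enc Rs)"
  defines "U \<equiv> \<Union>L\<in>set Rs. snd ` set L"
  shows "wp (PARSE c) (\<lambda>t s'. \<exists>nm. PS s' nm Rs \<and> vv s' Vend = 3 * length Rs \<and>
    t \<le> 300 * (card U + 1) * (\<Sum>L\<leftarrow>Rs. length L + 1) + 40) (init_st x)"
proof -
  have U: "finite U" by (simp add: U_def)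
  define s1 where "s1 = (init_st x)\<lparr>vv := (vv (init_st x))(Vrules := length Rs, Vpos := 1, Vbase := 0)\<rparr>"
  have ps: "PS s1 [] []" by (simp add: PS_def names_def layout_def s1_def init_st_def)
  have inp: "inp s1 (concat (map enc Rs))" by (simp add: inp_def s1_def init_st_def x)
  have W: "wp (LOOP c) (\<lambda>t s'. \<exists>nm'. PS s' nm' ([] @ Rs) \<and> vv s' Vbase = 3 * length ([] @ Rs) \<and>
    t \<le> 300 * (card U + 1) * (\<Sum>L\<leftarrow>Rs. length L + 1) + 4) s1"
    by (rule LOOP_correct[OF c U ps _ _ inp]) (use ok in \<open>auto simp: s1_def U_def\<close>)
  have "wp (LOOP c) (\<lambda>t s'. \<exists>nm. PS (s'\<lparr>vv := (vv s')(Vend := vv s' Vbase)\<rparr>) nm Rs \<and> vv s' Vbase = 3 * length Rs \<and>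
    9 + (3 + (3 + (t + 4))) \<le> 300 * (card U + 1) * (\<Sum>L\<leftarrow>Rs. length L + 1) + 40) s1"
  proof (rule wp_mono[OF W])
    fix t :: nat and s' :: st
    assume A: "\<exists>nm'. PS s' nm' ([] @ Rs) \<and> vv s' Vbase = 3 * length ([] @ Rs) \<and>
      t \<le> 300 * (card U + 1) * (\<Sum>L\<leftarrow>Rs. length L + 1) + 4"
    then obtain nm where "PS s' nm Rs" by auto
    then have "PS (s'\<lparr>vv := (vv s')(Vend := vv s' Vbase)\<rparr>) nm Rs" by (rule PS_cong) simp_all
    then show "\<exists>nm. PS (s'\<lparr>vv := (vv s')(Vend := vv s' Vbase)\<rparr>) nm Rs \<and> vv s' Vbase = 3 * length Rs \<and>
      9 + (3 + (3 + (t + 4))) \<le> 300 * (card U + 1) * (\<Sum>L\<leftarrow>Rs. length L + 1) + 40" using A by auto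
  qed
  moreover have "aa (init_st x) INP 0 = length Rs" by (simp add: init_st_def x)
  ultimately show ?thesis by (simp add: PARSE_def s1_def wp_Asg_abs)
qed

section \<open>Minimal models and answer sets\<close>

text \<open>The counterpart of \<open>viol\<close> on atom names instead of slots and indices; A
  determines the reduct and B is the set tested. Theories and programs are both compared with this
  notion.\<close>

definition gviol :: "nat set \<Rightarrow> nat set \<Rightarrow> grule \<Rightarrow> bool" where
  "gviol A B L \<longleftrightarrow> (\<forall>(k, a)\<in>set L. (k = 1 \<longrightarrow> a \<notin> B) \<and> (k = 2 \<longrightarrow> a \<in> B) \<and> (k = 3 \<longrightarrow> a \<notin> A))"

definition gstable :: "grule list \<Rightarrow> nat set \<Rightarrow> nat set \<Rightarrow> bool" where
  "gstable Ls A B \<longleftrightarrow> (\<forall>L\<in>set Ls. \<not> gviol A B L)"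

definition gans :: "grule list \<Rightarrow> nat set set" where
  "gans Ls = {A. gstable Ls A A \<and> (\<forall>B. B \<subset> A \<longrightarrow> \<not> gstable Ls A B)}"

text \<open>Dropping an atom that occurs in no rule changes no satisfaction, so minimality excludes
  it. This justifies enumerating only subsets of the occurring atoms.\<close>

lemma gans_subset_atoms:
  assumes "A \<in> gans Ls"
  shows "A \<subseteq> (\<Union>L\<in>set Ls. snd ` set L)"
proof
  fix a assume a: "a \<in> A"
  show "a \<in> (\<Union>L\<in>set Ls. snd ` set L)"
  proof (rule ccontr)
    assume n: "a \<notin> (\<Union>L\<in>set Ls. snd ` set L)"
    have "gviol A (A - {a}) L \<longleftrightarrow> gviol A A L" if "L \<in> set Ls" for L
    proof -
      have "b \<noteq> a" if "(k, b) \<in> set L" for k b using n that \<open>L \<in> set Ls\<close> by force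
      then show ?thesis unfolding gviol_def by (intro ball_cong refl) auto
    qed
    then have "gstable Ls A (A - {a})" using assms by (auto simp: gans_def gstable_def)
    moreover have "A - {a} \<subset> A" using a by auto
    ultimately show False using assms by (auto simp: gans_def)
  qed
qed

context
  fixes K X :: "nat \<Rightarrow> nat" and nm :: "nat list" and Ls :: "grule list"
  assumes lay: "layout K X nm Ls" and dist: "distinct nm" and at: "set nm = (\<Union>L\<in>set Ls. snd ` set L)"
    and len3: "\<forall>L\<in>set Ls. length L \<le> 3"
begin

interpretation slots "length nm" "length Ls" K X .

lemma idx_less:
  assumes "p < 3 * length Ls" "K p \<noteq> 0"
  shows "X p < length nm"
proof -
  have p: "p = 3 * (p div 3) + p mod 3" "p mod 3 < 3" by simp_all
  with lay have "if p div 3 < length Ls \<and> p mod 3 < length (Ls ! (p div 3))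
      then K p = fst (Ls ! (p div 3) ! (p mod 3)) \<and> X p < length nm \<and> nm ! X p = snd (Ls ! (p div 3) ! (p mod 3))
      else K p = 0" unfolding layout_def by metis
  then show ?thesis using assms(2) by (auto split: if_splits)
qed

lemma nth_image_iff: "i < length nm \<Longrightarrow> M \<subseteq> {..<length nm} \<Longrightarrow> nm ! i \<in> (!) nm ` M \<longleftrightarrow> i \<in> M"
  using dist by (auto simp: nth_eq_iff_index_eq)

lemma viol_gviol:
  assumes MN: "M \<subseteq> {..<length nm}" "N \<subseteq> {..<length nm}" and j: "j < length Ls"
  shows "viol M N j \<longleftrightarrow> gviol ((!) nm ` M) ((!) nm ` N) (Ls ! j)"
proof -
  let ?L = "Ls ! j"
  let ?ok = "\<lambda>e. (fst e = 1 \<longrightarrow> snd e \<notin> (!) nm ` N) \<and> (fst e = 2 \<longrightarrow> snd e \<in> (!) nm ` N) \<and> (fst e = 3 \<longrightarrow> snd e \<notin> (!) nm ` M)"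
  have l3: "length ?L \<le> 3" using len3 j by simp
  have slot: "slot_ok M N (3 * j + r) \<longleftrightarrow> (r < length ?L \<longrightarrow> ?ok (?L ! r))" if r: "r < 3" for r
  proof (cases "r < length ?L")
    case True
    then have k: "K (3 * j + r) = fst (?L ! r)" "X (3 * j + r) < length nm" "nm ! X (3 * j + r) = snd (?L ! r)"
      using lay r j unfolding layout_def by (auto split: if_splits)
    have "X (3 * j + r) \<in> M \<longleftrightarrow> snd (?L ! r) \<in> (!) nm ` M" "X (3 * j + r) \<in> N \<longleftrightarrow> snd (?L ! r) \<in> (!) nm ` N"
      using nth_image_iff[OF k(2) MN(1)] nth_image_iff[OF k(2) MN(2)] k(3) by simp_all
    then show ?thesis using True k(1) by (simp add: slot_ok_def)
  next
    case False
    then have "K (3 * j + r) = 0" using lay r unfolding layout_def by (auto split: if_splits)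
    then show ?thesis using False by (simp add: slot_ok_def)
  qed
  have "viol M N j \<longleftrightarrow> (\<forall>r<3. slot_ok M N (3 * j + r))"
    by (auto simp: viol_def numeral_3_eq_3 less_Suc_eq)
  also have "\<dots> \<longleftrightarrow> (\<forall>r<length ?L. ?ok (?L ! r))" using slot l3 by (meson less_le_trans)
  also have "\<dots> \<longleftrightarrow> (\<forall>e\<in>set ?L. ?ok e)" by (simp add: all_set_conv_all_nth)
  also have "\<dots> \<longleftrightarrow> gviol ((!) nm ` M) ((!) nm ` N) ?L" by (simp add: gviol_def case_prod_beta)
  finally show ?thesis .
qed

lemma stable_gstable:
  assumes MN: "M \<subseteq> {..<length nm}" "N \<subseteq> {..<length nm}"
  shows "stable M N \<longleftrightarrow> gstable Ls ((!) nm ` M) ((!) nm ` N)"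
  using viol_gviol[OF MN] by (auto simp: stable_def gstable_def all_set_conv_all_nth)

text \<open>Injectivity of the numbering carries proper inclusion between index sets and name sets
  in both directions; \<open>gans_subset_atoms\<close> ensures that no answer set is missed.\<close>

lemma gans_eq: "gans Ls = (\<lambda>M. (!) nm ` M) ` {M. M \<subseteq> {..<length nm} \<and> good M}"
proof (intro equalityI subsetI)
  fix A assume A: "A \<in> gans Ls"
  then have AU: "A \<subseteq> set nm" using gans_subset_atoms at by blast
  define M where "M = {i. i < length nm \<and> nm ! i \<in> A}"
  have M: "M \<subseteq> {..<length nm}" by (auto simp: M_def)
  have im: "(!) nm ` M = A"
  proof (intro equalityI subsetI)
    fix a assume "a \<in> A"
    then obtain i where "i < length nm" "nm ! i = a" using AU by (meson in_set_conv_nth subsetD)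
    then show "a \<in> (!) nm ` M" using \<open>a \<in> A\<close> by (auto simp: M_def)
  qed (auto simp: M_def)
  have "good M" unfolding good_iff[OF M]
  proof (intro conjI allI impI)
    show "stable M M" using A by (simp add: stable_gstable[OF M M] im gans_def)
    fix N assume N: "N \<subset> M"
    then have N': "N \<subseteq> {..<length nm}" using M by blast
    have "(!) nm ` N \<subset> (!) nm ` M"
    proof
      show "(!) nm ` N \<subseteq> (!) nm ` M" using N by auto
      obtain i where i: "i \<in> M" "i \<notin> N" using N by blast
      then have "nm ! i \<notin> (!) nm ` N" using nth_image_iff[OF _ N'] M by auto
      then show "(!) nm ` N \<noteq> (!) nm ` M" using i by auto
    qed
    then show "\<not> stable M N" using A by (simp add: stable_gstable[OF M N'] im gans_def)
  qed
  then show "A \<in> (\<lambda>M. (!) nm ` M) ` {M. M \<subseteq> {..<length nm} \<and> good M}" using M im by blast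
next
  fix A assume "A \<in> (\<lambda>M. (!) nm ` M) ` {M. M \<subseteq> {..<length nm} \<and> good M}"
  then obtain M where M: "M \<subseteq> {..<length nm}" "good M" "A = (!) nm ` M" by auto
  have g: "stable M M" "\<forall>N. N \<subset> M \<longrightarrow> \<not> stable M N" using M(2) good_iff[OF M(1)] by auto
  have "\<not> gstable Ls A B" if B: "B \<subset> A" for B
  proof -
    define N where "N = {i \<in> M. nm ! i \<in> B}"
    have im: "(!) nm ` N = B" using B M(3) by (auto simp: N_def)
    then have "N \<noteq> M" using B M(3) by auto
    then have "N \<subset> M" by (auto simp: N_def)
    moreover have "N \<subseteq> {..<length nm}" using M(1) by (auto simp: N_def)
    ultimately show ?thesis using g(2) stable_gstable[OF M(1), of N] im M(3) by simp
  qed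
  then show "A \<in> gans Ls" using g(1) stable_gstable[OF M(1) M(1)] M(3) by (auto simp: gans_def)
qed

lemma output_represents:
  assumes g: "\<forall>i<length nm. g i = nm ! i"
  shows "represents_family (concat (map (\<lambda>v. if good (Mset v) then outM g (Mset v) else []) [0..<2 ^ length nm])) (gans Ls)"
proof -
  let ?l = "\<lambda>M. map g (filter (\<lambda>i. i \<in> M) [0..<length nm])"
  let ?vs = "filter (\<lambda>v. good (Mset v)) [0..<2 ^ length nm]"
  let ?Ms = "map (\<lambda>v. ?l (Mset v)) ?vs"
  have card: "card (Mset v) = length (?l (Mset v))" for v
  proof -
    have "Mset v = set (filter (\<lambda>i. i \<in> Mset v) [0..<length nm])" using Mset_subset by auto
    then have "card (Mset v) = length (filter (\<lambda>i. i \<in> Mset v) [0..<length nm])"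
      by (metis distinct_card distinct_filter distinct_upt)
    then show ?thesis by simp
  qed
  have out: "concat (map (\<lambda>v. if good (Mset v) then outM g (Mset v) else []) vs) =
    concat (map (\<lambda>M. length M # M) (map (\<lambda>v. ?l (Mset v)) (filter (\<lambda>v. good (Mset v)) vs)))" for vs
    by (induction vs) (auto simp: outM_def card)
  have set_l: "set (?l (Mset v)) = (!) nm ` Mset v" for v
    using g Mset_subset[of v] by (auto simp: image_iff)
  have dl: "distinct (?l (Mset v))" for v
    using dist g by (auto simp: distinct_map inj_on_def nth_eq_iff_index_eq)
  have inj: "inj_on (\<lambda>M. (!) nm ` M) {M. M \<subseteq> {..<length nm}}"
  proof (rule inj_onI)
    fix M N assume MN: "M \<in> {M. M \<subseteq> {..<length nm}}" "N \<in> {M. M \<subseteq> {..<length nm}}" and e: "(!) nm ` M = (!) nm ` N"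
    show "M = N" using nth_image_iff[of _ M] nth_image_iff[of _ N] MN e by auto
  qed
  have injv: "inj_on (\<lambda>v. (!) nm ` Mset v) (set ?vs)"
  proof (rule inj_onI)
    fix v w assume vw: "v \<in> set ?vs" "w \<in> set ?vs" "(!) nm ` Mset v = (!) nm ` Mset w"
    then have "Mset v = Mset w" using inj_onD[OF inj] Mset_subset by blast
    then show "v = w" using bij_Mset vw by (auto simp: bij_betw_def inj_on_def)
  qed
  have sets: "set (map set ?Ms) = gans Ls"
  proof -
    have "set (map set ?Ms) = (\<lambda>v. (!) nm ` Mset v) ` {v. v < 2 ^ length nm \<and> good (Mset v)}"
      using set_l by auto
    also have "\<dots> = (\<lambda>M. (!) nm ` M) ` {M. M \<subseteq> {..<length nm} \<and> good M}"
    proof -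
      have "{M. M \<subseteq> {..<length nm} \<and> good M} = Mset ` {v. v < 2 ^ length nm \<and> good (Mset v)}"
      proof (intro equalityI subsetI)
        fix M assume M: "M \<in> {M. M \<subseteq> {..<length nm} \<and> good M}"
        then have "M \<in> Mset ` {..<2 ^ length nm}" using bij_Mset by (simp add: bij_betw_def)
        then show "M \<in> Mset ` {v. v < 2 ^ length nm \<and> good (Mset v)}" using M by blast
      qed (use Mset_subset in auto)
      then show ?thesis by (simp add: image_image)
    qed
    finally show ?thesis using gans_eq by simp
  qed
  have "distinct (map set ?Ms)"
  proof -
    have "map set ?Ms = map (\<lambda>v. (!) nm ` Mset v) ?vs" using set_l by simp
    then show ?thesis using injv by (simp only: distinct_map distinct_filter distinct_upt)
  qed
  then show ?thesis unfolding represents_family_def out using dl sets by (intro exI[of _ ?Ms]) auto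
qed

end

section \<open>Total running time\<close>

lemma solve:
  assumes c: "rparser c ok enc" and ok: "\<forall>L\<in>set Rs. ok L \<and> length L \<le> 3"
    and x: "x = length Rs # concat (map enc Rs)"
  defines "u \<equiv> card (\<Union>L\<in>set Rs. snd ` set L)"
  shows "\<exists>t s. big (Seq (PARSE c) MAIN) (init_st x) t s \<and> represents_family (oo s) (gans Rs) \<and>
    real t \<le> 1000000 * real ((\<Sum>L\<leftarrow>Rs. length L + 1) + 1) * (real u + 1)\<^sup>2 * (91 / 40) ^ u"
proof -
  let ?S = "\<Sum>L\<leftarrow>Rs. length L + 1"
  have P: "wp (PARSE c) (\<lambda>t s'. \<exists>nm. PS s' nm Rs \<and> vv s' Vend = 3 * length Rs \<and> t \<le> 300 * (u + 1) * ?S + 40) (init_st x)"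
    unfolding u_def using PARSE_correct[OF c _ x] ok by blast
  have mp: "moda (PARSE c) \<subseteq> {NAME, KIND, IDX}" "nowr (PARSE c)"
    using c by (auto simp: rparser_def PARSE_def LOOP_def)
  have "wp (PARSE c) (\<lambda>t. wp MAIN (\<lambda>w s'. represents_family (oo s') (gans Rs) \<and>
    real (t + w) \<le> 1000000 * real (?S + 1) * (real u + 1)\<^sup>2 * (91 / 40) ^ u)) (init_st x)"
  proof (rule wp_use[OF P])
    fix t :: nat and s :: st
    assume "\<exists>nm. PS s nm Rs \<and> vv s Vend = 3 * length Rs \<and> t \<le> 300 * (u + 1) * ?S + 40" and sb: "same_but (PARSE c) (init_st x) s"
    then obtain nm where ps: "PS s nm Rs" and e: "vv s Vend = 3 * length Rs" and t: "t \<le> 300 * (u + 1) * ?S + 40" by blast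
    have nm: "vv s Vn = length nm" "\<forall>i<length nm. aa s NAME i = nm ! i" "layout (aa s KIND) (aa s IDX) nm Rs" "distinct nm"
      "set nm = (\<Union>L\<in>set Rs. snd ` set L)" using ps by (auto simp: PS_def names_def)
    have u: "length nm = u" using nm(4,5) distinct_card u_def by metis
    have z: "aa s MM = (\<lambda>_. 0)" "aa s NN = (\<lambda>_. 0)" "aa s DIG = (\<lambda>_. 0)" "oo s = []"
      using sb mp by (auto simp: same_but_def init_st_def)
    interpret slots "length nm" "length Rs" "aa s KIND" "aa s IDX" .
    have len3: "\<forall>L\<in>set Rs. length L \<le> 3" using ok by blast
    have env: "env s" using nm e by (simp add: env_def)
    show "wp MAIN (\<lambda>w s'. represents_family (oo s') (gans Rs) \<and>
      real (t + w) \<le> 1000000 * real (?S + 1) * (real u + 1)\<^sup>2 * (91 / 40) ^ u) s"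
    proof (rule wp_mono[OF MAIN_correct[OF env z(1-3)]])
      fix w :: nat and s' :: st
      assume A: "oo s' = oo s @ concat (map (\<lambda>v. if good (Mset v) then outM (aa s NAME) (Mset v) else []) [0..<2 ^ length nm]) \<and>
        w \<le> 5000 * base * (\<Sum>v<2 ^ length nm. 1 + work (Mset v)) + 10"
      have rep: "represents_family (oo s') (gans Rs)"
        using output_represents[OF nm(3,4,5) len3 nm(2)] A z by simp
      let ?g = "(91 / 40) ^ u :: real" and ?n = "(real u + 1)\<^sup>2"
      have g1: "1 \<le> ?g" by (intro one_le_power) simp
      have R: "length Rs \<le> ?S" by (induction Rs) auto
      have "real (\<Sum>v<2 ^ length nm. 1 + work (Mset v)) \<le> 130 * (91 / 40) ^ length nm"
        by (rule sum_work_le) (rule idx_less[OF nm(3,4,5) len3])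
      then have s: "real (\<Sum>v<2 ^ length nm. 1 + work (Mset v)) \<le> 130 * ?g" by (simp add: u)
      have b: "real base \<le> real (?S + 1) * ?n"
      proof -
        have "base \<le> (?S + 1) * (u + 1)\<^sup>2" unfolding u[symmetric] base_def using R by (intro mult_le_mono1) simp
        then have "real base \<le> real ((?S + 1) * (u + 1)\<^sup>2)" by (simp only: of_nat_le_iff)
        then show ?thesis by (simp add: algebra_simps)
      qed
      define Y where "Y = real (?S + 1) * ?n * ?g"
      have sq: "real u + 1 \<le> ?n" by (simp add: power2_eq_square)
      have Y1: "real (?S + 1) * (real u + 1) * 1 \<le> Y" unfolding Y_def using g1 sq by (intro mult_mono) auto
      have "real w \<le> 5000 * real base * real (\<Sum>v<2 ^ length nm. 1 + work (Mset v)) + 10"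
        using A by (metis (no_types, lifting) of_nat_add of_nat_le_iff of_nat_mult of_nat_numeral)
      also have "\<dots> \<le> 5000 * (real (?S + 1) * ?n) * (130 * ?g) + 10"
        using b s by (intro add_mono mult_mono) (auto intro: sum_nonneg)
      also have "\<dots> = 650000 * Y + 10" by (simp add: Y_def)
      finally have w: "real w \<le> 650000 * Y + 10" .
      have "real t \<le> real (300 * (u + 1) * ?S + 40)" using t by (simp only: of_nat_le_iff)
      also have "\<dots> \<le> 300 * (real (?S + 1) * (real u + 1)) + 40" by (simp add: algebra_simps)
      also have "\<dots> \<le> 300 * Y + 40" using Y1 by simp
      finally have t': "real t \<le> 300 * Y + 40" .
      have "1 * 1 * 1 \<le> real (?S + 1) * (real u + 1) * 1" by (intro mult_mono) auto
      then have "1 \<le> Y" using Y1 by linarith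
      then have "real (t + w) \<le> 1000000 * Y" using w t' by simp
      then show "represents_family (oo s') (gans Rs) \<and>
        real (t + w) \<le> 1000000 * real (?S + 1) * (real u + 1)\<^sup>2 * (91 / 40) ^ u"
        using rep by (simp only: Y_def mult.assoc)
    qed
  qed
  then have "wp (Seq (PARSE c) MAIN) (\<lambda>t s'. represents_family (oo s') (gans Rs) \<and>
    real t \<le> 1000000 * real (?S + 1) * (real u + 1)\<^sup>2 * (91 / 40) ^ u) (init_st x)"
    unfolding wp_Seq .
  then show ?thesis unfolding wp_def by blast
qed


lemma computes_mono: "computes prog x y t w \<Longrightarrow> w \<le> w' \<Longrightarrow> computes prog x y t w'"
  unfolding computes_def by (meson le_trans)

lemma computes_in_time_of_com:
  assumes c: "\<And>i x. repI x i \<Longrightarrow> \<exists>t s. big c (init_st x) t s \<and> repO (oo s) (F i) \<and>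
    real (10 * length x + 3 + t) \<le> K * max 1 (f i)"
  shows "computes_in_time (prologue @ ccom c 12) repI repO F f"
  unfolding computes_in_time_def
proof (rule exI[of _ K], rule exI[of _ "maxcc c + 6"], intro allI impI)
  fix i x assume "repI x i"
  from c[OF this] obtain t s where b: "big c (init_st x) t s" "repO (oo s) (F i)" "real (10 * length x + 3 + t) \<le> K * max 1 (f i)"
    by blast
  let ?t = "10 * length x + 3 + t" and ?m = "maxcc c"
  define y where "y = 2 + length x + Max (insert 0 (set x)) + ?t"
  \<comment> \<open>The exponent may not depend on the input, so constants are absorbed into a power
    of y \<ge> 2: with m for the largest constant of the command, 8 * (y + m) + 8 \<le> y * (12 + 4
    * m) \<le> y ^ (m + 6).\<close>
  have "12 + 4 * m \<le> 2 ^ (m + 5)" for m :: nat by (induction m) (auto simp: power_add)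
  from this[of ?m] have "y * (12 + 4 * ?m) \<le> y * 2 ^ (?m + 5)" by (rule mult_le_mono2)
  also have "\<dots> \<le> y * y ^ (?m + 5)" by (intro mult_le_mono2 power_mono) (auto simp: y_def)
  also have "\<dots> = y ^ (?m + 6)" by (simp add: eval_nat_numeral)
  finally have p: "y * (12 + 4 * ?m) \<le> y ^ (?m + 6)" .
  have "2 * (4 * ?m + 4) \<le> y * (4 * ?m + 4)" by (intro mult_le_mono1) (simp add: y_def)
  then have "8 * (y + ?m) + 8 \<le> y * (12 + 4 * ?m)" by (simp add: algebra_simps)
  moreover have "8 * (1 + ?m + length x + Max (insert 0 (set x)) + t) + 8 \<le> 8 * (y + ?m) + 8"
  proof -
    have "8 * (1 + m + l + mx + t) + 8 \<le> 8 * (2 + l + mx + (10 * l + 3 + t) + m) + 8" for m l mx t :: nat by simp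
    then show ?thesis unfolding y_def .
  qed
  ultimately have "8 * (1 + ?m + length x + Max (insert 0 (set x)) + t) + 8 \<le> y ^ (?m + 6)" using p by linarith
  from computes_mono[OF ram_of_com[OF b(1)] this]
  show "\<exists>t y. computes (prologue @ ccom c 12) x y t ((2 + length x + Max (insert 0 (set x)) + t) ^ (?m + 6)) \<and>
    repO y (F i) \<and> real t \<le> K * max 1 (f i)" using b(2,3) unfolding y_def by blast
qed

text \<open>Without atoms the product vanishes and the maximum with 1 takes over; then at most one
  rule is left and the time is constant. Otherwise m and u are at least 1 and absorb all additive
  constants.\<close>

lemma final_bound:
  assumes t: "real t \<le> 1000000 * real (m + R + 1) * (real u + 1)\<^sup>2 * (91 / 40) ^ u"
    and R: "R \<le> m + 1" and u: "u = 0 \<Longrightarrow> m = 0" "u \<le> m" and l: "l \<le> 1 + 3 * R + 3 * m"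
  shows "real (10 * l + 3 + t) \<le> 100000000 * max 1 (real m * real u ^ 2 * d_const ^ u)"
proof (cases "u = 0")
  case True
  then have "m = 0" "R \<le> 1" "l \<le> 4" using u R l by auto
  moreover then have "real t \<le> 2000000" using t True by simp
  ultimately have "real (10 * l + 3 + t) \<le> 100000000 * 1" by simp
  also have "\<dots> \<le> 100000000 * max 1 (real m * real u ^ 2 * d_const ^ u)" by simp
  finally show ?thesis .
next
  case False
  then have m: "1 \<le> real u" "1 \<le> real m" using u(2) by auto
  define D where "D = d_const ^ u"
  have gD: "(91 / 40) ^ u \<le> D" unfolding D_def using d_const_bounds by (intro power_mono) auto
  have D1: "1 \<le> D" unfolding D_def using d_const_bounds by (intro one_le_power) auto
  let ?Z = "real m * real u ^ 2 * D"
  have u2: "1 \<le> real u ^ 2" using m by (intro one_le_power)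
  have "(real u + 1)\<^sup>2 \<le> (2 * real u)\<^sup>2" using m by (intro power_mono) auto
  then have n2: "(real u + 1)\<^sup>2 \<le> 4 * real u ^ 2" by (simp add: power_mult_distrib)
  have R': "real R \<le> real m + 1" using R by linarith
  have "real t \<le> 1000000 * real (m + R + 1) * (real u + 1)\<^sup>2 * (91 / 40) ^ u" by (rule t)
  also have "\<dots> \<le> 1000000 * (4 * real m) * (4 * real u ^ 2) * D"
    using R' m n2 gD by (intro mult_mono) auto
  also have "\<dots> = 16000000 * ?Z" by simp
  finally have t': "real t \<le> 16000000 * ?Z" .
  have "real m * 1 * 1 \<le> ?Z" using u2 D1 by (intro mult_mono) auto
  then have mZ: "real m \<le> ?Z" by simp
  have "real l \<le> real (1 + 3 * R + 3 * m)" using l by (simp only: of_nat_le_iff)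
  then have "real (10 * l + 3) \<le> 103 * real m" using R' m by simp
  moreover have "real (10 * l + 3 + t) = real (10 * l + 3) + real t" by simp
  ultimately have "real (10 * l + 3 + t) \<le> 100000000 * ?Z" using t' mZ m by linarith
  also have "\<dots> \<le> 100000000 * max 1 ?Z" by simp
  finally show ?thesis by (simp add: D_def)
qed

text \<open>A repetition-free list contains the empty rule at most once, and every other rule has an
  occurrence of its own. So the number of rules is bounded by m + 1 although m counts only
  atoms.\<close>

lemma length_le_sum_length:
  assumes "distinct Ls"
  shows "length Ls \<le> (\<Sum>L\<leftarrow>Ls. length L) + (if [] \<in> set Ls then 1 else 0)"
  using assms
proof (induction Ls)
  case (Cons L Ls)
  then show ?case by (cases L) (auto split: if_splits)
qed simp

lemma solve_in_time:
  assumes c: "rparser c ok enc" and ok: "\<forall>L\<in>set Rs. ok L \<and> length L \<le> 3"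
    and x: "x = length Rs # concat (map enc Rs)" and enc: "\<And>L. ok L \<Longrightarrow> length (enc L) \<le> 3 + 3 * length L"
    and d: "distinct Rs"
    and m: "m = (\<Sum>L\<leftarrow>Rs. length L)" and u: "u = card (\<Union>L\<in>set Rs. snd ` set L)"
  shows "\<exists>t s. big (Seq (PARSE c) MAIN) (init_st x) t s \<and> represents_family (oo s) (gans Rs) \<and>
    real (10 * length x + 3 + t) \<le> 100000000 * max 1 (real m * real u ^ 2 * d_const ^ u)"
proof -
  obtain t s where ts: "big (Seq (PARSE c) MAIN) (init_st x) t s" "represents_family (oo s) (gans Rs)"
    "real t \<le> 1000000 * real ((\<Sum>L\<leftarrow>Rs. length L + 1) + 1) * (real u + 1)\<^sup>2 * (91 / 40) ^ u"
    using solve[OF c ok x] unfolding u by blast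
  have S: "(\<Sum>L\<leftarrow>Rs. length L + 1) = m + length Rs" unfolding m by (induction Rs) auto
  have "real (10 * length x + 3 + t) \<le> 100000000 * max 1 (real m * real u ^ 2 * d_const ^ u)"
  proof (rule final_bound)
    show "real t \<le> 1000000 * real (m + length Rs + 1) * (real u + 1)\<^sup>2 * (91 / 40) ^ u" using ts(3) S by simp
    show "length Rs \<le> m + 1" using length_le_sum_length[OF d] m by (auto split: if_splits)
    show "m = 0" if "u = 0"
    proof -
      have "(\<Union>L\<in>set Rs. snd ` set L) = {}" using that u by simp
      then have "\<forall>L\<in>set Rs. L = []" by auto
      then show ?thesis unfolding m by (induction Rs) auto
    qed
    have "card (\<Union>L\<in>set Rs. snd ` set L) \<le> (\<Sum>L\<leftarrow>Rs. length L)"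
    proof (induction Rs)
      case (Cons L Rs)
      have "card (snd ` set L \<union> (\<Union>L\<in>set Rs. snd ` set L)) \<le> card (snd ` set L) + card (\<Union>L\<in>set Rs. snd ` set L)"
        by (rule card_Un_le)
      moreover have "card (snd ` set L) \<le> length L"
        by (meson card_image_le card_length finite_set le_trans)
      ultimately show ?case using Cons by simp
    qed simp
    then show "u \<le> m" using u m by simp
    have "length (concat (map enc Rs)) \<le> 3 * length Rs + 3 * (\<Sum>L\<leftarrow>Rs. length L)"
      using ok
    proof (induction Rs)
      case (Cons L Rs)
      then show ?case using enc[of L] by auto
    qed simp
    then show "length x \<le> 1 + 3 * length Rs + 3 * m" unfolding x m by simp
  qed
  then show ?thesis using ts by blast
qed


section \<open>The two input formats\<close>

definition readC :: com where
  "readC = Seq (Asg Vkind (Dif (Num 2) (Ld INP (Var Vpos)))) (Seq (Asg Vname (Ld INP (Inc (Var Vpos))))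
     (Asg Vpos (Inc (Inc (Var Vpos)))))"

definition readP :: com where
  "readP = Seq (Asg Vkind (Var Vk)) (Seq (Asg Vname (Ld INP (Var Vpos))) (Asg Vpos (Inc (Var Vpos))))"

text \<open>The kind is 2 minus the sign: a positive literal (sign 1) becomes a head atom and a
  negative one (sign 0) a body atom, so a clause is read as the equivalent rule.\<close>

lemma reader_readC: "reader readC (\<lambda>_ e. fst e \<in> {1, 2}) (\<lambda>e. [2 - fst e, snd e])"
  unfolding reader_def
proof (intro conjI allI impI)
  fix s and e :: "nat \<times> nat" and xs
  assume e: "fst e \<in> {1, 2}" and i: "inp s ([2 - fst e, snd e] @ xs)"
  have "aa s INP (vv s Vpos) = 2 - fst e" "aa s INP (Suc (vv s Vpos)) = snd e"
    "\<forall>i<length xs. aa s INP (Suc (Suc (vv s Vpos + i))) = xs ! i"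
    using i by (simp_all add: All_less_Suc2)
  then show "wp readC (\<lambda>t s'. vv s' Vkind = fst e \<and> vv s' Vname = snd e \<and> inp s' xs \<and> t \<le> 100) s"
    using e by (auto simp: readC_def inp_def)
qed (auto simp: readC_def)

lemma reader_readP: "reader readP (\<lambda>k e. fst e = k) (\<lambda>e. [snd e])"
  by (auto simp: reader_def readP_def inp_def)

definition okC :: "grule \<Rightarrow> bool" where
  "okC L \<longleftrightarrow> length L \<le> 3 \<and> (\<forall>e\<in>set L. fst e \<in> {1, 2})"

definition encC :: "grule \<Rightarrow> nat list" where
  "encC L = length L # concat (map (\<lambda>e. [2 - fst e, snd e]) L)"

lemma rparser_cnf: "rparser (BLK 0 readC) okC encC"
  unfolding rparser_def
proof (intro conjI allI impI)
  fix s nm Ls L xs and U :: "nat set"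
  assume A: "finite U" "PS s nm (Ls @ [[]])" "vv s Vp = 3 * length Ls" "inp s (encC L @ xs)" "okC L"
    "(\<Union>L\<in>set (Ls @ [L]). snd ` set L) \<subseteq> U"
  have "wp (BLK 0 readC) (\<lambda>t s'. \<exists>nm'. PS s' nm' (Ls @ [[] @ L]) \<and> vv s' Vp = 3 * length Ls + length ([] :: grule) + length L \<and>
    inp s' xs \<and> t \<le> 300 * (card U + 1) * length L + 40) s"
    by (rule BLK_correct[OF reader_readC A(1,2)]) (use A in \<open>auto simp: encC_def okC_def\<close>)
  then show "wp (BLK 0 readC) (\<lambda>t s'. \<exists>nm'. PS s' nm' (Ls @ [L]) \<and> inp s' xs \<and> t \<le> 300 * (card U + 1) * length L + 140) s"
    by (rule wp_mono) auto
qed (auto simp: BLK_def INNER_def readC_def ENTRY_def)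

definition prule :: "atom list \<times> atom list \<times> atom list \<Rightarrow> grule" where
  "prule r = (case r of (A, B, C) \<Rightarrow> map (Pair 1) A @ map (Pair 2) B @ map (Pair 3) C)"

text \<open>Recovers the three blocks of a rule from its flat form, so that the encoding is a
  function of the flat rule alone, as \<open>rparser\<close> requires.\<close>

definition atoms_of_kind :: "nat \<Rightarrow> grule \<Rightarrow> nat list" where
  "atoms_of_kind k L = map snd (filter (\<lambda>e. fst e = k) L)"

lemma atoms_of_kind_prule [simp]:
  "atoms_of_kind 1 (prule (A, B, C)) = A" "atoms_of_kind (Suc 0) (prule (A, B, C)) = A"
  "atoms_of_kind 2 (prule (A, B, C)) = B" "atoms_of_kind 3 (prule (A, B, C)) = C"
  by (simp_all add: atoms_of_kind_def prule_def filter_map o_def)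

definition okP :: "grule \<Rightarrow> bool" where
  "okP L \<longleftrightarrow> length L \<le> 3 \<and> L \<in> range prule"

definition encP :: "grule \<Rightarrow> nat list" where
  "encP L = (let A = atoms_of_kind 1 L; B = atoms_of_kind 2 L; C = atoms_of_kind 3 L in
     length A # A @ length B # B @ length C # C)"

definition RPRG :: com where
  "RPRG = Seq (BLK 1 readP) (Seq (BLK 2 readP) (BLK 3 readP))"

lemma rparser_program: "rparser RPRG okP encP"
  unfolding rparser_def
proof (intro conjI allI impI)
  fix s nm Ls L xs and U :: "nat set"
  assume A: "finite U" "PS s nm (Ls @ [[]])" "vv s Vp = 3 * length Ls" "inp s (encP L @ xs)" "okP L"
    "(\<Union>L\<in>set (Ls @ [L]). snd ` set L) \<subseteq> U"
  obtain a b c where L: "L = prule (a, b, c)" using A(5) by (auto simp: okP_def)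
  let ?a = "map (Pair (1::nat)) a" and ?b = "map (Pair (2::nat)) b" and ?c = "map (Pair (3::nat)) c"
  let ?d = "\<lambda>e::nat \<times> nat. [snd e]"
  have cat: "concat (map ?d (map (Pair k) l)) = l" for k l by (induction l) auto
  have Leq: "L = ?a @ ?b @ ?c" by (simp add: L prule_def)
  have len: "length a + length b + length c \<le> 3" using A(5) by (simp add: okP_def Leq)
  have enc: "encP L @ xs = length ?a # concat (map ?d ?a) @ (length ?b # concat (map ?d ?b) @ (length ?c # concat (map ?d ?c) @ xs))"
    unfolding cat by (simp add: encP_def L)
  have U: "(\<Union>L\<in>set (Ls @ [[] @ ?a]). snd ` set L) \<subseteq> U" "(\<Union>L\<in>set (Ls @ [?a @ ?b]). snd ` set L) \<subseteq> U"
    "(\<Union>L\<in>set (Ls @ [(?a @ ?b) @ ?c]). snd ` set L) \<subseteq> U"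
    using A(6) unfolding Leq by (auto simp: image_Un image_image)
  let ?t = "\<lambda>l. 300 * (card U + 1) * length l + 40"
  have 1: "wp (BLK 1 readP) (\<lambda>t s'. \<exists>nm'. PS s' nm' (Ls @ [[] @ ?a]) \<and> vv s' Vp = 3 * length Ls + length ([] :: grule) + length ?a \<and>
    inp s' (length ?b # concat (map ?d ?b) @ (length ?c # concat (map ?d ?c) @ xs)) \<and> t \<le> ?t ?a) s"
    by (rule BLK_correct[OF reader_readP A(1,2) _ A(4)[unfolded enc] _ _ U(1)]) (use A(3) len in auto)
  show "wp RPRG (\<lambda>t s'. \<exists>nm'. PS s' nm' (Ls @ [L]) \<and> inp s' xs \<and> t \<le> 300 * (card U + 1) * length L + 140) s"
    unfolding RPRG_def wp_Seq
  proof (rule wp_mono[OF 1])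
    fix t1 :: nat and s1 :: st
    assume "\<exists>nm'. PS s1 nm' (Ls @ [[] @ ?a]) \<and> vv s1 Vp = 3 * length Ls + length ([] :: grule) + length ?a \<and>
      inp s1 (length ?b # concat (map ?d ?b) @ (length ?c # concat (map ?d ?c) @ xs)) \<and> t1 \<le> ?t ?a"
    then obtain nm1 where s1: "PS s1 nm1 (Ls @ [?a])" "vv s1 Vp = 3 * length Ls + length ?a"
      "inp s1 (length ?b # concat (map ?d ?b) @ (length ?c # concat (map ?d ?c) @ xs))" "t1 \<le> ?t ?a" by auto
    have 2: "wp (BLK 2 readP) (\<lambda>t s'. \<exists>nm'. PS s' nm' (Ls @ [?a @ ?b]) \<and> vv s' Vp = 3 * length Ls + length ?a + length ?b \<and>
      inp s' (length ?c # concat (map ?d ?c) @ xs) \<and> t \<le> ?t ?b) s1"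
      by (rule BLK_correct[OF reader_readP A(1) s1(1,2,3) _ _ U(2)]) (use len in auto)
    show "wp (BLK 2 readP) (\<lambda>t. wp (BLK 3 readP) (\<lambda>u s'. \<exists>nm'. PS s' nm' (Ls @ [L]) \<and> inp s' xs \<and>
        t1 + (t + u) \<le> 300 * (card U + 1) * length L + 140)) s1"
    proof (rule wp_mono[OF 2])
      fix t2 :: nat and s2 :: st
      assume "\<exists>nm'. PS s2 nm' (Ls @ [?a @ ?b]) \<and> vv s2 Vp = 3 * length Ls + length ?a + length ?b \<and>
        inp s2 (length ?c # concat (map ?d ?c) @ xs) \<and> t2 \<le> ?t ?b"
      then obtain nm2 where s2: "PS s2 nm2 (Ls @ [?a @ ?b])" "vv s2 Vp = 3 * length Ls + length (?a @ ?b)"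
        "inp s2 (length ?c # concat (map ?d ?c) @ xs)" "t2 \<le> ?t ?b" by auto
      have 3: "wp (BLK 3 readP) (\<lambda>t s'. \<exists>nm'. PS s' nm' (Ls @ [(?a @ ?b) @ ?c]) \<and>
        vv s' Vp = 3 * length Ls + length (?a @ ?b) + length ?c \<and> inp s' xs \<and> t \<le> ?t ?c) s2"
        by (rule BLK_correct[OF reader_readP A(1) s2(1,2,3) _ _ U(3)]) (use len in auto)
      show "wp (BLK 3 readP) (\<lambda>u s'. \<exists>nm'. PS s' nm' (Ls @ [L]) \<and> inp s' xs \<and>
        t1 + (t2 + u) \<le> 300 * (card U + 1) * length L + 140) s2"
      proof (rule wp_mono[OF 3])
        fix t3 :: nat and s3 :: st
        assume B: "\<exists>nm'. PS s3 nm' (Ls @ [(?a @ ?b) @ ?c]) \<and>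
          vv s3 Vp = 3 * length Ls + length (?a @ ?b) + length ?c \<and> inp s3 xs \<and> t3 \<le> ?t ?c"
        have "300 * (card U + 1) * length L = 300 * (card U + 1) * length ?a + 300 * (card U + 1) * length ?b + 300 * (card U + 1) * length ?c"
          unfolding Leq by (simp add: distrib_left)
        then have "t1 + (t2 + t3) \<le> 300 * (card U + 1) * length L + 140" using s1(4) s2(4) B by auto
        then show "\<exists>nm'. PS s3 nm' (Ls @ [L]) \<and> inp s3 xs \<and> t1 + (t2 + t3) \<le> 300 * (card U + 1) * length L + 140"
          using B Leq by auto
      qed
    qed
  qed
qed (auto simp: RPRG_def BLK_def INNER_def readP_def ENTRY_def)

fun lit_entry :: "literal \<Rightarrow> nat \<times> nat" where
  "lit_entry (Pos a) = (1, a)"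
| "lit_entry (Neg a) = (2, a)"

lemma inj_lit_entry: "inj lit_entry"
proof (rule injI)
  fix l l' assume "lit_entry l = lit_entry l'"
  then show "l = l'" by (cases l; cases l') auto
qed

lemma snd_lit_entry [simp]: "snd (lit_entry l) = atom_of l" by (cases l) auto

text \<open>No entry has kind 3, so the value of \<open>gviol\<close> does not vary with its first
  argument and minimality in \<open>gans\<close> is minimality among the models.\<close>

lemma minimal_models_gans:
  assumes "T = set (map set Cs)"
  shows "minimal_models T = gans (map (map lit_entry) Cs)"
proof -
  have "gstable (map (map lit_entry) Cs) A B \<longleftrightarrow> cnf_model T B" for A B
  proof -
    have "\<not> gviol A B (map lit_entry C) \<longleftrightarrow> (\<exists>l\<in>set C. lit_true B l)" for C
    proof -
      have "\<not> (case lit_entry l of (k, a) \<Rightarrow> (k = 1 \<longrightarrow> a \<notin> B) \<and> (k = 2 \<longrightarrow> a \<in> B) \<and> (k = 3 \<longrightarrow> a \<notin> A)) \<longleftrightarrow> lit_true B l" for l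
        by (cases l) auto
      then show ?thesis by (simp add: gviol_def)
    qed
    then show ?thesis by (simp add: gstable_def cnf_model_def assms)
  qed
  then show ?thesis by (simp add: minimal_models_def minimal_set_def gans_def)
qed

lemma answer_sets_gans:
  assumes "P = set (map (\<lambda>(A, B, C). (set A, set B, set C)) Rs)"
  shows "answer_sets P = gans (map prule Rs)"
proof -
  have "gstable (map prule Rs) M N \<longleftrightarrow> program_model (reduct P M) N" for M N
  proof -
    have v: "\<not> gviol M N (prule (A, B, C)) \<longleftrightarrow> (set C \<inter> M = {} \<longrightarrow> set B \<subseteq> N \<longrightarrow> set A \<inter> N \<noteq> {})" for A B C
      by (auto simp: gviol_def prule_def)
    have "program_model (reduct P M) N \<longleftrightarrow>
      (\<forall>(A, B, C)\<in>P. C \<inter> M = {} \<longrightarrow> B \<subseteq> N \<longrightarrow> A \<inter> N \<noteq> {})"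
      by (fastforce simp: program_model_def reduct_def)
    also have "\<dots> \<longleftrightarrow> (\<forall>(A, B, C)\<in>set Rs. set C \<inter> M = {} \<longrightarrow> set B \<subseteq> N \<longrightarrow> set A \<inter> N \<noteq> {})"
      unfolding assms by (auto simp: case_prod_beta)
    also have "\<dots> \<longleftrightarrow> gstable (map prule Rs) M N"
    proof -
      have "(case r of (A, B, C) \<Rightarrow> set C \<inter> M = {} \<longrightarrow> set B \<subseteq> N \<longrightarrow> set A \<inter> N \<noteq> {}) \<longleftrightarrow> \<not> gviol M N (prule r)" for r
        by (cases r) (simp only: v split_conv)
      then show ?thesis by (simp add: gstable_def)
    qed
    finally show ?thesis by blast
  qed
  then show ?thesis by (simp add: answer_sets_def minimal_set_def gans_def)
qed

lemma cnf_in_time: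
  assumes "represents_cnf3 x T"
  shows "\<exists>t s. big (Seq (PARSE (BLK 0 readC)) MAIN) (init_st x) t s \<and> represents_family (oo s) (minimal_models T) \<and>
    real (10 * length x + 3 + t) \<le> 100000000 * max 1 (real (cnf_size T) * real (card (cnf_atoms T)) ^ 2
      * d_const ^ card (cnf_atoms T))"
proof -
  from assms obtain Cs where T: "cnf3 T" and x: "x = encode_cnf Cs" and dC: "\<forall>C\<in>set Cs. distinct C"
    and d: "distinct (map set Cs)" and e: "set (map set Cs) = T" by (auto simp: represents_cnf3_def)
  let ?Rs = "map (map lit_entry) Cs"
  have len: "length C \<le> 3" if "C \<in> set Cs" for C
  proof -
    have "set C \<in> T" using that e by auto
    then have "card (set C) \<le> 3" using T by (auto simp: cnf3_def)
    then show ?thesis using dC that distinct_card by metis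
  qed
  have kinds: "fst (lit_entry l) \<in> {1, 2}" for l by (cases l) auto
  have ok: "\<forall>L\<in>set ?Rs. okC L \<and> length L \<le> 3" using len kinds by (auto simp: okC_def)
  have lit: "[2 - fst (lit_entry l), snd (lit_entry l)] = encode_literal l" for l by (cases l) auto
  have x': "x = length ?Rs # concat (map encC ?Rs)"
    unfolding x encode_cnf_def encC_def by (simp add: o_def lit del: snd_lit_entry)
  \<comment> \<open>The clauses are distinct as sets, which turns the sum over the theory into a sum
    over the list.\<close>
  have m: "cnf_size T = (\<Sum>L\<leftarrow>?Rs. length L)"
  proof -
    have "cnf_size T = sum_list (map card (map set Cs))"
      unfolding cnf_size_def e[symmetric] using sum_list_distinct_conv_sum_set[OF d] by metis
    also have "\<dots> = (\<Sum>C\<leftarrow>Cs. length C)" using dC by (simp add: o_def distinct_card cong: map_cong)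
    also have "\<dots> = (\<Sum>L\<leftarrow>?Rs. length L)" by (simp add: o_def)
    finally show ?thesis .
  qed
  have at: "cnf_atoms T = (\<Union>L\<in>set ?Rs. snd ` set L)"
    unfolding cnf_atoms_def e[symmetric] by (simp add: image_image)
  have dR: "distinct ?Rs"
    using d inj_lit_entry by (simp add: distinct_map inj_on_def inj_map_eq_map)
  have "length (encC L) \<le> 3 + 3 * length L" for L
  proof -
    have "length (concat (map (\<lambda>e::nat \<times> nat. [2 - fst e, snd e]) L)) = 2 * length L" by (induction L) auto
    then show ?thesis by (simp add: encC_def)
  qed
  from solve_in_time[OF rparser_cnf ok x' this dR m arg_cong[where f = card, OF at]] show ?thesis
    unfolding minimal_models_gans[OF e[symmetric]] .
qed

lemma program_in_time:
  assumes "represents_program3 x P"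
  shows "\<exists>t s. big (Seq (PARSE RPRG) MAIN) (init_st x) t s \<and> represents_family (oo s) (answer_sets P) \<and>
    real (10 * length x + 3 + t) \<le> 100000000 * max 1 (real (program_size P) * real (card (program_atoms P)) ^ 2
      * d_const ^ card (program_atoms P))"
proof -
  let ?set = "\<lambda>(A, B, C). (set A, set B, set C)"
  from assms obtain Rs where P: "program3 P" and x: "x = encode_program Rs"
    and dR: "\<forall>(A, B, C)\<in>set Rs. distinct A \<and> distinct B \<and> distinct C"
    and d: "distinct (map ?set Rs)" and e: "set (map ?set Rs) = P" unfolding represents_program3_def by blast
  let ?Rs = "map prule Rs"
  have card: "card (set A) + card (set B) + card (set C) = length (prule (A, B, C))" if "(A, B, C) \<in> set Rs" for A B C
    using dR that by (auto simp: prule_def distinct_card)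
  have ok: "\<forall>L\<in>set ?Rs. okP L \<and> length L \<le> 3"
  proof
    fix L assume "L \<in> set ?Rs"
    then obtain A B C where r: "(A, B, C) \<in> set Rs" "L = prule (A, B, C)" by auto
    then have "(set A, set B, set C) \<in> P" using e by force
    then have "length L \<le> 3" using P card[OF r(1)] r(2) by (fastforce simp: program3_def)
    then show "okP L \<and> length L \<le> 3" using r(2) by (simp add: okP_def)
  qed
  have x': "x = length ?Rs # concat (map encP ?Rs)"
  proof -
    have "encP (prule r) = (\<lambda>(A, B, C). length A # A @ length B # B @ length C # C) r" for r
      by (cases r) (simp add: encP_def)
    then show ?thesis unfolding x encode_program_def by (simp add: o_def)
  qed
  have m: "program_size P = (\<Sum>L\<leftarrow>?Rs. length L)"
  proof -
    have "program_size P = sum_list (map (\<lambda>(A, B, C). card A + card B + card C) (map ?set Rs))"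
      unfolding program_size_def e[symmetric] using sum_list_distinct_conv_sum_set[OF d] by metis
    also have "\<dots> = (\<Sum>L\<leftarrow>?Rs. length L)"
      unfolding map_map by (rule arg_cong[where f = sum_list], rule map_cong[OF refl]) (use card in auto)
    finally show ?thesis .
  qed
  have at: "program_atoms P = (\<Union>L\<in>set ?Rs. snd ` set L)"
  proof -
    have "snd ` set (prule r) = (case r of (A, B, C) \<Rightarrow> set A \<union> set B \<union> set C)" for r
      by (cases r) (auto simp: prule_def image_Un image_image)
    then show ?thesis unfolding program_atoms_def e[symmetric] by (simp add: case_prod_beta)
  qed
  have "inj prule"
  proof (rule injI)
    fix r r' assume e: "prule r = prule r'"
    obtain A B C A' B' C' where r: "r = (A, B, C)" "r' = (A', B', C')" by (cases r; cases r')
    show "r = r'" using arg_cong[OF e, of "atoms_of_kind 1"] arg_cong[OF e, of "atoms_of_kind 2"]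
      arg_cong[OF e, of "atoms_of_kind 3"] by (simp add: r)
  qed
  then have "inj_on prule (set Rs)" by (rule inj_on_subset) simp
  moreover have "distinct Rs" using d by (simp add: distinct_map)
  ultimately have dP: "distinct ?Rs" by (simp add: distinct_map)
  have enc: "length (encP L) \<le> 3 + 3 * length L" if "okP L" for L
  proof -
    obtain A B C where "L = prule (A, B, C)" using \<open>okP L\<close> by (auto simp: okP_def)
    moreover have "length (prule (A, B, C)) = length A + length B + length C" by (simp add: prule_def)
    ultimately show ?thesis by (simp add: encP_def)
  qed
  from solve_in_time[OF rparser_program ok x' enc dP m arg_cong[where f = card, OF at]] show ?thesis
    unfolding answer_sets_gans[OF e[symmetric]] .
qed

theorem theorem2p5:
  shows "(\<exists>prog. computes_in_time prog represents_cnf3 represents_family minimal_models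
            (\<lambda>T. real (cnf_size T) * real (card (cnf_atoms T)) ^ 2
                  * d_const ^ card (cnf_atoms T)))
       \<and> (\<exists>prog. computes_in_time prog represents_program3 represents_family answer_sets
            (\<lambda>P. real (program_size P) * real (card (program_atoms P)) ^ 2
                  * d_const ^ card (program_atoms P)))
       \<and> \<bar>d_const - 2.2782\<bar> < 0.0005"
proof (intro conjI)
  show "\<exists>prog. computes_in_time prog represents_cnf3 represents_family minimal_models
            (\<lambda>T. real (cnf_size T) * real (card (cnf_atoms T)) ^ 2 * d_const ^ card (cnf_atoms T))"
    by (intro exI, rule computes_in_time_of_com, erule cnf_in_time)
  show "\<exists>prog. computes_in_time prog represents_program3 represents_family answer_sets
            (\<lambda>P. real (program_size P) * real (card (program_atoms P)) ^ 2 * d_const ^ card (program_atoms P))"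
    by (intro exI, rule computes_in_time_of_com, erule program_in_time)
  show "\<bar>d_const - 2.2782\<bar> < 0.0005" unfolding abs_less_iff using d_const_bounds by (auto simp: field_simps)
qed

end
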